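(* Assume that $0<\rho_1\le\rho_0\le\rho_2$ a.e. in $\Omega$, that $\mathbf{u}_0\in\mathbf{H}^1_0(\Omega)$ and that $\operatorname{div}\mathbf{u}_0=0$. Let $(\rho^n,\mathbf{u}^n,\hat{\mathbf{u}}^n,q^n,p^n,\boldsymbol\Sigma^n)_{0\le n\le N}$ be produced by the bi-projection scheme (described in the context). If $r\frac{\alpha_2^2}{\mu_1}\le\frac32$ and $\theta\le\frac12$, then, for all $1\le n\le N$, $$\|\sqrt{\rho^n}\,\mathbf{u}^n\|^2+\delta t\sum_{k=0}^{n-1}\|\sqrt{2\mu^{k+1}}\,\mathbf{D}\mathbf{u}^{k+1}\|^2+\frac{\delta t^2}{\rho_1}\|\nabla p^n\|^2+\frac{2\theta}{r}\delta t\,\|\boldsymbol\Sigma^n\|^2\le\|\sqrt{\rho^0}\,\mathbf{u}^0\|^2+\frac{\delta t^2}{\rho_1}\|\nabla p^0\|^2+\frac{2\theta}{r}\delta t\,\|\boldsymbol\Sigma^0\|^2.$$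
   Context: Setting: $T>0$, $\Omega$ is a bounded domain of $\mathbb{R}^3$ with boundary $\Gamma$ and unit outward normal $\mathbf{n}$. Bold function spaces are vector-valued. $\|\cdot\|$ is the $L^2(\Omega)$ norm. $\mathbf{D}\mathbf{u}=\frac12(\nabla\mathbf{u}+{}^T\nabla\mathbf{u})$. Tensor conventions: for $\boldsymbol\lambda\in\mathbb{R}^{3\times3}$, $|\boldsymbol\lambda|^2=\frac12\operatorname{tr}({}^T\boldsymbol\lambda\boldsymbol\lambda)$, and for tensor fields $\|\boldsymbol f\|^2=\int_\Omega|\boldsymbol f|^2$. $\Lambda=\{\boldsymbol\lambda\in\mathbb{R}^{3\times3}:|\boldsymbol\lambda|\le1,\ {}^T\boldsymbol\lambda=\boldsymbol\lambda,\ \operatorname{tr}\boldsymbol\lambda=0\}$ and $\mathbb{P}$ is the projection onto the closed convex set $\Lambda$, applied pointwise a.e. to tensor fields. $\boldsymbol\Lambda=\{\boldsymbol f\in L^2(\Omega)^{3\times3}: \boldsymbol f(x)\in\Lambda\text{ a.e.}\}$. Coefficients: the plastic viscosity $\mu$ and yield stress $\alpha$ are $\mathcal{C}^1$ functions of the density, $\mu$ positive and $\alpha$ non-negative; there are constants $\mu_1,\mu_2>0$, $\alpha_1,\alpha_2\ge0$ with $\mu_1\le\mu(s)\le\mu_2$ and $\alpha_1\le\alpha(s)\le\alpha_2$ for $s\in[\rho_1,\rho_2]$. (The discrete densities satisfy $\rho_1\le\rho^n\le\rho_2$ a.e.) Notation: $\tilde B(\mathbf{u},\mathbf{v})=(\mathbf{u}\cdot\nabla)\mathbf{v}+\frac{\mathbf{v}}2\operatorname{div}\mathbf{u}$.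 Bi-projection scheme: $N>0$ integer, $\delta t=T/N$, $t_n=n\,\delta t$, numerical parameters $r>0$, $\theta>0$. Initialization: $\rho^0=\rho_0$, $\mathbf{u}^0=\hat{\mathbf{u}}^0=\mathbf{u}_0$, $q^0=0$, with $p^0$ and $\boldsymbol\Sigma^0$ arbitrary (in the relevant spaces). For $0\le n\le N-1$: (1) $\rho^{n+1}$ is the viscosity solution of $\frac{\rho^{n+1}-\rho^n}{\delta t}+\hat{\mathbf{u}}^n\cdot\nabla\rho^{n+1}=0$, i.e. the limit as $\epsilon\to0$ (weak-$*$ in $L^\infty(\Omega)$) of the solutions $\rho_\epsilon^{n+1}\in H^1(\Omega)$ of $\frac{\rho_\epsilon^{n+1}-\rho^n}{\delta t}+\hat{\mathbf{u}}^n\cdot\nabla\rho_\epsilon^{n+1}-\epsilon\Delta\rho_\epsilon^{n+1}=0$, $\nabla\rho_\epsilon^{n+1}\cdot\mathbf{n}|_\Gamma=0$. Set $\mu^{n+1}=\mu(\rho^{n+1})$, $\alpha^{n+1}=\alpha(\rho^{n+1})$. (2) $(\mathbf{u}^{n+1},\boldsymbol\Sigma^{n+1})\in\mathbf{H}^1_0(\Omega)\times\boldsymbol\Lambda$ solves $$\tfrac1{\delta t}\big[\tfrac12(\rho^{n+1}+\rho^n)\mathbf{u}^{n+1}-\rho^n\mathbf{u}^n\big]+\tilde B(\rho^{n+1}\hat{\mathbf{u}}^n,\mathbf{u}^{n+1})-\operatorname{div}(2\mu^{n+1}\mathbf{D}\mathbf{u}^{n+1})+\nabla(p^n+q^n)=\operatorname{div}(\alpha^{n+1}\boldsymbol\Sigma^{n+1}),$$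 $$\boldsymbol\Sigma^{n+1}=\mathbb{P}\big(\boldsymbol\Sigma^{n+1}+r\alpha^{n+1}\mathbf{D}\mathbf{u}^{n+1}+\theta(\boldsymbol\Sigma^n-\boldsymbol\Sigma^{n+1})\big),\qquad \mathbf{u}^{n+1}|_\Gamma=0.$$ (3) $q^{n+1}$ solves $\Delta q^{n+1}=\frac{\rho_1}{\delta t}\operatorname{div}\mathbf{u}^{n+1}$, $\partial_{\mathbf{n}}q^{n+1}|_\Gamma=0$ (up to an irrelevant additive constant). (4) $p^{n+1}=p^n+q^{n+1}$ and $\hat{\mathbf{u}}^{n+1}=\mathbf{u}^{n+1}-\frac{\delta t}{\rho_1}\nabla q^{n+1}$. *)

theory Defs
  imports "HOL-Analysis.Analysis"
begin

text \<open>Fields are represented by functions on the whole space of which only the values on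
  \<open>\<Omega>\<close>, up to Lebesgue-null sets, matter.\<close>

definition ae_eq :: "(real^3) set \<Rightarrow> (real^3 \<Rightarrow> 'a) \<Rightarrow> (real^3 \<Rightarrow> 'a) \<Rightarrow> bool" where
  "ae_eq \<Omega> f g \<longleftrightarrow> (AE x in lebesgue_on \<Omega>. f x = g x)"

definition L2 :: "(real^3) set \<Rightarrow> (real^3 \<Rightarrow> 'a::euclidean_space) set" where
  "L2 \<Omega> = {f. f \<in> borel_measurable (lebesgue_on \<Omega>) \<and>
                integrable (lebesgue_on \<Omega>) (\<lambda>x. (norm (f x))\<^sup>2)}"

definition Linf :: "(real^3) set \<Rightarrow> (real^3 \<Rightarrow> real) set" where
  "Linf \<Omega> = {f. f \<in> borel_measurable (lebesgue_on \<Omega>) \<and>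
                  (\<exists>C. AE x in lebesgue_on \<Omega>. \<bar>f x\<bar> \<le> C)}"

definition L1loc :: "(real^3) set \<Rightarrow> (real^3 \<Rightarrow> real) set" where
  "L1loc \<Omega> = {f. \<forall>K. compact K \<and> K \<subseteq> \<Omega> \<longrightarrow> f absolutely_integrable_on K}"

definition l2norm :: "(real^3) set \<Rightarrow> (real^3 \<Rightarrow> 'a::euclidean_space) \<Rightarrow> real" where
  "l2norm \<Omega> f = sqrt (LINT x|lebesgue_on \<Omega>. (norm (f x))\<^sup>2)"

definition partial :: "3 \<Rightarrow> (real^3 \<Rightarrow> real) \<Rightarrow> real^3 \<Rightarrow> real" where
  "partial i f x = frechet_derivative f (at x) (axis i 1)"

primrec Ck :: "nat \<Rightarrow> (real^3 \<Rightarrow> real) \<Rightarrow> bool" where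
  "Ck 0 f \<longleftrightarrow> continuous_on UNIV f"
| "Ck (Suc k) f \<longleftrightarrow> (\<forall>x. f differentiable (at x)) \<and> (\<forall>i. Ck k (partial i f))"

definition test_functions :: "(real^3) set \<Rightarrow> (real^3 \<Rightarrow> real) set" where
  "test_functions \<Omega> = {\<phi>. (\<forall>k. Ck k \<phi>) \<and>
     compact (closure {x. \<phi> x \<noteq> 0}) \<and> closure {x. \<phi> x \<noteq> 0} \<subseteq> \<Omega>}"

definition has_weak_partial ::
    "(real^3) set \<Rightarrow> 3 \<Rightarrow> (real^3 \<Rightarrow> real) \<Rightarrow> (real^3 \<Rightarrow> real) \<Rightarrow> bool" where
  "has_weak_partial \<Omega> i f g \<longleftrightarrow> f \<in> L1loc \<Omega> \<and> g \<in> L1loc \<Omega> \<and>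
     (\<forall>\<phi>\<in>test_functions \<Omega>.
        (LINT x|lebesgue_on \<Omega>. f x * partial i \<phi> x) = - (LINT x|lebesgue_on \<Omega>. g x * \<phi> x))"

text \<open>The weak derivative is determined only up to a null set (and is arbitrary if none
  exists); every use below is insensitive to the representative.\<close>

definition wpartial :: "(real^3) set \<Rightarrow> 3 \<Rightarrow> (real^3 \<Rightarrow> real) \<Rightarrow> real^3 \<Rightarrow> real" where
  "wpartial \<Omega> i f = (SOME g. has_weak_partial \<Omega> i f g)"

definition H1 :: "(real^3) set \<Rightarrow> (real^3 \<Rightarrow> real) set" where
  "H1 \<Omega> = {f \<in> L2 \<Omega>. \<forall>i. \<exists>g\<in>L2 \<Omega>. has_weak_partial \<Omega> i f g}"

definition H10 :: "(real^3) set \<Rightarrow> (real^3 \<Rightarrow> real) set" where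
  "H10 \<Omega> = {f \<in> H1 \<Omega>. \<exists>\<phi> :: nat \<Rightarrow> real^3 \<Rightarrow> real.
     (\<forall>k. \<phi> k \<in> test_functions \<Omega>) \<and>
     (\<lambda>k. l2norm \<Omega> (\<lambda>x. \<phi> k x - f x)) \<longlonglongrightarrow> 0 \<and>
     (\<forall>i. (\<lambda>k. l2norm \<Omega> (\<lambda>x. partial i (\<phi> k) x - wpartial \<Omega> i f x)) \<longlonglongrightarrow> 0)}"

definition vecH10 :: "(real^3) set \<Rightarrow> (real^3 \<Rightarrow> real^3) set" where
  "vecH10 \<Omega> = {u. \<forall>i. (\<lambda>x. u x $ i) \<in> H10 \<Omega>}"

definition wgrad :: "(real^3) set \<Rightarrow> (real^3 \<Rightarrow> real) \<Rightarrow> real^3 \<Rightarrow> real^3" where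
  "wgrad \<Omega> f x = (\<chi> i. wpartial \<Omega> i f x)"

text \<open>Row \<open>i\<close>, column \<open>j\<close> is the \<open>j\<close>-th derivative of the \<open>i\<close>-th component, so that
  \<open>wjac \<Omega> u x *v w x\<close> is \<open>((w \<cdot> \<nabla>) u)(x)\<close>.\<close>

definition wjac :: "(real^3) set \<Rightarrow> (real^3 \<Rightarrow> real^3) \<Rightarrow> real^3 \<Rightarrow> real^3^3" where
  "wjac \<Omega> u x = (\<chi> i j. wpartial \<Omega> j (\<lambda>y. u y $ i) x)"

definition wdiv :: "(real^3) set \<Rightarrow> (real^3 \<Rightarrow> real^3) \<Rightarrow> real^3 \<Rightarrow> real" where
  "wdiv \<Omega> u x = (\<Sum>i\<in>UNIV. wpartial \<Omega> i (\<lambda>y. u y $ i) x)"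

definition symgrad :: "(real^3) set \<Rightarrow> (real^3 \<Rightarrow> real^3) \<Rightarrow> real^3 \<Rightarrow> real^3^3" where
  "symgrad \<Omega> u x = (1/2) *\<^sub>R (wjac \<Omega> u x + transpose (wjac \<Omega> u x))"

definition tensor_norm :: "real^3^3 \<Rightarrow> real" where
  "tensor_norm A = sqrt (1/2 * trace (transpose A ** A))"

definition tensor_l2norm :: "(real^3) set \<Rightarrow> (real^3 \<Rightarrow> real^3^3) \<Rightarrow> real" where
  "tensor_l2norm \<Omega> f = sqrt (LINT x|lebesgue_on \<Omega>. (tensor_norm (f x))\<^sup>2)"

definition Lam :: "(real^3^3) set" where
  "Lam = {A. tensor_norm A \<le> 1 \<and> transpose A = A \<and> trace A = 0}"

definition tensorLam :: "(real^3) set \<Rightarrow> (real^3 \<Rightarrow> real^3^3) set" where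
  "tensorLam \<Omega> = {f \<in> L2 \<Omega>. AE x in lebesgue_on \<Omega>. f x \<in> Lam}"

text \<open>\<open>closest_point\<close> refers to the Frobenius distance, which is \<open>sqrt 2\<close> times the one given
  by \<^const>\<open>tensor_norm\<close>; the projection is the same.\<close>

definition proj_Lam :: "real^3^3 \<Rightarrow> real^3^3" where
  "proj_Lam A = closest_point Lam A"

definition C1_on :: "real set \<Rightarrow> (real \<Rightarrow> real) \<Rightarrow> bool" where
  "C1_on I f \<longleftrightarrow> (\<exists>f'. continuous_on I f' \<and>
     (\<forall>s\<in>I. (f has_real_derivative f' s) (at s within I)))"

text \<open>Variational form of
  \<open>(\<rho> - \<rho>old) / \<delta>t + w \<cdot> \<nabla>\<rho> - \<epsilon> \<Delta>\<rho> = 0\<close> with the homogeneous Neumann condition, the latter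
  being encoded by the test functions not vanishing on the boundary. Bounded test functions
  make the transport term integrable when \<open>w\<close> is merely square integrable.\<close>

definition regularized_density ::
    "(real^3) set \<Rightarrow> real \<Rightarrow> (real^3 \<Rightarrow> real^3) \<Rightarrow> (real^3 \<Rightarrow> real) \<Rightarrow> real \<Rightarrow>
     (real^3 \<Rightarrow> real) \<Rightarrow> bool" where
  "regularized_density \<Omega> \<delta>t w \<rho>old \<epsilon> \<rho> \<longleftrightarrow> \<rho> \<in> H1 \<Omega> \<and>
     (\<forall>\<phi>\<in>H1 \<Omega> \<inter> Linf \<Omega>.
        (LINT x|lebesgue_on \<Omega>. (\<rho> x - \<rho>old x) / \<delta>t * \<phi> x)
        + (LINT x|lebesgue_on \<Omega>. (w x \<bullet> wgrad \<Omega> \<rho> x) * \<phi> x)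
        + \<epsilon> * (LINT x|lebesgue_on \<Omega>. wgrad \<Omega> \<rho> x \<bullet> wgrad \<Omega> \<phi> x) = 0)"

definition weak_star_limit ::
    "(real^3) set \<Rightarrow> (real \<Rightarrow> real^3 \<Rightarrow> real) \<Rightarrow> (real^3 \<Rightarrow> real) \<Rightarrow> bool" where
  "weak_star_limit \<Omega> R \<rho> \<longleftrightarrow> (\<forall>\<epsilon>>0. R \<epsilon> \<in> Linf \<Omega>) \<and> \<rho> \<in> Linf \<Omega> \<and>
     (\<forall>\<psi>. integrable (lebesgue_on \<Omega>) \<psi> \<longrightarrow>
        ((\<lambda>\<epsilon>. LINT x|lebesgue_on \<Omega>. R \<epsilon> x * \<psi> x) \<longlongrightarrow>
         (LINT x|lebesgue_on \<Omega>. \<rho> x * \<psi> x)) (at_right 0))"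

definition density_step ::
    "(real^3) set \<Rightarrow> real \<Rightarrow> (real^3 \<Rightarrow> real^3) \<Rightarrow> (real^3 \<Rightarrow> real) \<Rightarrow> (real^3 \<Rightarrow> real) \<Rightarrow> bool" where
  "density_step \<Omega> \<delta>t w \<rho>old \<rho> \<longleftrightarrow>
     (\<exists>R. (\<forall>\<epsilon>>0. regularized_density \<Omega> \<delta>t w \<rho>old \<epsilon> (R \<epsilon>)) \<and> weak_star_limit \<Omega> R \<rho>)"

text \<open>Duality pairing of \<open>(w \<cdot> \<nabla>) u + (u / 2) div w\<close> with \<open>v\<close>. For \<open>w = \<rho> uh\<close> the divergence
  is only a distribution, so \<open>\<integral> (div w) (u \<cdot> v)\<close> stands for \<open>- \<integral> w \<cdot> \<nabla>(u \<cdot> v)\<close>. The product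
  \<open>u \<cdot> v\<close> of two \<open>H10\<close> fields has its weak gradient in \<open>L1\<close> only.\<close>

definition Btilde_integrable ::
    "(real^3) set \<Rightarrow> (real^3 \<Rightarrow> real^3) \<Rightarrow> (real^3 \<Rightarrow> real^3) \<Rightarrow> (real^3 \<Rightarrow> real^3) \<Rightarrow> bool" where
  "Btilde_integrable \<Omega> w u v \<longleftrightarrow>
     integrable (lebesgue_on \<Omega>) (\<lambda>x. (wjac \<Omega> u x *v w x) \<bullet> v x) \<and>
     integrable (lebesgue_on \<Omega>) (\<lambda>x. w x \<bullet> wgrad \<Omega> (\<lambda>y. u y \<bullet> v y) x)"

definition Btilde ::
    "(real^3) set \<Rightarrow> (real^3 \<Rightarrow> real^3) \<Rightarrow> (real^3 \<Rightarrow> real^3) \<Rightarrow> (real^3 \<Rightarrow> real^3) \<Rightarrow> real" where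
  "Btilde \<Omega> w u v =
     (LINT x|lebesgue_on \<Omega>. (wjac \<Omega> u x *v w x) \<bullet> v x)
     - 1/2 * (LINT x|lebesgue_on \<Omega>. w x \<bullet> wgrad \<Omega> (\<lambda>y. u y \<bullet> v y) x)"

text \<open>The momentum equation, as an identity between functionals on \<open>H10\<close>; \<open>\<pi>\<close> is the explicit
  pressure, \<open>m\<close> and \<open>a\<close> the viscosity and yield stress fields, and \<open>\<bullet>\<close> on matrices is the
  Frobenius product. The integrability requirement says that the convective term defines such a
  functional; it is automatic if \<open>w\<close> is in \<open>L3\<close>, by Sobolev embedding.\<close>

definition momentum_equation ::
    "(real^3) set \<Rightarrow> real \<Rightarrow> (real^3 \<Rightarrow> real) \<Rightarrow> (real^3 \<Rightarrow> real) \<Rightarrow> (real^3 \<Rightarrow> real^3) \<Rightarrow>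
     (real^3 \<Rightarrow> real^3) \<Rightarrow> (real^3 \<Rightarrow> real) \<Rightarrow> (real^3 \<Rightarrow> real) \<Rightarrow> (real^3 \<Rightarrow> real) \<Rightarrow>
     (real^3 \<Rightarrow> real^3) \<Rightarrow> (real^3 \<Rightarrow> real^3^3) \<Rightarrow> bool" where
  "momentum_equation \<Omega> \<delta>t \<rho>old \<rho> uold w \<pi> m a u S \<longleftrightarrow>
     (\<forall>v\<in>vecH10 \<Omega>. Btilde_integrable \<Omega> w u v \<and>
        1 / \<delta>t * (LINT x|lebesgue_on \<Omega>.
           ((1/2 * (\<rho> x + \<rho>old x)) *\<^sub>R u x - \<rho>old x *\<^sub>R uold x) \<bullet> v x)
        + Btilde \<Omega> w u v
        + (LINT x|lebesgue_on \<Omega>. ((2 * m x) *\<^sub>R symgrad \<Omega> u x) \<bullet> wjac \<Omega> v x)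
        + (LINT x|lebesgue_on \<Omega>. wgrad \<Omega> \<pi> x \<bullet> v x)
        = - (LINT x|lebesgue_on \<Omega>. (a x *\<^sub>R S x) \<bullet> wjac \<Omega> v x))"

text \<open>Variational form of \<open>\<Delta>q = f\<close> with the homogeneous Neumann condition. In the scheme
  \<open>f\<close> is a multiple of the divergence of an \<open>H10\<close> field, so the usual compatibility condition
  holds.\<close>

definition neumann_poisson ::
    "(real^3) set \<Rightarrow> (real^3 \<Rightarrow> real) \<Rightarrow> (real^3 \<Rightarrow> real) \<Rightarrow> bool" where
  "neumann_poisson \<Omega> f q \<longleftrightarrow> q \<in> H1 \<Omega> \<and>
     (\<forall>\<phi>\<in>H1 \<Omega>. (LINT x|lebesgue_on \<Omega>. wgrad \<Omega> q x \<bullet> wgrad \<Omega> \<phi> x)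
                 = - (LINT x|lebesgue_on \<Omega>. f x * \<phi> x))"

definition bi_projection_step ::
    "(real^3) set \<Rightarrow> real \<Rightarrow> real \<Rightarrow> real \<Rightarrow> real \<Rightarrow> (real \<Rightarrow> real) \<Rightarrow> (real \<Rightarrow> real) \<Rightarrow>
     (nat \<Rightarrow> real^3 \<Rightarrow> real) \<Rightarrow> (nat \<Rightarrow> real^3 \<Rightarrow> real^3) \<Rightarrow> (nat \<Rightarrow> real^3 \<Rightarrow> real^3) \<Rightarrow>
     (nat \<Rightarrow> real^3 \<Rightarrow> real) \<Rightarrow> (nat \<Rightarrow> real^3 \<Rightarrow> real) \<Rightarrow> (nat \<Rightarrow> real^3 \<Rightarrow> real^3^3) \<Rightarrow>
     nat \<Rightarrow> bool" where
  "bi_projection_step \<Omega> \<delta>t \<rho>1 r \<theta> \<mu> \<alpha> \<rho> u uh q p S n \<longleftrightarrow>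
     density_step \<Omega> \<delta>t (uh n) (\<rho> n) (\<rho> (Suc n)) \<and>
     u (Suc n) \<in> vecH10 \<Omega> \<and> S (Suc n) \<in> tensorLam \<Omega> \<and>
     momentum_equation \<Omega> \<delta>t (\<rho> n) (\<rho> (Suc n)) (u n) (\<lambda>x. \<rho> (Suc n) x *\<^sub>R uh n x)
       (\<lambda>x. p n x + q n x) (\<lambda>x. \<mu> (\<rho> (Suc n) x)) (\<lambda>x. \<alpha> (\<rho> (Suc n) x)) (u (Suc n)) (S (Suc n)) \<and>
     ae_eq \<Omega> (S (Suc n))
       (\<lambda>x. proj_Lam (S (Suc n) x + (r * \<alpha> (\<rho> (Suc n) x)) *\<^sub>R symgrad \<Omega> (u (Suc n)) x
                        + \<theta> *\<^sub>R (S n x - S (Suc n) x))) \<and>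
     neumann_poisson \<Omega> (\<lambda>x. \<rho>1 / \<delta>t * wdiv \<Omega> (u (Suc n)) x) (q (Suc n)) \<and>
     ae_eq \<Omega> (p (Suc n)) (\<lambda>x. p n x + q (Suc n) x) \<and>
     ae_eq \<Omega> (uh (Suc n)) (\<lambda>x. u (Suc n) x - (\<delta>t / \<rho>1) *\<^sub>R wgrad \<Omega> (q (Suc n)) x)"

definition bi_projection_scheme ::
    "(real^3) set \<Rightarrow> real \<Rightarrow> nat \<Rightarrow> real \<Rightarrow> real \<Rightarrow> real \<Rightarrow> (real \<Rightarrow> real) \<Rightarrow> (real \<Rightarrow> real) \<Rightarrow>
     (real^3 \<Rightarrow> real) \<Rightarrow> (real^3 \<Rightarrow> real^3) \<Rightarrow>
     (nat \<Rightarrow> real^3 \<Rightarrow> real) \<Rightarrow> (nat \<Rightarrow> real^3 \<Rightarrow> real^3) \<Rightarrow> (nat \<Rightarrow> real^3 \<Rightarrow> real^3) \<Rightarrow>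
     (nat \<Rightarrow> real^3 \<Rightarrow> real) \<Rightarrow> (nat \<Rightarrow> real^3 \<Rightarrow> real) \<Rightarrow> (nat \<Rightarrow> real^3 \<Rightarrow> real^3^3) \<Rightarrow> bool" where
  "bi_projection_scheme \<Omega> \<delta>t N \<rho>1 r \<theta> \<mu> \<alpha> \<rho>0 u0 \<rho> u uh q p S \<longleftrightarrow>
     ae_eq \<Omega> (\<rho> 0) \<rho>0 \<and> ae_eq \<Omega> (u 0) u0 \<and> ae_eq \<Omega> (uh 0) u0 \<and> ae_eq \<Omega> (q 0) (\<lambda>x. 0) \<and>
     p 0 \<in> H1 \<Omega> \<and> S 0 \<in> tensorLam \<Omega> \<and>
     (\<forall>n<N. bi_projection_step \<Omega> \<delta>t \<rho>1 r \<theta> \<mu> \<alpha> \<rho> u uh q p S n)"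

end

theory Submission
  imports Defs
begin

text \<open>Tested with \<open>2 \<delta>t u\<^sup>n\<^sup>+\<^sup>1\<close>, the momentum equation loses its convective term, which is
  skew-symmetric, and the inertial term telescopes up to the gain
  \<open>\<integral> \<rho>\<^sup>n |u\<^sup>n\<^sup>+\<^sup>1 - u\<^sup>n|\<^sup>2\<close>. The variational inequality of the projection, taken at \<open>0 \<in> \<Lambda>\<close>, bounds
  the plastic work from below by a telescoping difference of \<open>\<parallel>\<Sigma>\<^sup>n\<parallel>\<^sup>2\<close>. The corrected velocities are
  orthogonal to all gradients, so \<open>\<nabla>q\<^sup>n\<close> is \<open>\<rho>1 / \<delta>t\<close> times the projection of \<open>u\<^sup>n\<close> onto the
  gradients. Hence the work of the explicit pressure is a telescoping difference of \<open>\<parallel>\<nabla>p\<^sup>n\<parallel>\<^sup>2\<close> up to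
  \<open>\<parallel>\<nabla>(q\<^sup>n\<^sup>+\<^sup>1 - q\<^sup>n)\<parallel>\<^sup>2\<close>, which the inertial gain absorbs because \<open>\<rho>1 \<le> \<rho>\<^sup>n\<close>. That bound is a maximum
  principle: powers of \<open>\<rho>\<^sub>\<epsilon> - (\<rho>1 + \<rho>2) / 2\<close> are admissible test functions in the regularized
  transport equation, whose transport term they annihilate, and they bound all the moments of
  \<open>\<bar>\<rho>\<^sub>\<epsilon> - (\<rho>1 + \<rho>2) / 2\<bar>\<close>.\<close>

subsection \<open>Smooth bump functions\<close>

text \<open>The maximum principle is usually tested with positive parts, which require a chain rule
  for Lipschitz functions. Powers require only the product rule for bounded H1 functions. As the
  boundary of \<Omega> is arbitrary, approximation by functions smooth up to it cannot be invoked.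
  That rule is therefore proved against compactly supported test functions, with one factor replaced
  by a mollification of its extension by zero. The midpoint of \<open>\<rho>1\<close> and
  \<open>\<rho>2\<close> merges the two bounds into one bound on an absolute value. Mollification
  also gives uniqueness of weak derivatives, through which the chosen representative
  \<open>wpartial\<close> can be computed. Velocities in \<open>H10\<close> may be unbounded, so the
  gradient of \<open>u \<bullet> u\<close> in the convective term comes from approximation by test
  functions instead. The corrected velocity \<open>uh\<close> is only square integrable: that it is
  solenoidal with zero normal flux is kept in weak form, as orthogonality to the gradients of all H1
  functions. This travels through the induction with the density bounds, because each density step
  is driven by the previous \<open>uh\<close>.\<close>

lemma partial_eqI:
  assumes "(f has_derivative D) (at x)"
  shows "partial i f x = D (axis i 1)"
  using frechet_derivative_at[OF assms] by (simp add: partial_def)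

lemma Ck_imp_continuous: "Ck k f \<Longrightarrow> continuous_on UNIV f"
  by (cases k) (auto simp: continuous_on_eq_continuous_at differentiable_imp_continuous_within)

lemma Ck_SucD: "Ck (Suc k) f \<Longrightarrow> Ck k f"
proof (induction k arbitrary: f)
  case 0
  then show ?case using Ck_imp_continuous[OF 0] by simp
next
  case (Suc k)
  then show ?case by auto
qed

lemma partial_add:
  assumes "f differentiable (at x)" "g differentiable (at x)"
  shows "partial i (\<lambda>x. f x + g x) x = partial i f x + partial i g x"
  using has_derivative_add[OF assms[unfolded frechet_derivative_works]]
  by (subst partial_eqI) (auto simp: partial_def)

lemma partial_diff:
  assumes "f differentiable (at x)" "g differentiable (at x)"
  shows "partial i (\<lambda>x. f x - g x) x = partial i f x - partial i g x"
  using has_derivative_diff[OF assms[unfolded frechet_derivative_works]]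
  by (subst partial_eqI) (auto simp: partial_def)

lemma partial_mult:
  assumes "f differentiable (at x)" "g differentiable (at x)"
  shows "partial i (\<lambda>x. f x * g x) x = f x * partial i g x + partial i f x * g x"
  using has_derivative_mult[OF assms[unfolded frechet_derivative_works]]
  by (subst partial_eqI) (auto simp: partial_def)

lemma partial_affine:
  assumes "f differentiable (at (c *\<^sub>R x + a))"
  shows "partial i (\<lambda>x. f (c *\<^sub>R x + a)) x = c * partial i f (c *\<^sub>R x + a)"
    and "(\<lambda>x. f (c *\<^sub>R x + a)) differentiable (at x)"
proof -
  let ?D = "frechet_derivative f (at (c *\<^sub>R x + a))"
  have D: "(f has_derivative ?D) (at (c *\<^sub>R x + a))"
    using assms frechet_derivative_works by blast
  have "((\<lambda>x. c *\<^sub>R x + a) has_derivative (\<lambda>h. c *\<^sub>R h)) (at x)"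
    by (auto intro!: derivative_eq_intros)
  from has_derivative_compose[OF this D]
  have 1: "((\<lambda>x. f (c *\<^sub>R x + a)) has_derivative (\<lambda>h. ?D (c *\<^sub>R h))) (at x)" .
  then show "(\<lambda>x. f (c *\<^sub>R x + a)) differentiable (at x)"
    using differentiable_def by blast
  have "?D (c *\<^sub>R axis i 1) = c * ?D (axis i 1)"
    using D by (simp add: has_derivative_def linear_scale[OF bounded_linear.linear])
  then show "partial i (\<lambda>x. f (c *\<^sub>R x + a)) x = c * partial i f (c *\<^sub>R x + a)"
    using partial_eqI[OF 1] by (simp add: partial_def)
qed

lemma Ck_const: "Ck k (\<lambda>x. c)"
proof (induction k arbitrary: c)
  case 0
  then show ?case by simp
next
  case (Suc k)
  have "partial i (\<lambda>x. c) = (\<lambda>x. 0)" for i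
    by (rule ext, subst partial_eqI[OF has_derivative_const]) simp
  then show ?case using Suc by simp
qed

lemma Ck_add: "Ck k f \<Longrightarrow> Ck k g \<Longrightarrow> Ck k (\<lambda>x. f x + g x)"
proof (induction k arbitrary: f g)
  case 0
  then show ?case by (auto intro: continuous_intros)
next
  case (Suc k)
  have "partial i (\<lambda>x. f x + g x) = (\<lambda>x. partial i f x + partial i g x)" for i
    using Suc.prems by (intro ext partial_add) auto
  then show ?case using Suc by simp
qed

lemma Ck_diff: "Ck k f \<Longrightarrow> Ck k g \<Longrightarrow> Ck k (\<lambda>x. f x - g x)"
proof (induction k arbitrary: f g)
  case 0
  then show ?case by (auto intro: continuous_intros)
next
  case (Suc k)
  have "partial i (\<lambda>x. f x - g x) = (\<lambda>x. partial i f x - partial i g x)" for i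
    using Suc.prems by (intro ext partial_diff) auto
  then show ?case using Suc by simp
qed

lemma Ck_mult: "Ck k f \<Longrightarrow> Ck k g \<Longrightarrow> Ck k (\<lambda>x. f x * g x)"
proof (induction k arbitrary: f g)
  case 0
  then show ?case by (auto intro: continuous_intros)
next
  case (Suc k)
  have "partial i (\<lambda>x. f x * g x) = (\<lambda>x. f x * partial i g x + partial i f x * g x)" for i
    using Suc.prems by (intro ext partial_mult) auto
  moreover have "Ck k f" "Ck k g" using Suc.prems Ck_SucD by auto
  ultimately show ?case using Suc by (auto intro!: Ck_add)
qed

lemma Ck_prod: "(\<And>i. i \<in> I \<Longrightarrow> Ck k (f i)) \<Longrightarrow> Ck k (\<lambda>x. \<Prod>i\<in>I. f i x)"
  by (induction I rule: infinite_finite_induct) (auto intro: Ck_const Ck_mult)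

lemma Ck_affine: "Ck k f \<Longrightarrow> Ck k (\<lambda>x. f (c *\<^sub>R x + a))"
proof (induction k arbitrary: f)
  case 0
  then show ?case
    by (auto intro!: continuous_on_compose2[of UNIV f] continuous_intros)
next
  case (Suc k)
  have "partial i (\<lambda>x. f (c *\<^sub>R x + a)) = (\<lambda>x. c * partial i f (c *\<^sub>R x + a))" for i
    using Suc.prems by (intro ext partial_affine) auto
  then show ?case using Suc by (auto intro!: Ck_mult Ck_const partial_affine)
qed

text \<open>The powers of \<open>t\<close> make the family closed under differentiation.\<close>

definition flat :: "nat \<Rightarrow> real \<Rightarrow> real" where
  "flat m t = (if t \<le> 0 then 0 else exp (- 1 / t) / t ^ m)"

lemma flat_nonneg: "0 \<le> flat m t"
  by (simp add: flat_def)

lemma flat_0_pos: "0 < t \<Longrightarrow> 0 < flat 0 t"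
  by (simp add: flat_def)

text \<open>A single term of the exponential series of \<open>1 / t\<close>, the one of degree
  \<open>m + 2\<close>, beats \<open>t ^ m\<close> with a factor \<open>t\<^sup>2\<close> to spare.
  This quadratic bound is what makes the difference quotient at 0 vanish in the limit.\<close>

lemma flat_le: "\<bar>flat m t\<bar> \<le> fact (m + 2) * t\<^sup>2"
proof (cases "t \<le> 0")
  case True
  then show ?thesis by (simp add: flat_def)
next
  case False
  then have t: "0 < t" by simp
  have "(1 / t) ^ (m + 2) / fact (m + 2) \<le> exp (1 / t)"
  proof -
    have "(\<lambda>n. (1/t) ^ n / fact n) sums exp (1/t)"
      using exp_converges[of "1/t"] by (simp add: scaleR_conv_of_real field_simps)
    from sum_le_suminf[OF sums_summable[OF this], of "{m+2}"] sums_unique[OF this]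
    show ?thesis using t by simp
  qed
  then have "1 \<le> exp (1 / t) * (fact (m + 2) * t ^ (m + 2))"
    using t by (simp add: power_one_over divide_le_eq mult.assoc mult.commute[of "fact (m + 2)"]
        del: fact_Suc fact_2 power_Suc add_2_eq_Suc')
  then have "exp (- 1 / t) \<le> fact (m + 2) * t ^ (m + 2)"
    using t by (simp add: exp_minus inverse_eq_divide divide_le_eq mult_ac del: fact_Suc fact_2 power_Suc add_2_eq_Suc')
  then have "exp (- 1 / t) / t ^ m \<le> fact (m + 2) * t\<^sup>2"
    using t by (simp add: field_simps power_add power2_eq_square)
  then show ?thesis using t by (simp add: flat_def)
qed

text \<open>The quotient rule raises the power in the denominator by 2 through the exponential and
  by 1 through \<open>t ^ m\<close>, so the derivative stays in the family. The only delicate point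
  is \<open>t = 0\<close>, where \<open>flat_le\<close> is used.\<close>

lemma flat_has_derivative:
  "(flat m has_real_derivative (flat (m + 2) t - real m * flat (m + 1) t)) (at t)"
proof -
  consider "t < 0" | "t = 0" | "t > 0" by linarith
  then show ?thesis
  proof cases
    case 1
    have "((\<lambda>_. 0) has_real_derivative 0) (at t)" by simp
    then have "(flat m has_real_derivative 0) (at t)"
      by (rule has_field_derivative_transform_within_open[of _ _ _ "{..<0}"])
        (use 1 in \<open>auto simp: flat_def\<close>)
    then show ?thesis using 1 by (simp add: flat_def)
  next
    case 2
    have "((\<lambda>h. (flat m h - flat m 0) / (h - 0)) \<longlongrightarrow> 0) (at 0)"
    proof (rule Lim_null_comparison)
      show "\<forall>\<^sub>F h in at 0. norm ((flat m h - flat m 0) / (h - 0)) \<le> fact (m + 2) * \<bar>h\<bar>"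
      proof (rule eventually_at_filter[THEN iffD2], rule always_eventually, intro allI impI)
        fix h :: real
        assume "h \<noteq> 0"
        then show "norm ((flat m h - flat m 0) / (h - 0)) \<le> fact (m + 2) * \<bar>h\<bar>"
          using flat_le[of m h]
          by (simp add: flat_def[of m 0] field_simps power2_eq_square abs_if split: if_splits)
      qed
      show "((\<lambda>h::real. fact (m + 2) * \<bar>h\<bar>) \<longlongrightarrow> 0) (at 0)"
        by (rule tendsto_eq_intros | simp)+
    qed
    then show ?thesis using 2 by (simp add: has_field_derivative_iff flat_def)
  next
    case 3
    \<comment> \<open>Differentiating \<open>t ^ m\<close> produces \<open>t ^ (m - 1)\<close> with
      truncated subtraction; this relates it to \<open>t ^ m\<close>.\<close>
    have e: "m = 0 \<or> t ^ m = t * t ^ (m - 1)"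
      by (cases m) auto
    have "((\<lambda>s. exp (- 1 / s) / s ^ m) has_real_derivative
        flat (m + 2) t - real m * flat (m + 1) t) (at t)"
      using 3 e by (auto intro!: derivative_eq_intros simp: flat_def field_simps power2_eq_square)
    then show ?thesis
      by (rule has_field_derivative_transform_within_open[of _ _ _ "{0<..}"])
        (use 3 in \<open>auto simp: flat_def\<close>)
  qed
qed

lemma has_derivative_flat_coordinate:
  "((\<lambda>x::real^3. flat m (c * (x $ j) + d)) has_derivative
     (\<lambda>h. (flat (m + 2) (c * (x $ j) + d) - real m * flat (m + 1) (c * (x $ j) + d)) * (c * (h $ j))))
     (at x)"
proof -
  have "((\<lambda>x::real^3. c * (x $ j) + d) has_derivative (\<lambda>h. c * (h $ j))) (at x)"
    by (auto intro!: derivative_eq_intros bounded_linear_imp_has_derivative bounded_linear_vec_nth)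
  from has_derivative_compose[OF this flat_has_derivative[unfolded has_field_derivative_def]]
  show ?thesis .
qed

lemma Ck_flat_coordinate: "Ck k (\<lambda>x. flat m (c * (x $ j) + d))"
proof (induction k arbitrary: m)
  case 0
  have "continuous_on UNIV (\<lambda>x::real^3. flat m (c * (x $ j) + d))"
    by (rule has_derivative_continuous_on[OF has_derivative_at_withinI[OF has_derivative_flat_coordinate]])
  then show ?case by simp
next
  case (Suc k)
  have "partial i (\<lambda>x. flat m (c * (x $ j) + d)) =
    (\<lambda>x. (c * axis i 1 $ j) * (flat (m + 2) (c * (x $ j) + d) + (- real m) * flat (m + 1) (c * (x $ j) + d)))" for i
    by (rule ext, subst partial_eqI[OF has_derivative_flat_coordinate]) (simp add: algebra_simps)
  moreover have "(\<lambda>x. flat m (c * (x $ j) + d)) differentiable (at x)" for x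
    using has_derivative_flat_coordinate differentiable_def by blast
  ultimately show ?case
    by (auto intro!: Ck_mult Ck_const Ck_add Ck_diff Suc)
qed

text \<open>The product vanishes as soon as one coordinate leaves its interval, so it is positive
  exactly on an open box. The factors \<open>1 *\<close> and \<open>- 1 *\<close> put the arguments
  into the affine shape of \<open>Ck_flat_coordinate\<close>.\<close>

definition bump :: "real^3 \<Rightarrow> real^3 \<Rightarrow> real^3 \<Rightarrow> real" where
  "bump a b x = (\<Prod>j\<in>UNIV. flat 0 (1 * (x $ j) + (- (a $ j))) * flat 0 (- 1 * (x $ j) + b $ j))"

lemma Ck_bump: "Ck k (bump a b)"
  unfolding bump_def by (intro Ck_prod Ck_mult Ck_flat_coordinate)

lemma bump_nonneg: "0 \<le> bump a b x"
  unfolding bump_def by (intro prod_nonneg) (auto simp: flat_nonneg)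

lemma bump_pos_iff: "0 < bump a b x \<longleftrightarrow> x \<in> box a b"
proof
  assume "x \<in> box a b"
  then show "0 < bump a b x"
    unfolding bump_def by (intro prod_pos) (auto simp: mem_box_cart intro!: mult_pos_pos flat_0_pos)
next
  assume pos: "0 < bump a b x"
  have "a $ j < x $ j \<and> x $ j < b $ j" for j
  proof (rule ccontr)
    assume "\<not> ?thesis"
    then have "flat 0 (1 * (x $ j) + (- (a $ j))) * flat 0 (- 1 * (x $ j) + b $ j) = 0"
      by (auto simp: flat_def)
    then have "bump a b x = 0" unfolding bump_def by (subst prod_zero_iff) auto
    then show False using pos by simp
  qed
  then show "x \<in> box a b" by (simp add: mem_box_cart)
qed

lemma support_bump: "{x. bump a b x \<noteq> 0} = box a b"
  using bump_pos_iff[of a b] bump_nonneg[of a b] by (auto simp: less_le)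

section \<open>Stability of the class of test functions\<close>

lemma test_functionsD:
  assumes "\<phi> \<in> test_functions \<Omega>"
  shows "Ck k \<phi>" "\<phi> differentiable (at x)" "continuous_on UNIV \<phi>" "continuous_on UNIV (partial i \<phi>)"
    "compact (closure {x. \<phi> x \<noteq> 0})" "closure {x. \<phi> x \<noteq> 0} \<subseteq> \<Omega>"
proof -
  have C: "\<forall>k. Ck k \<phi>" using assms by (simp add: test_functions_def)
  then show "Ck k \<phi>" by blast
  from C have "Ck (Suc 0) \<phi>" by blast
  then show "\<phi> differentiable (at x)" "continuous_on UNIV (partial i \<phi>)" by auto
  show "continuous_on UNIV \<phi>" using C Ck_imp_continuous by blast
  show "compact (closure {x. \<phi> x \<noteq> 0})" "closure {x. \<phi> x \<noteq> 0} \<subseteq> \<Omega>"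
    using assms by (auto simp: test_functions_def)
qed

lemma partial_eq_0_outside_support:
  assumes "x \<notin> closure {x. \<phi> x \<noteq> 0}"
  shows "partial i \<phi> x = 0"
proof -
  have "((\<lambda>_. 0) has_derivative (\<lambda>_. 0)) (at x)" by simp
  then have "(\<phi> has_derivative (\<lambda>_. 0)) (at x)"
    by (rule has_derivative_transform_within_open[of _ _ _ _ "- closure {x. \<phi> x \<noteq> 0}"])
      (use assms closure_subset[of "{x. \<phi> x \<noteq> 0}"] in auto)
  then show ?thesis by (simp add: partial_eqI)
qed

lemma partial_support:
  "closure {x. partial i \<phi> x \<noteq> 0} \<subseteq> closure {x. \<phi> x \<noteq> 0}"
  by (rule closure_minimal) (use partial_eq_0_outside_support in auto)

lemma compact_closure_subset:
  fixes S T :: "'a::heine_borel set"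
  shows "compact (closure T) \<Longrightarrow> closure S \<subseteq> closure T \<Longrightarrow> compact (closure S)"
  using compact_eq_bounded_closed bounded_subset by blast

lemma partial_test_functions:
  assumes "\<phi> \<in> test_functions \<Omega>"
  shows "partial i \<phi> \<in> test_functions \<Omega>"
proof -
  have "Ck (Suc k) \<phi>" for k using test_functionsD(1)[OF assms] .
  then have "Ck k (partial i \<phi>)" for k by simp
  then show ?thesis
    using test_functionsD(5,6)[OF assms] partial_support[of i \<phi>] compact_closure_subset
    by (auto simp: test_functions_def)
qed

lemma test_functions_mult:
  assumes "\<phi> \<in> test_functions \<Omega>" "\<And>k. Ck k g"
  shows "(\<lambda>x. g x * \<phi> x) \<in> test_functions \<Omega>"
proof -
  have "closure {x. g x * \<phi> x \<noteq> 0} \<subseteq> closure {x. \<phi> x \<noteq> 0}"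
    by (rule closure_mono) auto
  then show ?thesis
    using test_functionsD[OF assms(1)] compact_closure_subset assms(2)
    by (auto simp: test_functions_def intro!: Ck_mult)
qed

lemma test_functions_affine:
  assumes "\<phi> \<in> test_functions UNIV" "c \<noteq> 0"
    and "\<And>x. c *\<^sub>R x + a \<in> closure {x. \<phi> x \<noteq> 0} \<Longrightarrow> x \<in> \<Omega>"
  shows "(\<lambda>x. \<phi> (c *\<^sub>R x + a)) \<in> test_functions \<Omega>"
proof -
  let ?K = "closure {x. \<phi> x \<noteq> 0}" and ?g = "\<lambda>y. (1 / c) *\<^sub>R (y - a)"
  have K: "compact (?g ` ?K)"
    by (rule compact_continuous_image)
      (use test_functionsD(5)[OF assms(1)] in \<open>auto intro!: continuous_intros\<close>)
  have "{x. \<phi> (c *\<^sub>R x + a) \<noteq> 0} \<subseteq> ?g ` ?K"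
  proof clarify
    fix x assume "\<phi> (c *\<^sub>R x + a) \<noteq> 0"
    then have "c *\<^sub>R x + a \<in> ?K" using closure_subset by fastforce
    moreover have "x = ?g (c *\<^sub>R x + a)" using assms(2) by simp
    ultimately show "x \<in> ?g ` ?K" by blast
  qed
  then have sub: "closure {x. \<phi> (c *\<^sub>R x + a) \<noteq> 0} \<subseteq> ?g ` ?K"
    by (rule closure_minimal) (use K compact_imp_closed in blast)
  then have "compact (closure {x. \<phi> (c *\<^sub>R x + a) \<noteq> 0})"
    using K by (meson bounded_subset closed_closure compact_eq_bounded_closed)
  moreover have "?g ` ?K \<subseteq> \<Omega>"
    using assms(2,3) by auto
  ultimately show ?thesis
    using sub test_functionsD(1)[OF assms(1)] by (auto simp: test_functions_def intro!: Ck_affine)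
qed

lemma bump_test_functions: "bump a b \<in> test_functions UNIV"
  using Ck_bump[of _ a b] bounded_closure[OF bounded_box[of a b]]
  by (auto simp: test_functions_def support_bump compact_eq_bounded_closed)

lemma test_functions_bounded:
  assumes "\<phi> \<in> test_functions \<Omega>"
  obtains C where "\<And>x. \<bar>\<phi> x\<bar> \<le> C"
proof -
  let ?K = "closure {x. \<phi> x \<noteq> 0}"
  have "compact (\<phi> ` ?K)"
    using test_functionsD(3,5)[OF assms] compact_continuous_image continuous_on_subset by blast
  then obtain C where C: "\<And>x. x \<in> ?K \<Longrightarrow> \<bar>\<phi> x\<bar> \<le> C"
    by (fastforce dest!: compact_imp_bounded simp: bounded_iff)
  \<comment> \<open>If the support is empty, \<open>C\<close> is arbitrary and may be
    negative.\<close>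
  have "\<bar>\<phi> x\<bar> \<le> max C 0" for x
    using C[of x] closure_subset[of "{x. \<phi> x \<noteq> 0}"] by (cases "\<phi> x = 0") (auto simp: subset_eq le_max_iff_disj)
  then show ?thesis using that by blast
qed

lemma test_functions_borel:
  "\<phi> \<in> test_functions \<Omega> \<Longrightarrow> \<phi> \<in> borel_measurable borel"
  by (rule borel_measurable_continuous_onI) (rule test_functionsD)

lemma test_functions_mono: "\<phi> \<in> test_functions A \<Longrightarrow> A \<subseteq> B \<Longrightarrow> \<phi> \<in> test_functions B"
  by (auto simp: test_functions_def)

lemma test_functions_integrable:
  assumes "\<phi> \<in> test_functions \<Omega>"
  shows "integrable lborel \<phi>"
proof -
  let ?K = "closure {x. \<phi> x \<noteq> 0}"
  obtain C where C: "\<And>x. \<bar>\<phi> x\<bar> \<le> C" using test_functions_bounded[OF assms] by blast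
  have K: "emeasure lborel ?K < \<infinity>" "?K \<in> sets borel"
    using test_functionsD(5)[OF assms] emeasure_bounded_finite compact_imp_bounded by auto
  show ?thesis
  proof (rule integrableI_bounded_set[of ?K _ _ C])
    show "AE x in lborel. x \<notin> ?K \<longrightarrow> \<phi> x = 0"
      using closure_subset[of "{x. \<phi> x \<noteq> 0}"] by (auto intro!: AE_I2)
  qed (use K C test_functions_borel[OF assms] in auto)
qed

subsection \<open>Mollification\<close>

lemma lborel_reflect:
  fixes f :: "'a::euclidean_space \<Rightarrow> real"
  assumes [measurable]: "f \<in> borel_measurable borel"
  shows "(LINT y|lborel. f (x - y)) = (LINT y|lborel. f y)"
    and "integrable lborel (\<lambda>y. f (x - y)) \<longleftrightarrow> integrable lborel f"
    and "(\<integral>\<^sup>+y. ennreal (f (x - y)) \<partial>lborel) = (\<integral>\<^sup>+y. ennreal (f y) \<partial>lborel)"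
proof -
  have "(lborel :: 'a measure) = density (distr lborel borel (\<lambda>y. x + (-1) *\<^sub>R y)) (\<lambda>_. ennreal (\<bar>-1\<bar> ^ DIM('a)))"
    by (rule lborel_affine) simp
  then have L: "lborel = distr lborel borel (\<lambda>y::'a. x - y)"
    by (simp add: density_1)
  show "(LINT y|lborel. f (x - y)) = (LINT y|lborel. f y)"
    by (subst (2) L) (simp add: integral_distr)
  show "integrable lborel (\<lambda>y. f (x - y)) \<longleftrightarrow> integrable lborel f"
    by (subst (2) L) (simp add: integrable_distr_eq)
  show "(\<integral>\<^sup>+y. ennreal (f (x - y)) \<partial>lborel) = (\<integral>\<^sup>+y. ennreal (f y) \<partial>lborel)"
    by (subst (2) L) (simp add: nn_integral_distr)
qed

lemma lborel_translate:
  fixes f :: "'a::euclidean_space \<Rightarrow> real"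
  assumes [measurable]: "f \<in> borel_measurable borel"
  shows "(LINT x|lborel. f (x + a)) = (LINT x|lborel. f x)"
    and "integrable lborel (\<lambda>x. f (x + a)) \<longleftrightarrow> integrable lborel f"
    and "(\<integral>\<^sup>+x. ennreal (f (x + a)) \<partial>lborel) = (\<integral>\<^sup>+y. ennreal (f y) \<partial>lborel)"
proof -
  have L: "lborel = distr lborel borel (\<lambda>y::'a. y + a)"
    using lborel_distr_plus[of a] by (simp add: add.commute[of a] cong: distr_cong)
  show "(LINT x|lborel. f (x + a)) = (LINT x|lborel. f x)"
    by (subst (2) L) (simp add: integral_distr)
  show "integrable lborel (\<lambda>x. f (x + a)) \<longleftrightarrow> integrable lborel f"
    by (subst (2) L) (simp add: integrable_distr_eq)
  show "(\<integral>\<^sup>+x. ennreal (f (x + a)) \<partial>lborel) = (\<integral>\<^sup>+y. ennreal (f y) \<partial>lborel)"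
    by (subst (2) L) (simp add: nn_integral_distr)
qed

section \<open>Smoothness of the convolution with a test function\<close>

definition conv :: "(real^3 \<Rightarrow> real) \<Rightarrow> (real^3 \<Rightarrow> real) \<Rightarrow> real^3 \<Rightarrow> real" where
  "conv F \<psi> x = (LINT y|lborel. F y * \<psi> (x - y))"

lemma integrable_mult_bounded:
  fixes f g :: "'a \<Rightarrow> real"
  assumes "integrable M f" "g \<in> borel_measurable M" "AE x in M. \<bar>g x\<bar> \<le> C"
  shows "integrable M (\<lambda>x. f x * g x)"
proof (rule Bochner_Integration.integrable_bound[of _ "\<lambda>x. C * f x"])
  show "AE x in M. norm (f x * g x) \<le> norm (C * f x)"
    using assms(3)
  proof eventually_elim
    case (elim x)
    have "\<bar>g x\<bar> * \<bar>f x\<bar> \<le> \<bar>C\<bar> * \<bar>f x\<bar>" using elim by (intro mult_right_mono) auto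
    then show ?case by (simp add: abs_mult mult.commute)
  qed
qed (use assms in auto)

lemma integrable_conv_integrand:
  assumes "integrable lborel F" "\<psi> \<in> test_functions \<Omega>"
  shows "integrable lborel (\<lambda>y. F y * \<psi> (x - y))"
proof -
  obtain C where C: "\<And>x. \<bar>\<psi> x\<bar> \<le> C" using test_functions_bounded[OF assms(2)] by blast
  have [measurable]: "\<psi> \<in> borel_measurable borel" using assms(2) by (rule test_functions_borel)
  show ?thesis
    by (rule integrable_mult_bounded[of _ _ _ C]) (use assms C in auto)
qed

lemma frechet_derivative_eq_sum_partial:
  assumes "f differentiable (at x)"
  shows "frechet_derivative f (at x) h = (\<Sum>i\<in>UNIV. h $ i * partial i f x)"
proof -
  interpret bounded_linear "frechet_derivative f (at x)"
    using assms by (simp add: frechet_derivative_works has_derivative_def)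
  have "frechet_derivative f (at x) h = frechet_derivative f (at x) (\<Sum>i\<in>UNIV. h $ i *\<^sub>R axis i 1)"
    by (simp add: basis_expansion flip: scalar_mult_eq_scaleR)
  then show ?thesis by (simp add: sum scale partial_def)
qed

text \<open>The signed quotient, unlike its norm, is linear in \<open>f\<close> and \<open>D\<close>
  and therefore passes under an integral sign. \<open>conv_has_derivative\<close> relies on
  this.\<close>

lemma has_derivative_at_real_quotient:
  fixes f :: "'a::real_normed_vector \<Rightarrow> real"
  shows "(f has_derivative D) (at x) \<longleftrightarrow>
    bounded_linear D \<and> ((\<lambda>h. (f (x + h) - f x - D h) / norm h) \<longlongrightarrow> 0) (at 0)"
proof -
  have "(\<lambda>h. norm (f (x + h) - f x - D h) / norm h) = (\<lambda>h. \<bar>(f (x + h) - f x - D h) / norm h\<bar>)"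
    by (simp add: abs_divide)
  then show ?thesis by (simp only: has_derivative_at tendsto_rabs_zero_iff)
qed

text \<open>The difference quotient of the convolution is the integral of \<open>F\<close> against
  the quotient of \<open>\<psi>\<close>. The latter is bounded by twice the Lipschitz constant
  \<open>?L\<close>, uniformly in the increment and the point, so a multiple of the modulus of
  \<open>F\<close> dominates and the limit passes inside.\<close>

lemma conv_has_derivative:
  assumes F: "integrable lborel F" and psi: "\<psi> \<in> test_functions UNIV"
  shows "(conv F \<psi> has_derivative (\<lambda>h. \<Sum>i\<in>UNIV. h $ i * conv F (partial i \<psi>) x)) (at x)"
proof -
  let ?D = "\<lambda>h. \<Sum>i\<in>UNIV. h $ i * conv F (partial i \<psi>) x"
  let ?q = "\<lambda>h z. (\<psi> (z + h) - \<psi> z - (\<Sum>i\<in>UNIV. h $ i * partial i \<psi> z)) / norm h"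
  have cont [measurable]: "\<psi> \<in> borel_measurable borel" "partial i \<psi> \<in> borel_measurable borel" for i
    using psi partial_test_functions[OF psi] by (auto intro: test_functions_borel)
  have der: "(\<psi> has_derivative (\<lambda>h. \<Sum>i\<in>UNIV. h $ i * partial i \<psi> z)) (at z)" for z
  proof -
    have "frechet_derivative \<psi> (at z) = (\<lambda>h. \<Sum>i\<in>UNIV. h $ i * partial i \<psi> z)"
      using frechet_derivative_eq_sum_partial[OF test_functionsD(2)[OF psi]] by blast
    then show ?thesis using test_functionsD(2)[OF psi, of z] by (simp add: frechet_derivative_works)
  qed
  have "\<forall>i. \<exists>C. \<forall>x. \<bar>partial i \<psi> x\<bar> \<le> C"
    using test_functions_bounded[OF partial_test_functions[OF psi]] by metis
  then obtain C where C: "\<And>i x. \<bar>partial i \<psi> x\<bar> \<le> C i" by metis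
  let ?L = "\<Sum>i\<in>UNIV. C i"
  have lin: "\<bar>\<Sum>i\<in>UNIV. h $ i * partial i \<psi> z\<bar> \<le> ?L * norm h" for h z
  proof -
    have "\<bar>\<Sum>i\<in>UNIV. h $ i * partial i \<psi> z\<bar> \<le> (\<Sum>i\<in>UNIV. C i * norm h)"
      by (rule order_trans[OF sum_abs], rule sum_mono)
        (use C component_le_norm_cart[of h] in \<open>auto simp: abs_mult mult.commute[of "C _"] intro!: mult_mono'\<close>)
    then show ?thesis by (simp add: sum_distrib_right)
  qed
  have lip: "\<bar>\<psi> (z + h) - \<psi> z\<bar> \<le> ?L * norm h" for h z
  proof -
    have "norm (\<psi> (z + h) - \<psi> z) \<le> ?L * norm (z + h - z)"
    proof (rule differentiable_bound[of UNIV])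
      show "onorm (\<lambda>h. \<Sum>i\<in>UNIV. h $ i * partial i \<psi> z) \<le> ?L" for z
        by (rule onorm_le) (use lin in auto)
    qed (use der in auto)
    then show ?thesis by simp
  qed
  have q_bound: "\<bar>?q h z\<bar> \<le> 2 * ?L" for h z
  proof (cases "h = 0")
    case False
    have "\<bar>\<psi> (z + h) - \<psi> z - (\<Sum>i\<in>UNIV. h $ i * partial i \<psi> z)\<bar> \<le> 2 * ?L * norm h"
      using lin[of h z] lip[of z h] by linarith
    then show ?thesis using False by (simp add: abs_divide divide_le_eq)
  next
    \<comment> \<open>Division by zero makes the quotient 0 here, so the bound reduces to
      \<open>?L\<close> being nonnegative.\<close>
    case True
    then show ?thesis using C[of _ 0] by (auto intro!: sum_nonneg intro: order_trans[OF abs_ge_zero])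
  qed
  have conv_q: "(conv F \<psi> (x + h) - conv F \<psi> x - ?D h) / norm h = (LINT y|lborel. F y * ?q h (x - y))" for h
  proof -
    have i1: "integrable lborel (\<lambda>y. F y * \<psi> (x + h - y))" "integrable lborel (\<lambda>y. F y * \<psi> (x - y))"
      "integrable lborel (\<lambda>y. F y * partial i \<psi> (x - y))" for i
      using integrable_conv_integrand[OF F psi] integrable_conv_integrand[OF F partial_test_functions[OF psi]]
      by auto
    have "(LINT y|lborel. F y * ?q h (x - y)) =
      (LINT y|lborel. (F y * \<psi> (x + h - y) - F y * \<psi> (x - y)
         - (\<Sum>i\<in>UNIV. h $ i * (F y * partial i \<psi> (x - y)))) / norm h)"
      by (intro Bochner_Integration.integral_cong)
        (auto simp: algebra_simps sum_distrib_left diff_divide_distrib add_divide_distrib)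
    also have "\<dots> = (conv F \<psi> (x + h) - conv F \<psi> x - ?D h) / norm h"
      using i1 by (simp add: conv_def)
    finally show ?thesis by (rule sym)
  qed
  have "((\<lambda>h. (conv F \<psi> (x + h) - conv F \<psi> x - ?D h) / norm h) \<longlongrightarrow> 0) (at 0)"
    unfolding conv_q
  proof (subst tendsto_at_iff_sequentially, intro allI impI)
    fix X :: "nat \<Rightarrow> real^3"
    assume X: "\<forall>i. X i \<in> UNIV - {0}" "X \<longlonglongrightarrow> 0"
    have "(\<lambda>k. LINT y|lborel. F y * ?q (X k) (x - y)) \<longlonglongrightarrow> (LINT y|(lborel :: (real^3) measure). 0::real)"
    proof (rule integral_dominated_convergence[where w="\<lambda>y. \<bar>F y\<bar> * (2 * ?L)"])
      show "AE y in lborel. (\<lambda>k. F y * ?q (X k) (x - y)) \<longlonglongrightarrow> 0"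
      proof (rule AE_I2)
        fix y
        have "((\<lambda>h. ?q h (x - y)) \<longlongrightarrow> 0) (at 0)"
          using der[of "x - y"] unfolding has_derivative_at_real_quotient by blast
        then have "(\<lambda>k. ?q (X k) (x - y)) \<longlonglongrightarrow> 0"
          using X unfolding tendsto_at_iff_sequentially comp_def by blast
        then show "(\<lambda>k. F y * ?q (X k) (x - y)) \<longlonglongrightarrow> 0" by (rule tendsto_mult_right_zero)
      qed
      show "AE y in lborel. norm (F y * ?q (X k) (x - y)) \<le> \<bar>F y\<bar> * (2 * ?L)" for k
        by (rule AE_I2, unfold real_norm_def abs_mult[of "F _"], rule mult_left_mono[OF q_bound abs_ge_zero])
      have [measurable]: "F \<in> borel_measurable lborel" using F by auto
      show "(\<lambda>y. F y * ?q (X k) (x - y)) \<in> borel_measurable lborel" for k by measurable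
      show "integrable lborel (\<lambda>y. \<bar>F y\<bar> * (2 * ?L))"
        using F by (intro integrable_mult_left integrable_abs)
    qed simp
    then show "((\<lambda>h. LINT y|lborel. F y * ?q h (x - y)) \<circ> X) \<longlonglongrightarrow> 0"
      by (simp add: comp_def)
  qed
  moreover have "bounded_linear ?D"
    by (intro bounded_linear_sum bounded_linear_mult_const bounded_linear_vec_nth)
  ultimately show ?thesis
    unfolding has_derivative_at_real_quotient by blast
qed

lemma Ck_conv:
  assumes F: "integrable lborel F" and psi: "\<psi> \<in> test_functions UNIV"
  shows "partial i (conv F \<psi>) = conv F (partial i \<psi>)" "Ck k (conv F \<psi>)"
proof -
  have p: "partial i (conv F \<psi>) = conv F (partial i \<psi>)" if "\<psi> \<in> test_functions UNIV" for i \<psi>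
  proof
    fix x
    have "partial i (conv F \<psi>) x = (\<Sum>j\<in>UNIV. axis i 1 $ j * conv F (partial j \<psi>) x)"
      by (rule partial_eqI[OF conv_has_derivative[OF F that]])
    also have "\<dots> = (\<Sum>j\<in>UNIV. if j = i then conv F (partial j \<psi>) x else 0)"
      by (intro sum.cong) (auto simp: axis_def)
    finally show "partial i (conv F \<psi>) x = conv F (partial i \<psi>) x" by simp
  qed
  then show "partial i (conv F \<psi>) = conv F (partial i \<psi>)" using psi by blast
  have d: "conv F \<psi> differentiable (at x)" if "\<psi> \<in> test_functions UNIV" for \<psi> x
    using conv_has_derivative[OF F that] differentiable_def by blast
  show "Ck k (conv F \<psi>)"
    using psi
  proof (induction k arbitrary: \<psi>)
    case 0
    then show ?case
      using d by (simp add: continuous_on_eq_continuous_at differentiable_imp_continuous_within)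
  next
    case (Suc k)
    then show ?case using d p partial_test_functions by auto
  qed
qed

text \<open>Every index gets its own bump on the cube of half side \<open>1 / Suc n\<close>, divided
  by its mass, instead of rescalings of one profile. Smoothness, sign, mass one and shrinking
  support are all that matters.\<close>

definition moll :: "nat \<Rightarrow> real^3 \<Rightarrow> real" where
  "moll n x = bump (\<chi> i. - 1 / Suc n) (\<chi> i. 1 / Suc n) x
     / (LINT y|lborel. bump (\<chi> i. - 1 / Suc n) (\<chi> i. 1 / Suc n) y)"

lemma integral_bump_pos:
  assumes "box a b \<noteq> {}"
  shows "0 < (LINT y|lborel. bump a b y)"
proof -
  have int: "integrable lborel (bump a b)"
    using test_functions_integrable[OF bump_test_functions] .
  have "\<not> (AE y in lborel. bump a b y = 0)"
  proof
    assume "AE y in lborel. bump a b y = 0"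
    then have "AE y in lborel. y \<notin> box a b"
      by eventually_elim (use bump_pos_iff[of a b] in force)
    then have "box a b \<in> null_sets lborel" by (simp add: AE_iff_null_sets)
    then have "negligible (box a b)" 
      by (simp add: negligible_iff_null_sets null_sets_completionI)
    then show False using assms open_not_negligible by blast
  qed
  moreover have "0 \<le> (LINT y|lborel. bump a b y)"
    by (intro integral_nonneg_AE AE_I2 bump_nonneg)
  ultimately show ?thesis
    using integral_nonneg_eq_0_iff_AE[OF int] bump_nonneg by (force simp: less_le)
qed

lemma moll_test_functions: "moll n \<in> test_functions UNIV"
proof -
  have "(\<lambda>x. c * bump a b x) \<in> test_functions UNIV" for a b c
    by (rule test_functions_mult[OF bump_test_functions]) (rule Ck_const)
  from this[of "1 / (LINT y|lborel. bump (\<chi> i. - 1 / Suc n) (\<chi> i. 1 / Suc n) y)"]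
  show ?thesis by (simp add: moll_def[abs_def])
qed

lemma
  shows moll_nonneg: "0 \<le> moll n x"
    and moll_support: "moll n x \<noteq> 0 \<Longrightarrow> \<bar>x $ i\<bar> < 1 / Suc n"
    and integral_moll: "(LINT x|lborel. moll n x) = 1"
    and moll_borel [measurable]: "moll n \<in> borel_measurable borel"
    and integrable_moll: "integrable lborel (moll n)"
proof -
  let ?a = "(\<chi> i. - 1 / Suc n) :: real^3" and ?b = "(\<chi> i. 1 / Suc n) :: real^3"
  have pos: "0 < (LINT y|lborel. bump ?a ?b y)"
  proof (rule integral_bump_pos)
    have "0 \<in> box ?a ?b" by (simp add: mem_box_cart)
    then show "box ?a ?b \<noteq> {}" by blast
  qed
  show "0 \<le> moll n x" using pos by (simp add: moll_def bump_nonneg)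
  show "\<bar>x $ i\<bar> < 1 / Suc n" if "moll n x \<noteq> 0"
  proof -
    have "x \<in> box ?a ?b" using that support_bump[of ?a ?b] by (auto simp: moll_def)
    then have "- 1 / Suc n < x $ i \<and> x $ i < 1 / Suc n" by (simp add: mem_box_cart)
    then show ?thesis by (auto simp: abs_less_iff)
  qed
  show "(LINT x|lborel. moll n x) = 1" using pos by (simp add: moll_def)
  show "moll n \<in> borel_measurable borel" by (rule test_functions_borel[OF moll_test_functions])
  show "integrable lborel (moll n)" by (rule test_functions_integrable[OF moll_test_functions])
qed

lemma conv_measurable:
  assumes "integrable lborel F"
  shows "conv F (moll n) \<in> borel_measurable borel"
  by (rule borel_measurable_continuous_onI)
    (use Ck_imp_continuous[OF Ck_conv(2)[OF assms moll_test_functions]] in blast)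

lemma abs_conv_moll_le:
  assumes F: "integrable lborel F" and "AE y in lborel. \<bar>F y\<bar> \<le> M"
  shows "\<bar>conv F (moll n) x\<bar> \<le> M"
proof -
  have "\<bar>conv F (moll n) x\<bar> \<le> (LINT y|lborel. \<bar>F y * moll n (x - y)\<bar>)"
    unfolding conv_def by (rule integral_abs_bound)
  also have "\<dots> \<le> (LINT y|lborel. M * moll n (x - y))"
  proof (rule integral_mono_AE)
    show "AE y in lborel. \<bar>F y * moll n (x - y)\<bar> \<le> M * moll n (x - y)"
      using assms(2) by eventually_elim (auto simp: abs_mult moll_nonneg intro!: mult_right_mono)
    show "integrable lborel (\<lambda>y. M * moll n (x - y))"
      using lborel_reflect(2)[OF moll_borel, of n x] integrable_moll[of n] by (intro integrable_mult_right) simp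
    show "integrable lborel (\<lambda>y. \<bar>F y * moll n (x - y)\<bar>)"
      by (rule integrable_abs[OF integrable_conv_integrand[OF F moll_test_functions]])
  qed
  also have "\<dots> = M" using lborel_reflect(1)[OF moll_borel, of n x] by (simp add: integral_moll)
  finally show ?thesis .
qed

text \<open>By Tonelli the mass of the mollifier integrates out to one. The bound is uniform in
  \<open>n\<close>, which is what lets L1 convergence pass from a dense class to its
  closure.\<close>

lemma conv_moll_L1:
  assumes F: "integrable lborel F"
  shows "integrable lborel (conv F (moll n))"
    and "(LINT x|lborel. \<bar>conv F (moll n) x\<bar>) \<le> (LINT x|lborel. \<bar>F x\<bar>)"
proof -
  have [measurable]: "F \<in> borel_measurable borel" using F by auto
  have [measurable]: "conv F (moll n) \<in> borel_measurable borel" by (rule conv_measurable[OF F])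
  have "(\<integral>\<^sup>+x. ennreal \<bar>conv F (moll n) x\<bar> \<partial>lborel)
      \<le> (\<integral>\<^sup>+x. (\<integral>\<^sup>+y. ennreal (\<bar>F y\<bar> * moll n (x - y)) \<partial>lborel) \<partial>lborel)"
  proof (rule nn_integral_mono)
    fix x
    have "ennreal \<bar>conv F (moll n) x\<bar> \<le> ennreal (LINT y|lborel. \<bar>F y * moll n (x - y)\<bar>)"
      unfolding conv_def by (intro ennreal_leI integral_abs_bound)
    also have "\<dots> = (\<integral>\<^sup>+y. ennreal \<bar>F y * moll n (x - y)\<bar> \<partial>lborel)"
      by (rule nn_integral_eq_integral[symmetric])
        (auto intro!: integrable_abs integrable_conv_integrand[OF F moll_test_functions])
    finally show "ennreal \<bar>conv F (moll n) x\<bar> \<le> (\<integral>\<^sup>+y. ennreal (\<bar>F y\<bar> * moll n (x - y)) \<partial>lborel)"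
      by (simp add: abs_mult moll_nonneg)
  qed
  also have "\<dots> = (\<integral>\<^sup>+y. (\<integral>\<^sup>+x. ennreal (\<bar>F y\<bar> * moll n (x - y)) \<partial>lborel) \<partial>lborel)"
    by (rule lborel_pair.Fubini') simp
  also have "\<dots> = (\<integral>\<^sup>+y. ennreal \<bar>F y\<bar> * (\<integral>\<^sup>+x. ennreal (moll n (x + (- y))) \<partial>lborel) \<partial>lborel)"
    by (simp add: ennreal_mult' nn_integral_cmult moll_nonneg)
  also have "\<dots> = (\<integral>\<^sup>+y. ennreal \<bar>F y\<bar> \<partial>lborel)"
  proof -
    have "(\<integral>\<^sup>+x. ennreal (moll n (x + (- y))) \<partial>lborel) = 1" for y
      by (subst lborel_translate(3)) 
        (simp_all add: nn_integral_eq_integral integrable_moll moll_nonneg integral_moll)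
    then show ?thesis by simp
  qed
  finally have le: "(\<integral>\<^sup>+x. ennreal \<bar>conv F (moll n) x\<bar> \<partial>lborel) \<le> (\<integral>\<^sup>+y. ennreal \<bar>F y\<bar> \<partial>lborel)" .
  have fin: "(\<integral>\<^sup>+y. ennreal \<bar>F y\<bar> \<partial>lborel) = ennreal (LINT x|lborel. \<bar>F x\<bar>)"
    by (rule nn_integral_eq_integral) (use F in auto)
  show int: "integrable lborel (conv F (moll n))"
  proof (rule integrableI_bounded)
    show "(\<integral>\<^sup>+x. ennreal (norm (conv F (moll n) x)) \<partial>lborel) < \<infinity>"
      using le fin by (simp add: order_le_less_trans)
  qed simp
  have "ennreal (LINT x|lborel. \<bar>conv F (moll n) x\<bar>) \<le> ennreal (LINT x|lborel. \<bar>F x\<bar>)"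
    using le fin nn_integral_eq_integral[OF integrable_abs[OF int]] by simp
  then show "(LINT x|lborel. \<bar>conv F (moll n) x\<bar>) \<le> (LINT x|lborel. \<bar>F x\<bar>)"
    by (subst (asm) ennreal_le_iff) auto
qed

lemma conv_diff:
  assumes "integrable lborel F" "integrable lborel G"
  shows "conv (\<lambda>x. F x - G x) (moll n) x = conv F (moll n) x - conv G (moll n) x"
  using integrable_conv_integrand[OF assms(1) moll_test_functions]
    integrable_conv_integrand[OF assms(2) moll_test_functions]
  by (simp add: conv_def left_diff_distrib)

lemma conv_cmult: "conv (\<lambda>x. c * F x) \<psi> x = c * conv F \<psi> x"
  by (simp add: conv_def mult.assoc)

section \<open>L1 convergence of mollifications\<close>

definition moll_conv :: "(real^3 \<Rightarrow> real) \<Rightarrow> bool" where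
  "moll_conv F \<longleftrightarrow> integrable lborel F \<and> (\<lambda>n. LINT x|lborel. \<bar>conv F (moll n) x - F x\<bar>) \<longlonglongrightarrow> 0"

text \<open>The error for \<open>F\<close> splits into the mollified difference of \<open>F\<close>
  and \<open>G\<close>, the error for \<open>G\<close>, and the difference of \<open>F\<close> and
  \<open>G\<close>. \<open>conv_moll_L1\<close> bounds the first by the last, hence the thirds of
  \<open>e\<close>.\<close>

lemma moll_conv_closed:
  assumes F: "integrable lborel F"
    and ap: "\<And>e. 0 < e \<Longrightarrow> \<exists>G. moll_conv G \<and> (LINT x|lborel. \<bar>F x - G x\<bar>) < e"
  shows "moll_conv F"
  unfolding moll_conv_def
proof (intro conjI F LIMSEQ_I)
  fix e :: real
  assume "0 < e"
  then obtain G where G: "moll_conv G" and FG: "(LINT x|lborel. \<bar>F x - G x\<bar>) < e / 3"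
    using ap[of "e / 3"] by auto
  have Gi: "integrable lborel G" using G by (simp add: moll_conv_def)
  obtain N where N: "\<And>n. n \<ge> N \<Longrightarrow> (LINT x|lborel. \<bar>conv G (moll n) x - G x\<bar>) < e / 3"
    using G \<open>0 < e\<close> LIMSEQ_D[of _ 0 "e/3"] by (fastforce simp: moll_conv_def)
  show "\<exists>no. \<forall>n\<ge>no. norm ((LINT x|lborel. \<bar>conv F (moll n) x - F x\<bar>) - 0) < e"
  proof (intro exI allI impI)
    fix n assume "N \<le> n"
    note int = conv_moll_L1(1)[OF F, of n] conv_moll_L1(1)[OF Gi, of n] F Gi
    let ?c = "conv (\<lambda>x. F x - G x) (moll n)"
    have "(LINT x|lborel. \<bar>conv F (moll n) x - F x\<bar>)
      \<le> (LINT x|lborel. \<bar>?c x\<bar> + \<bar>conv G (moll n) x - G x\<bar> + \<bar>F x - G x\<bar>)"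
      by (rule integral_mono) (use int in \<open>auto simp: conv_diff\<close>)
    also have "\<dots> = (LINT x|lborel. \<bar>?c x\<bar>) + (LINT x|lborel. \<bar>conv G (moll n) x - G x\<bar>)
        + (LINT x|lborel. \<bar>F x - G x\<bar>)"
      using int conv_moll_L1(1)[of "\<lambda>x. F x - G x" n] by simp
    also have "(LINT x|lborel. \<bar>?c x\<bar>) \<le> (LINT x|lborel. \<bar>F x - G x\<bar>)"
      using F Gi by (intro conv_moll_L1) auto
    finally show "norm ((LINT x|lborel. \<bar>conv F (moll n) x - F x\<bar>) - 0) < e"
      using FG N[OF \<open>N \<le> n\<close>] by (simp add: integral_nonneg_AE)
  qed
qed

lemma moll_conv_diff:
  assumes "moll_conv F" "moll_conv G"
  shows "moll_conv (\<lambda>x. F x - G x)"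
proof -
  have F: "integrable lborel F" and G: "integrable lborel G" using assms by (auto simp: moll_conv_def)
  have "(\<lambda>n. LINT x|lborel. \<bar>conv (\<lambda>x. F x - G x) (moll n) x - (F x - G x)\<bar>) \<longlonglongrightarrow> 0"
  proof (rule tendsto_sandwich[OF _ _ tendsto_const])
    show "(\<lambda>n. (LINT x|lborel. \<bar>conv F (moll n) x - F x\<bar>) + (LINT x|lborel. \<bar>conv G (moll n) x - G x\<bar>)) \<longlonglongrightarrow> 0"
      using assms tendsto_add[of _ 0 sequentially _ 0] by (auto simp: moll_conv_def)
    show "\<forall>\<^sub>F n in sequentially. (LINT x|lborel. \<bar>conv (\<lambda>x. F x - G x) (moll n) x - (F x - G x)\<bar>)
      \<le> (LINT x|lborel. \<bar>conv F (moll n) x - F x\<bar>) + (LINT x|lborel. \<bar>conv G (moll n) x - G x\<bar>)"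
    proof (rule always_eventually, rule allI)
      fix n
      note int = conv_moll_L1(1)[OF F, of n] conv_moll_L1(1)[OF G, of n] F G
      have "(LINT x|lborel. \<bar>conv (\<lambda>x. F x - G x) (moll n) x - (F x - G x)\<bar>)
        \<le> (LINT x|lborel. \<bar>conv F (moll n) x - F x\<bar> + \<bar>conv G (moll n) x - G x\<bar>)"
        by (rule integral_mono) (use int in \<open>auto simp: conv_diff\<close>)
      then show "(LINT x|lborel. \<bar>conv (\<lambda>x. F x - G x) (moll n) x - (F x - G x)\<bar>)
        \<le> (LINT x|lborel. \<bar>conv F (moll n) x - F x\<bar>) + (LINT x|lborel. \<bar>conv G (moll n) x - G x\<bar>)"
        using int by simp
    qed
  qed (auto intro!: always_eventually integral_nonneg_AE)
  then show ?thesis using F G by (simp add: moll_conv_def)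
qed

lemma moll_conv_cmult:
  assumes "moll_conv F"
  shows "moll_conv (\<lambda>x. c * F x)"
proof -
  have "(\<lambda>n. LINT x|lborel. \<bar>conv (\<lambda>x. c * F x) (moll n) x - c * F x\<bar>) =
     (\<lambda>n. \<bar>c\<bar> * (LINT x|lborel. \<bar>conv F (moll n) x - F x\<bar>))"
    by (simp add: conv_cmult abs_mult flip: right_diff_distrib)
  then show ?thesis using assms tendsto_mult_right_zero[of _ sequentially "\<bar>c\<bar>"]
    by (simp add: moll_conv_def)
qed

lemma moll_conv_add:
  assumes "moll_conv F" "moll_conv G"
  shows "moll_conv (\<lambda>x. F x + G x)"
  using moll_conv_diff[OF assms(1) moll_conv_cmult[OF assms(2), of "-1"]] by simp

lemma conv_moll_local_const:
  assumes "\<And>y. (\<And>i. \<bar>x $ i - y $ i\<bar> < 1 / Suc n) \<Longrightarrow> F y = c"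
  shows "conv F (moll n) x = c"
proof -
  have "F y * moll n (x - y) = c * moll n (x - y)" for y
    using assms[of y] moll_support[of n "x - y"] by (cases "moll n (x - y) = 0") auto
  then show ?thesis
    using lborel_reflect(1)[OF moll_borel, of n x] unfolding conv_def
    by (simp only: integral_moll) (simp add: integral_moll)
qed

text \<open>Off the faces of the box the indicator is locally constant, and a mollifier of small
  enough support reproduces a locally constant value exactly; the faces are null. The box enlarged
  by \<open>?one\<close> carries the majorant because no mollifier reaches further than distance 1
  in any coordinate.\<close>

lemma moll_conv_box: "moll_conv (indicator (box a b))"
proof -
  let ?F = "indicator (box a b) :: real^3 \<Rightarrow> real"
  have F: "integrable lborel ?F"
    by (rule integrable_real_indicator) (use emeasure_lborel_box_finite in auto)
  let ?one = "(\<chi> i. 1) :: real^3"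
  have small: "eventually (\<lambda>n. 1 / real (Suc n) < d) sequentially" if "d > 0" for d
    using LIMSEQ_inverse_real_of_nat that
    by (auto dest: order_tendstoD(2)[of _ 0 sequentially d] simp: inverse_eq_divide)
  have ptw: "(\<lambda>n. \<bar>conv ?F (moll n) x - ?F x\<bar>) \<longlonglongrightarrow> 0" if x: "x \<notin> cbox a b - box a b" for x
  proof -
    have ex: "\<exists>d>0. \<forall>y. (\<forall>i. \<bar>x $ i - y $ i\<bar> < d) \<longrightarrow> ?F y = ?F x"
    proof (cases "x \<in> box a b")
      case True
      let ?d = "Min ((\<lambda>i. min (x $ i - a $ i) (b $ i - x $ i)) ` UNIV)"
      have "?d > 0" using True by (subst Min_gr_iff) (auto simp: mem_box_cart)
      moreover have "y \<in> box a b" if "\<forall>i. \<bar>x $ i - y $ i\<bar> < ?d" for y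
        using that by (subst (asm) Min_gr_iff) (auto simp: mem_box_cart abs_less_iff, (smt (verit))+)
      ultimately show ?thesis using True by (intro exI[of _ ?d]) auto
    next
      case False
      then obtain i where i: "x $ i < a $ i \<or> b $ i < x $ i"
        using x by (auto simp: mem_box_cart not_le)
      define d where "d = (if x $ i < a $ i then a $ i - x $ i else x $ i - b $ i)"
      have "d > 0" using i by (auto simp: d_def)
      moreover have "y \<notin> box a b" if "\<forall>i. \<bar>x $ i - y $ i\<bar> < d" for y
        using that[rule_format, of i] i by (auto simp: mem_box_cart d_def intro!: exI[of _ i] split: if_splits)
      ultimately show ?thesis using False by (intro exI[of _ d]) auto
    qed
    then obtain d where d: "d > 0" "\<And>y. (\<And>i. \<bar>x $ i - y $ i\<bar> < d) \<Longrightarrow> ?F y = ?F x" by blast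
    have "eventually (\<lambda>n. \<bar>conv ?F (moll n) x - ?F x\<bar> = 0) sequentially"
      using small[OF d(1)]
    proof eventually_elim
      case (elim n)
      have "conv ?F (moll n) x = ?F x"
        by (rule conv_moll_local_const) (rule d(2), rule less_trans, assumption, rule elim)
      then show ?case by simp
    qed
    then show ?thesis by (rule tendsto_eventually)
  qed
  have out: "conv ?F (moll n) x = 0" if "x \<notin> cbox (a - ?one) (b + ?one)" for x n
  proof (rule conv_moll_local_const)
    fix y :: "real^3"
    assume y: "\<And>i. \<bar>x $ i - y $ i\<bar> < 1 / Suc n"
    from that obtain i where "x $ i < a $ i - 1 \<or> b $ i + 1 < x $ i"
      by (auto simp: mem_box_cart not_le)
    moreover have "\<bar>x $ i - y $ i\<bar> < 1"
      using y[of i] by (rule order_less_le_trans) (simp add: field_simps)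
    ultimately have "y \<notin> box a b" by (auto simp: mem_box_cart intro!: exI[of _ i])
    then show "?F y = 0" by simp
  qed
  have "(\<lambda>n. LINT x|lborel. \<bar>conv ?F (moll n) x - ?F x\<bar>) \<longlonglongrightarrow> (LINT x|(lborel::(real^3) measure). 0::real)"
  proof (rule integral_dominated_convergence[where w="\<lambda>x. 2 * indicator (cbox (a - ?one) (b + ?one)) x"])
    have "cbox a b - box a b \<in> null_sets lborel"
      using negligible_frontier_interval[of a b] by (simp add: negligible_iff_null_sets null_sets_completion_iff)
    then show "AE x in lborel. (\<lambda>n. \<bar>conv ?F (moll n) x - ?F x\<bar>) \<longlonglongrightarrow> 0"
      by (rule AE_I') (use ptw in auto)
    show "AE x in lborel. norm \<bar>conv ?F (moll n) x - ?F x\<bar> \<le> 2 * indicator (cbox (a - ?one) (b + ?one)) x" for n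
    proof (rule AE_I2)
      fix x
      have le1: "\<bar>conv ?F (moll n) x\<bar> \<le> 1" by (rule abs_conv_moll_le[OF F]) (auto simp: indicator_def)
      show "norm \<bar>conv ?F (moll n) x - ?F x\<bar> \<le> 2 * indicator (cbox (a - ?one) (b + ?one)) x"
      proof (cases "x \<in> cbox (a - ?one) (b + ?one)")
        case True
        then show ?thesis using le1 by (auto simp: indicator_def)
      next
        case False
        then have "x \<notin> box a b" by (auto simp: mem_box_cart) (smt (verit))+
        then show ?thesis using out[OF False, of n] False by simp
      qed
    qed
    have "integrable lborel (indicator (cbox (a - ?one) (b + ?one)) :: _ \<Rightarrow> real)"
      by (rule integrable_real_indicator) (use emeasure_lborel_cbox_finite in auto)
    then show "integrable lborel (\<lambda>x. 2 * indicator (cbox (a - ?one) (b + ?one)) x :: real)"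
      by (rule integrable_mult_right)
  qed (use conv_measurable[OF F] in auto)
  then show ?thesis using F by (simp add: moll_conv_def)
qed

lemma moll_conv_lim:
  assumes F: "integrable lborel F" and s: "\<And>k. moll_conv (s k)"
    and lim: "AE x in lborel. (\<lambda>k. s k x) \<longlonglongrightarrow> F x"
    and w: "integrable lborel w" "\<And>k. AE x in lborel. \<bar>s k x\<bar> \<le> w x"
  shows "moll_conv F"
proof (rule moll_conv_closed[OF F])
  fix e :: real
  assume "0 < e"
  have si: "integrable lborel (s k)" for k using s by (simp add: moll_conv_def)
  have "(\<lambda>k. LINT x|lborel. \<bar>F x - s k x\<bar>) \<longlonglongrightarrow> (LINT x|(lborel::(real^3) measure). 0::real)"
  proof (rule integral_dominated_convergence[where w="\<lambda>x. \<bar>F x\<bar> + w x"])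
    show "AE x in lborel. (\<lambda>k. \<bar>F x - s k x\<bar>) \<longlonglongrightarrow> 0"
      using lim
    proof eventually_elim
      case (elim x)
      from tendsto_rabs[OF tendsto_diff[OF tendsto_const[of "F x"] elim]]
      show ?case by simp
    qed
    show "AE x in lborel. norm \<bar>F x - s k x\<bar> \<le> \<bar>F x\<bar> + w x" for k
      using w(2)[of k] by eventually_elim auto
  qed (use F si w in auto)
  then have "\<exists>k. (LINT x|lborel. \<bar>F x - s k x\<bar>) < e"
    using \<open>0 < e\<close> by (auto dest!: order_tendstoD(2)[of _ _ _ e] eventually_happens)
  then show "\<exists>G. moll_conv G \<and> (LINT x|lborel. \<bar>F x - G x\<bar>) < e"
    using s by blast
qed

lemma moll_conv_sum:
  fixes n :: nat
  assumes "\<And>i. i < n \<Longrightarrow> moll_conv (f i)"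
  shows "moll_conv (\<lambda>x. \<Sum>i<n. f i x)"
  using assms
proof (induction n)
  case 0
  show ?case using moll_conv_cmult[OF moll_conv_box[of 0 0], of 0] by simp
next
  case (Suc n)
  then show ?case using moll_conv_add[of "\<lambda>x. \<Sum>i<n. f i x" "f n"] by simp
qed

text \<open>Dynkin's argument: boxes form an intersection-stable generator of the Borel sets.
  Cutting everything with one fixed box keeps complements integrable and supplies the majorant for
  countable unions.\<close>

lemma moll_conv_bounded_borel:
  assumes "A \<in> sets borel"
  shows "moll_conv (indicator (A \<inter> box (- c) c))"
proof -
  let ?G = "range (\<lambda>(a, b). box a b :: (real^3) set)"
  have A: "A \<in> sigma_sets UNIV ?G"
    using assms by (subst (asm) borel_eq_box) simp
  have "Int_stable ?G"
  proof (rule Int_stableI, clarify)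
    fix a b c d :: "real^3"
    have "box a b \<inter> box c d = box (\<chi> i. max (a$i) (c$i)) (\<chi> i. min (b$i) (d$i))"
      by (auto simp: mem_box_cart)
    then show "box a b \<inter> box c d \<in> range (\<lambda>(a, b). box a b)" by auto
  qed
  moreover have "?G \<subseteq> Pow UNIV" by simp
  ultimately show ?thesis
    using A
  proof (induction A rule: sigma_sets_induct_disjoint)
    case (basic A)
    then obtain a b where "A = box a b" by auto
    moreover have "box a b \<inter> box (- c) c = box (\<chi> i. max (a$i) ((-c)$i)) (\<chi> i. min (b$i) (c$i))"
      by (auto simp: mem_box_cart)
    ultimately show ?case using moll_conv_box by simp
  next
    case empty
    show ?case using moll_conv_cmult[OF moll_conv_box[of 0 0], of 0] by simp
  next
    case (compl A)
    have "indicator ((UNIV - A) \<inter> box (- c) c)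
        = (\<lambda>x. indicator (box (- c) c) x - indicator (A \<inter> box (- c) c) x :: real)"
      by (auto simp: indicator_def)
    then show ?case using moll_conv_diff[OF moll_conv_box compl(2)] by simp
  next
    case (union A)
    have [measurable]: "A i \<in> sets borel" for i
      using union(2) by (subst borel_eq_box) auto
    let ?s = "\<lambda>k x. \<Sum>i<k. indicator (A i \<inter> box (- c) c) x :: real"
    have s: "?s k x = indicator ((\<Union>i<k. A i) \<inter> box (- c) c) x" for k x
    proof -
      have d: "disjoint_family_on (\<lambda>i. A i \<inter> box (- c) c) {..<k}"
        using union(1) by (auto simp: disjoint_family_on_def)
      have "(\<Union>i<k. A i) \<inter> box (- c) c = (\<Union>i<k. A i \<inter> box (- c) c)" by auto
      moreover have "(indicator (\<Union>i<k. A i \<inter> box (- c) c) x :: real) = ?s k x"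
        by (rule indicator_UN_disjoint[OF finite_lessThan d])
      ultimately show ?thesis by simp
    qed
    show ?case
    proof (rule moll_conv_lim[where s="?s" and w="indicator (box (- c) c)"])
      show "integrable lborel (indicator ((\<Union>i. A i) \<inter> box (- c) c) :: _ \<Rightarrow> real)"
        by (rule integrable_real_indicator)
          (auto intro: le_less_trans[OF emeasure_mono emeasure_lborel_box_finite[of "-c" c, unfolded infinity_ennreal_def]])
      show "moll_conv (?s k)" for k
        by (rule moll_conv_sum) (rule union(3))
      show "AE x in lborel. (\<lambda>k. ?s k x) \<longlonglongrightarrow> indicator ((\<Union>i. A i) \<inter> box (- c) c) x"
      proof (rule AE_I2)
        fix x
        have "(\<lambda>k. indicator (\<Union>i<k. A i \<inter> box (- c) c) x :: real) \<longlonglongrightarrow> indicator (\<Union>i. A i \<inter> box (- c) c) x"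
          by (rule LIMSEQ_indicator_UN)
        then show "(\<lambda>k. ?s k x) \<longlonglongrightarrow> indicator ((\<Union>i. A i) \<inter> box (- c) c) x"
          unfolding s by (simp flip: UN_extend_simps)
      qed
      show "AE x in lborel. \<bar>?s k x\<bar> \<le> indicator (box (- c) c) x" for k
        unfolding s by (rule AE_I2) (auto simp: indicator_def)
      show "integrable lborel (indicator (box (- c) c) :: _ \<Rightarrow> real)"
        by (rule integrable_real_indicator) (use emeasure_lborel_box_finite in auto)
    qed
  qed
qed

text \<open>Indicators of sets of finite measure are reached by cutting with growing boxes; the
  induction for integrable functions supplies sums and dominated limits.\<close>

lemma moll_conv_integrable:
  assumes "integrable lborel F"
  shows "moll_conv F"
  using assms
proof (induction rule: integrable_induct)
  case (base A c)
  then have [measurable]: "A \<in> sets borel" and fin: "emeasure lborel A < \<infinity>" by auto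
  have "moll_conv (indicator A)"
  proof (rule moll_conv_lim[where s="\<lambda>k. indicator (A \<inter> box (- (\<chi> i. real k)) (\<chi> i. real k))" and w="indicator A"])
    show "AE x in lborel. (\<lambda>k. indicator (A \<inter> box (- (\<chi> i. real k)) (\<chi> i. real k)) x :: real) \<longlonglongrightarrow> indicator A x"
    proof (rule AE_I2)
      fix x :: "real^3"
      have "eventually (\<lambda>k. norm x < real k) sequentially"
        by (rule eventually_compose_filterlim[OF eventually_gt_at_top filterlim_real_sequentially])
      then show "(\<lambda>k. indicator (A \<inter> box (- (\<chi> i. real k)) (\<chi> i. real k)) x :: real) \<longlonglongrightarrow> indicator A x"
      proof (rule tendsto_eventually[OF eventually_mono])
        fix k assume k: "norm x < real k"
        have "\<bar>x $ i\<bar> < real k" for i using component_le_norm_cart[of x i] k by linarith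
        then show "indicator (A \<inter> box (- (\<chi> i. real k)) (\<chi> i. real k)) x = (indicator A x :: real)"
          by (auto simp: indicator_def mem_box_cart abs_less_iff) (smt (verit))+
      qed
    qed
  qed (use fin moll_conv_bounded_borel in \<open>auto simp: indicator_def\<close>)
  then show ?case using moll_conv_cmult[of "indicator A" c] by (simp add: mult.commute)
next
  case (add f g)
  then show ?case by (intro moll_conv_add)
next
  case (lim f s)
  then show ?case
    by (intro moll_conv_lim[of f s "\<lambda>x. 2 * \<bar>f x\<bar>"] AE_I2) simp_all
qed

subsection \<open>Weak derivatives\<close>

text \<open>Fields are Lebesgue measurable on a set, while translation and Tonelli are used for
  \<open>lborel\<close> on the whole space. A Borel representative of the extension by zero connects
  the two settings.\<close>

lemma lebesgue_on_borel_representative: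
  fixes f :: "'a::euclidean_space \<Rightarrow> real"
  assumes S: "S \<in> sets lebesgue" and f: "integrable (lebesgue_on S) f"
  obtains F where "integrable lborel F" "AE x in lebesgue. F x = indicator S x * f x"
proof -
  have fi: "integrable lebesgue (\<lambda>x. indicator S x * f x)"
    using f S by (simp add: integrable_restrict_space)
  then obtain F where F: "F \<in> borel_measurable lborel" "AE x in lborel. indicator S x * f x = F x"
    using completion_ex_borel_measurable_real[of "\<lambda>x. indicator S x * f x" lborel]
    by (auto dest: borel_measurable_integrable)
  have ae: "AE x in lebesgue. F x = indicator S x * f x"
    using AE_completion[OF F(2)] by (simp add: eq_commute)
  have [measurable]: "F \<in> borel_measurable lebesgue" using F(1) by (rule measurable_completion)
  have "integrable lebesgue F"
    using fi ae F(1) by (subst integrable_cong_AE) (auto dest: borel_measurable_integrable)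
  then have "integrable lborel F" using integrable_completion[OF F(1)] by simp
  then show ?thesis using ae that by blast
qed

text \<open>The two sets allow \<open>T\<close> to be the whole domain while the representative is
  taken on a smaller \<open>S\<close>, for instance a compact box on which a locally integrable
  function is integrable. The factor \<open>g\<close> vanishes on the difference.\<close>

lemma lebesgue_on_borel_representative_integral:
  fixes f g :: "'a::euclidean_space \<Rightarrow> real"
  assumes S: "S \<in> sets lebesgue" "S \<subseteq> T" "T \<in> sets lebesgue" and f: "integrable (lebesgue_on S) f"
    and F: "integrable lborel F" "AE x in lebesgue. F x = indicator S x * f x"
    and g: "g \<in> borel_measurable lborel" "\<And>x. x \<in> T - S \<Longrightarrow> g x = 0"
  shows "(LINT x|lebesgue_on T. f x * g x) = (LINT x|lborel. F x * g x)"
proof -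
  have "(\<lambda>x. indicator S x * f x) \<in> borel_measurable lebesgue"
    using f S by (simp add: integrable_restrict_space borel_measurable_integrable)
  moreover have gm: "g \<in> borel_measurable lebesgue" using g(1) by (rule measurable_completion)
  moreover have Fm: "F \<in> borel_measurable lebesgue" using F(1) by (auto intro: measurable_completion)
  moreover have eq: "indicator T x * (f x * g x) = indicator S x * f x * g x" for x
    using g(2)[of x] S(2) by (auto simp: indicator_def)
  ultimately have "(LINT x|lebesgue. indicator T x * (f x * g x)) = (LINT x|lebesgue. F x * g x)"
    using F(2) by (intro integral_cong_AE) (auto simp: eq)
  also have "\<dots> = (LINT x|lborel. F x * g x)"
    using F(1) g(1) by (intro integral_completion) auto
  finally show ?thesis using S by (simp add: integral_restrict_space)
qed

lemma AE_lebesgue_on_iff: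
  assumes "S \<in> sets lebesgue"
  shows "(AE x in lebesgue_on S. P x) \<longleftrightarrow> (AE x in lebesgue. x \<in> S \<longrightarrow> P x)"
  using assms by (simp add: AE_restrict_space_iff)

text \<open>This rests on the completeness of Lebesgue measure.\<close>

lemma borel_measurable_lebesgue_on_AE:
  fixes f g :: "'a::euclidean_space \<Rightarrow> 'b::euclidean_space"
  assumes S: "S \<in> sets lebesgue" and f: "f \<in> borel_measurable (lebesgue_on S)"
    and ae: "AE x in lebesgue_on S. f x = g x"
  shows "g \<in> borel_measurable (lebesgue_on S)"
proof -
  have "(\<lambda>x. indicator S x *\<^sub>R f x) \<in> borel_measurable lebesgue"
    using f S by (simp add: borel_measurable_restrict_space_iff)
  moreover have "AE x in lebesgue. indicator S x *\<^sub>R f x = indicator S x *\<^sub>R g x"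
    using ae unfolding AE_lebesgue_on_iff[OF S] by eventually_elim (auto simp: indicator_def)
  ultimately have "(\<lambda>x. indicator S x *\<^sub>R g x) \<in> borel_measurable lebesgue"
    by (rule borel_measurable_AE)
  then show ?thesis using S by (simp add: borel_measurable_restrict_space_iff)
qed

lemma absolutely_integrable_on_iff_lebesgue_on:
  fixes f :: "'a::euclidean_space \<Rightarrow> real"
  assumes "S \<in> sets lebesgue"
  shows "f absolutely_integrable_on S \<longleftrightarrow> integrable (lebesgue_on S) f"
  using assms by (simp add: set_integrable_def integrable_restrict_space)

text \<open>Integrating against the reflected mollifier evaluates a convolution at \<open>x\<close>;
  this is how identities tested against functions become pointwise statements. The cube in the
  hypothesis is closed because the support is a closure.\<close>

lemma moll_reflect_test_functions:
  assumes "\<And>y. (\<And>i. \<bar>x $ i - y $ i\<bar> \<le> 1 / Suc n) \<Longrightarrow> y \<in> \<Omega>"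
  shows "(\<lambda>y. moll n (x - y)) \<in> test_functions \<Omega>"
    and "partial i (\<lambda>y. moll n (x - y)) y = - partial i (moll n) (x - y)"
proof -
  have "closed {z::real^3. \<forall>i. \<bar>z $ i\<bar> \<le> 1 / Suc n}"
    by (intro closed_Collect_all closed_Collect_le continuous_intros)
  then have "closure {z. moll n z \<noteq> 0} \<subseteq> {z. \<forall>i. \<bar>z $ i\<bar> \<le> 1 / Suc n}"
    using moll_support by (intro closure_minimal) (auto intro: less_imp_le)
  then have "(\<lambda>y. moll n ((-1) *\<^sub>R y + x)) \<in> test_functions \<Omega>"
    by (intro test_functions_affine moll_test_functions assms) (auto simp: subset_eq)
  then show "(\<lambda>y. moll n (x - y)) \<in> test_functions \<Omega>" by simp
  have "moll n differentiable (at ((-1) *\<^sub>R y + x))" by (rule test_functionsD(2)[OF moll_test_functions])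
  from partial_affine(1)[OF this, of i]
  show "partial i (\<lambda>y. moll n (x - y)) y = - partial i (moll n) (x - y)" by simp
qed

lemma moll_neighbourhood:
  assumes "compact K" "open \<Omega>" "K \<subseteq> \<Omega>"
  shows "\<forall>\<^sub>F n in sequentially. \<forall>x\<in>K. \<forall>y. (\<forall>i. \<bar>x $ i - y $ i\<bar> \<le> 1 / Suc n) \<longrightarrow> y \<in> (\<Omega> :: (real^3) set)"
proof -
  obtain e where e: "e > 0" "(\<Union>x\<in>K. ball x e) \<subseteq> \<Omega>"
    using compact_subset_open_imp_ball_epsilon_subset[OF assms] by blast
  \<comment> \<open>The Euclidean norm is bounded by the sum of three coordinates, hence the third
    of \<open>e\<close>.\<close>
  have "\<forall>\<^sub>F n in sequentially. 1 / real (Suc n) < e / 3"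
    using order_tendstoD(2)[OF LIMSEQ_inverse_real_of_nat, of "e/3"] e(1) by (simp add: inverse_eq_divide)
  then show ?thesis
  proof eventually_elim
    case (elim n)
    show ?case
    proof (intro ballI allI impI)
      fix x y :: "real^3"
      assume "x \<in> K" and xy: "\<forall>i. \<bar>x $ i - y $ i\<bar> \<le> 1 / real (Suc n)"
      have "norm (x - y) \<le> (\<Sum>i\<in>UNIV. \<bar>(x - y) $ i\<bar>)" by (rule norm_le_l1_cart)
      also have "\<dots> \<le> (\<Sum>i\<in>(UNIV::3 set). 1 / real (Suc n))" using xy by (intro sum_mono) simp
      also have "\<dots> < e" using elim by simp
      finally have "y \<in> ball x e" by (simp add: dist_norm)
      then show "y \<in> \<Omega>" using e(2) \<open>x \<in> K\<close> by blast
    qed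
  qed
qed

lemma conv_moll_AE_subseq:
  assumes "integrable lborel F"
  obtains r :: "nat \<Rightarrow> nat" where "strict_mono r"
    "AE x in lborel. (\<lambda>k. conv F (moll (r k)) x) \<longlonglongrightarrow> F x"
proof -
  have "\<exists>r::nat\<Rightarrow>nat. strict_mono r \<and> (AE x in lborel. (\<lambda>k. conv F (moll (r k)) x - F x) \<longlonglongrightarrow> 0)"
    by (rule tendsto_L1_AE_subseq)
      (use moll_conv_integrable[OF assms] conv_moll_L1(1)[OF assms] assms in \<open>auto simp: moll_conv_def\<close>)
  then obtain r :: "nat \<Rightarrow> nat"
    where r: "strict_mono r" "AE x in lborel. (\<lambda>k. conv F (moll (r k)) x - F x) \<longlonglongrightarrow> 0" by blast
  show ?thesis
  proof (rule that[OF r(1)])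
    show "AE x in lborel. (\<lambda>k. conv F (moll (r k)) x) \<longlonglongrightarrow> F x"
      using r(2)
    proof eventually_elim
      case (elim x)
      from tendsto_add[OF elim tendsto_const[of "F x"]] show ?case by simp
    qed
  qed
qed

lemma compact_sets_lebesgue: "compact K \<Longrightarrow> K \<in> sets lebesgue"
  by (simp add: compact_imp_closed)

lemma ae_eq_sym: "ae_eq \<Omega> f g \<Longrightarrow> ae_eq \<Omega> g f"
  by (simp add: ae_eq_def eq_commute)

lemma ae_eq_trans: "ae_eq \<Omega> f g \<Longrightarrow> ae_eq \<Omega> g h \<Longrightarrow> ae_eq \<Omega> f h"
  unfolding ae_eq_def by (auto elim: eventually_elim2)

lemma test_functions_eq_0: "\<phi> \<in> test_functions A \<Longrightarrow> x \<notin> A \<Longrightarrow> \<phi> x = 0"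
  using test_functionsD(6)[of \<phi> A] closure_subset[of "{x. \<phi> x \<noteq> 0}"] by auto

text \<open>Translation invariance gives every difference quotient integral zero, and dominated
  convergence carries this to the derivative. The mean value theorem bounds the quotients by
  \<open>C\<close>, and steps of length at most 1 keep their supports in the ball of radius
  \<open>B + 1\<close>.\<close>

lemma integral_partial_test_functions:
  assumes "\<phi> \<in> test_functions A"
  shows "(LINT x|lborel. partial i \<phi> x) = 0"
proof -
  let ?q = "\<lambda>h x. (\<phi> (x + h *\<^sub>R axis i 1) - \<phi> x) / h"
  let ?K = "closure {x. \<phi> x \<noteq> 0}"
  have d: "\<phi> \<in> test_functions UNIV" using test_functions_mono[OF assms] by simp
  obtain C where C: "\<And>x. \<bar>partial i \<phi> x\<bar> \<le> C"
    using test_functions_bounded[OF partial_test_functions[OF assms]] by blast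
  have [measurable]: "\<phi> \<in> borel_measurable borel" "partial i \<phi> \<in> borel_measurable borel"
    using test_functions_borel[OF assms] test_functions_borel[OF partial_test_functions[OF assms]] by auto
  have der: "((\<lambda>t. \<phi> (x + t *\<^sub>R axis i 1)) has_real_derivative partial i \<phi> (x + t *\<^sub>R axis i 1)) (at t)" for x t
  proof -
    let ?D = "frechet_derivative \<phi> (at (x + t *\<^sub>R axis i 1))"
    have D: "(\<phi> has_derivative ?D) (at (x + t *\<^sub>R axis i 1))"
      using test_functionsD(2)[OF assms] frechet_derivative_works by blast
    have "((\<lambda>t. x + t *\<^sub>R axis i 1) has_derivative (\<lambda>h. h *\<^sub>R axis i 1)) (at t)"
      by (auto intro!: derivative_eq_intros)
    from has_derivative_compose[OF this D]
    have "((\<lambda>t. \<phi> (x + t *\<^sub>R axis i 1)) has_derivative (\<lambda>h. ?D (h *\<^sub>R axis i 1))) (at t)" .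
    moreover have "(\<lambda>h. ?D (h *\<^sub>R axis i 1)) = (*) (partial i \<phi> (x + t *\<^sub>R axis i 1))"
      using D by (auto simp: has_derivative_def linear_scale[OF bounded_linear.linear] partial_def)
    ultimately show ?thesis by (simp add: has_field_derivative_def)
  qed
  have lip: "\<bar>?q h x\<bar> \<le> C" if h: "h > 0" for h x
  proof -
    obtain z where "\<phi> (x + h *\<^sub>R axis i 1) - \<phi> (x + 0 *\<^sub>R axis i 1) = (h - 0) * partial i \<phi> (x + z *\<^sub>R axis i 1)"
      using MVT2[OF h, of "\<lambda>t. \<phi> (x + t *\<^sub>R axis i 1)" "\<lambda>t. partial i \<phi> (x + t *\<^sub>R axis i 1)"] der by blast
    then have "?q h x = partial i \<phi> (x + z *\<^sub>R axis i 1)" using h by simp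
    then show ?thesis using C by simp
  qed
  obtain B where "\<And>x. x \<in> ?K \<Longrightarrow> norm x \<le> B"
    using compact_imp_bounded[OF test_functionsD(5)[OF assms]] by (auto simp: bounded_iff)
  then have B: "?K \<subseteq> cball 0 B" by auto
  have out: "?q h x = 0" if "0 < h" "h \<le> 1" "x \<notin> cball 0 (B + 1)" for h x
  proof -
    have "norm (x + h *\<^sub>R axis i 1) \<ge> norm x - h" using norm_triangle_ineq4[of "x + h *\<^sub>R axis i 1" "h *\<^sub>R axis i 1"] that
      by simp
    then have "x \<notin> ?K" "x + h *\<^sub>R axis i 1 \<notin> ?K" using B that by auto
    then have "\<phi> x = 0" "\<phi> (x + h *\<^sub>R axis i 1) = 0"
      using closure_subset[of "{x. \<phi> x \<noteq> 0}"] by blast+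
    then show ?thesis by simp
  qed
  have "(\<lambda>n. LINT x|lborel. ?q (1 / Suc n) x) \<longlonglongrightarrow> (LINT x|lborel. partial i \<phi> x)"
  proof (rule integral_dominated_convergence[where w="\<lambda>x. C * indicator (cball 0 (B + 1)) x"])
    have "integrable lborel (indicator (cball 0 (B + 1)) :: real^3 \<Rightarrow> real)"
      by (rule integrable_real_indicator) (use emeasure_bounded_finite[OF bounded_cball] in simp_all)
    then show "integrable lborel (\<lambda>x::real^3. C * indicator (cball 0 (B + 1)) x)"
      by (rule integrable_mult_right)
    show "AE x in lborel. norm (?q (1 / Suc n) x) \<le> C * indicator (cball 0 (B + 1)) x" for n
    proof (rule AE_I2)
      fix x
      show "norm (?q (1 / Suc n) x) \<le> C * indicator (cball 0 (B + 1)) x"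
        using lip[of "1 / Suc n" x] out[of "1 / Suc n" x]
        by (cases "x \<in> cball 0 (B + 1)") (simp_all del: mem_cball of_nat_Suc)
    qed
    show "AE x in lborel. (\<lambda>n. ?q (1 / Suc n) x) \<longlonglongrightarrow> partial i \<phi> x"
    proof (rule AE_I2)
      fix x
      have "((\<lambda>h. ?q h x) \<longlongrightarrow> partial i \<phi> x) (at 0)"
        using der[of x 0] by (simp add: has_field_derivative_iff)
      then show "(\<lambda>n. ?q (1 / Suc n) x) \<longlonglongrightarrow> partial i \<phi> x"
        unfolding tendsto_at_iff_sequentially comp_def
        using LIMSEQ_inverse_real_of_nat
        by (elim allE[of _ "\<lambda>n. 1 / real (Suc n)"]) (simp add: inverse_eq_divide)
    qed
  qed simp_all
  moreover have "(LINT x|lborel. ?q h x) = 0" for h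
    using lborel_translate(1)[of \<phi> "h *\<^sub>R axis i 1"] lborel_translate(2)[of \<phi> "h *\<^sub>R axis i 1"]
      test_functions_integrable[OF assms] by (simp add: Bochner_Integration.integral_diff)
  ultimately have "(\<lambda>n. 0) \<longlonglongrightarrow> (LINT x|lborel. partial i \<phi> x)" by (simp only:)
  then show ?thesis by (simp add: LIMSEQ_const_iff)
qed

section \<open>Weak partial derivatives on a bounded open set\<close>

locale bounded_open =
  fixes \<Omega> :: "(real^3) set"
  assumes open_\<Omega>: "open \<Omega>" and bounded_\<Omega>: "bounded \<Omega>"
begin

lemma \<Omega>_sets [simp]: "\<Omega> \<in> sets lebesgue" "\<Omega> \<in> sets borel"
  using open_\<Omega> by auto

sublocale fin: finite_measure "lebesgue_on \<Omega>"
proof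
  have "emeasure lebesgue \<Omega> < \<infinity>"
    using emeasure_bounded_finite[OF bounded_\<Omega>] by simp
  then show "emeasure (lebesgue_on \<Omega>) (space (lebesgue_on \<Omega>)) \<noteq> \<infinity>"
    by (simp add: emeasure_restrict_space)
qed

lemma borel_measurable_\<Omega>:
  "g \<in> borel_measurable borel \<Longrightarrow> g \<in> borel_measurable (lebesgue_on \<Omega>)"
  by (rule measurable_restrict_space1) (rule measurable_completion, simp)

lemma L1loc_iff:
  "f \<in> L1loc \<Omega> \<longleftrightarrow> (\<forall>K. compact K \<and> K \<subseteq> \<Omega> \<longrightarrow> integrable (lebesgue_on K) f)"
  unfolding L1loc_def using absolutely_integrable_on_iff_lebesgue_on compact_sets_lebesgue by blast

lemma integrable_imp_L1loc:
  assumes "integrable (lebesgue_on \<Omega>) f"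
  shows "f \<in> L1loc \<Omega>"
  unfolding L1loc_def
proof clarify
  fix K assume "compact K" "K \<subseteq> \<Omega>"
  moreover have "f absolutely_integrable_on \<Omega>"
    using assms by (simp add: absolutely_integrable_on_iff_lebesgue_on)
  ultimately show "f absolutely_integrable_on K"
    using set_integrable_subset compact_sets_lebesgue by blast
qed

lemma L1loc_cong_AE:
  assumes "f \<in> L1loc \<Omega>" "ae_eq \<Omega> f g"
  shows "g \<in> L1loc \<Omega>"
proof -
  obtain N where N: "negligible N" "{x. \<not> (x \<in> \<Omega> \<longrightarrow> f x = g x)} \<subseteq> N"
    using assms(2) unfolding ae_eq_def AE_lebesgue_on_iff[OF \<Omega>_sets(1)] eventually_ae_filter_negligible
    by auto
  show ?thesis
    unfolding L1loc_def
  proof (clarify)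
    fix K assume K: "compact K" "K \<subseteq> \<Omega>"
    then have "f absolutely_integrable_on K" using assms(1) by (simp add: L1loc_def)
    then show "g absolutely_integrable_on K"
      by (rule absolutely_integrable_spike[OF _ N(1)]) (use N(2) K(2) in auto)
  qed
qed

text \<open>Testing with the reflected mollifier at \<open>x\<close> shows that the mollifications
  of \<open>h\<close> vanish at \<open>x\<close> for all large indices, while a subsequence
  converges to \<open>h\<close> almost everywhere. Local integrability forces the work to be done on
  one compact box at a time, with mollifiers supported inside it; countably many boxes exhaust the
  domain.\<close>

lemma fundamental_lemma:
  assumes h: "h \<in> L1loc \<Omega>"
    and 0: "\<And>\<phi>. \<phi> \<in> test_functions \<Omega> \<Longrightarrow> (LINT x|lebesgue_on \<Omega>. h x * \<phi> x) = 0"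
  shows "AE x in lebesgue_on \<Omega>. h x = 0"
proof -
  have cb: "AE x in lebesgue. x \<in> cbox a b \<longrightarrow> h x = 0" if ab: "cbox a b \<subseteq> \<Omega>" for a b
  proof -
    have hi: "integrable (lebesgue_on (cbox a b)) h"
      using h ab L1loc_iff by auto
    have cs: "cbox a b \<in> sets lebesgue" by simp
    obtain F where F: "integrable lborel F" "AE x in lebesgue. F x = indicator (cbox a b) x * h x"
      using lebesgue_on_borel_representative[OF cs hi] by blast
    obtain r :: "nat \<Rightarrow> nat" where r: "strict_mono r"
      "AE x in lborel. (\<lambda>k. conv F (moll (r k)) x) \<longlonglongrightarrow> F x"
      using conv_moll_AE_subseq[OF F(1)] by blast
    have conv0: "conv F (moll n) x = 0"
      if n: "\<forall>y. (\<forall>i. \<bar>x $ i - y $ i\<bar> \<le> 1 / Suc n) \<longrightarrow> y \<in> box a b" for x n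
    proof -
      have t: "(\<lambda>y. moll n (x - y)) \<in> test_functions (box a b)"
        using moll_reflect_test_functions(1)[of x n "box a b"] n by blast
      have bo: "box a b \<subseteq> cbox a b" by (rule box_subset_cbox)
      have m0: "moll n (x - y) = 0" if "y \<notin> box a b" for y
      proof (rule ccontr)
        assume "moll n (x - y) \<noteq> 0"
        then have "\<bar>(x - y) $ i\<bar> \<le> 1 / Suc n" for i using moll_support[of n "x - y" i] by linarith
        then show False using n that by auto
      qed
      have "0 = (LINT y|lebesgue_on \<Omega>. h y * moll n (x - y))"
        using 0 test_functions_mono[OF t] ab bo by (metis subset_trans)
      also have "\<dots> = (LINT y|lborel. F y * moll n (x - y))"
        by (rule lebesgue_on_borel_representative_integral[OF cs ab \<Omega>_sets(1) hi F])
          (use m0 bo in auto)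
      finally show ?thesis by (simp add: conv_def)
    qed
    have "AE x in lborel. x \<in> box a b \<longrightarrow> F x = 0"
      using r(2)
    proof eventually_elim
      case (elim x)
      show ?case
      proof
        assume x: "x \<in> box a b"
        have "\<forall>\<^sub>F n in sequentially. conv F (moll n) x = 0"
          using moll_neighbourhood[OF compact_sing[of x] open_box[of a b]] x
          by (auto elim!: eventually_mono intro!: conv0)
        then have "\<forall>\<^sub>F k in sequentially. conv F (moll (r k)) x = 0"
          using r(1) by (rule eventually_subseq[rotated])
        then have "(\<lambda>k. conv F (moll (r k)) x) \<longlonglongrightarrow> 0" by (rule tendsto_eventually)
        then show "F x = 0" using elim LIMSEQ_unique by blast
      qed
    qed
    then have 1: "AE x in lebesgue. x \<in> box a b \<longrightarrow> F x = 0" by (rule AE_completion)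
    have "cbox a b - box a b \<in> null_sets lebesgue"
      using negligible_frontier_interval[of a b] by (simp add: negligible_iff_null_sets)
    then have "AE x in lebesgue. x \<notin> cbox a b - box a b" by (rule AE_not_in)
    with 1 F(2) show ?thesis by eventually_elim (auto simp: indicator_def)
  qed
  obtain \<D> where D: "countable \<D>" "\<D> \<subseteq> Pow \<Omega>" "\<And>X. X \<in> \<D> \<Longrightarrow> \<exists>a b. X = cbox a b" "\<Union>\<D> = \<Omega>"
    using open_countable_Union_open_cbox[OF open_\<Omega>] by metis
  have "AE x in lebesgue. \<forall>X\<in>\<D>. x \<in> X \<longrightarrow> h x = 0"
    unfolding AE_ball_countable[OF D(1)]
  proof
    fix X assume "X \<in> \<D>"
    then obtain a b where "X = cbox a b" "cbox a b \<subseteq> \<Omega>" using D by blast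
    then show "AE x in lebesgue. x \<in> X \<longrightarrow> h x = 0" using cb by simp
  qed
  then have "AE x in lebesgue. x \<in> \<Omega> \<longrightarrow> h x = 0"
    by eventually_elim (use D(4) in blast)
  then show ?thesis by (simp add: AE_lebesgue_on_iff)
qed

lemma L1loc_integrable_test:
  assumes f: "f \<in> L1loc \<Omega>" and phi: "\<phi> \<in> test_functions \<Omega>"
  shows "integrable (lebesgue_on \<Omega>) (\<lambda>x. f x * \<phi> x)"
proof -
  let ?K = "closure {x. \<phi> x \<noteq> 0}"
  note K = test_functionsD(5,6)[OF phi]
  obtain C where C: "\<And>x. \<bar>\<phi> x\<bar> \<le> C" using test_functions_bounded[OF phi] by blast
  have "integrable (lebesgue_on ?K) f" using f K L1loc_iff by blast
  moreover have [measurable]: "\<phi> \<in> borel_measurable lebesgue"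
    using test_functions_borel[OF phi] by (simp add: measurable_completion)
  ultimately have "integrable (lebesgue_on ?K) (\<lambda>x. f x * \<phi> x)"
    using C by (intro integrable_mult_bounded[of _ _ _ C] measurable_restrict_space1) auto
  then have "integrable lebesgue (\<lambda>x. indicator ?K x * (f x * \<phi> x))"
    using compact_sets_lebesgue[OF K(1)] by (simp add: integrable_restrict_space)
  moreover have "indicator ?K x * (f x * \<phi> x) = indicator \<Omega> x * (f x * \<phi> x)" for x
    using K(2) closure_subset[of "{x. \<phi> x \<noteq> 0}"] by (auto simp: indicator_def)
  ultimately show ?thesis by (simp add: integrable_restrict_space)
qed

lemma has_weak_partialD:
  assumes "has_weak_partial \<Omega> i f g"
  shows "f \<in> L1loc \<Omega>" "g \<in> L1loc \<Omega>"
    "\<phi> \<in> test_functions \<Omega> \<Longrightarrow>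
      (LINT x|lebesgue_on \<Omega>. f x * partial i \<phi> x) = - (LINT x|lebesgue_on \<Omega>. g x * \<phi> x)"
  using assms by (auto simp: has_weak_partial_def)

lemma L1loc_add: "f \<in> L1loc \<Omega> \<Longrightarrow> g \<in> L1loc \<Omega> \<Longrightarrow> (\<lambda>x. f x + g x) \<in> L1loc \<Omega>"
  by (auto simp: L1loc_iff)

lemma L1loc_cmult: "f \<in> L1loc \<Omega> \<Longrightarrow> (\<lambda>x. c * f x) \<in> L1loc \<Omega>"
  by (auto simp: L1loc_iff)

lemma has_weak_partial_add:
  assumes "has_weak_partial \<Omega> i f f'" "has_weak_partial \<Omega> i g g'"
  shows "has_weak_partial \<Omega> i (\<lambda>x. f x + g x) (\<lambda>x. f' x + g' x)"
  unfolding has_weak_partial_def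
proof (intro conjI ballI L1loc_add)
  fix \<phi> assume phi: "\<phi> \<in> test_functions \<Omega>"
  note dphi = partial_test_functions[OF phi, of i]
  note D = has_weak_partialD[OF assms(1)] has_weak_partialD[OF assms(2)]
  show "(LINT x|lebesgue_on \<Omega>. (f x + g x) * partial i \<phi> x)
      = - (LINT x|lebesgue_on \<Omega>. (f' x + g' x) * \<phi> x)"
    using D(3)[OF phi] D(6)[OF phi] L1loc_integrable_test[OF D(1) dphi] L1loc_integrable_test[OF D(4) dphi]
      L1loc_integrable_test[OF D(2) phi] L1loc_integrable_test[OF D(5) phi]
    by (simp add: distrib_right)
qed (use assms has_weak_partialD in blast)+

lemma has_weak_partial_cong_AE:
  assumes "has_weak_partial \<Omega> i f f'" "ae_eq \<Omega> f g" "ae_eq \<Omega> f' g'"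
  shows "has_weak_partial \<Omega> i g g'"
  unfolding has_weak_partial_def
proof (intro conjI ballI)
  note D = has_weak_partialD[OF assms(1)]
  show g: "g \<in> L1loc \<Omega>" and g': "g' \<in> L1loc \<Omega>" using D assms L1loc_cong_AE by blast+
  fix \<phi> assume phi: "\<phi> \<in> test_functions \<Omega>"
  note dphi = partial_test_functions[OF phi, of i]
  have "(LINT x|lebesgue_on \<Omega>. g x * partial i \<phi> x) = (LINT x|lebesgue_on \<Omega>. f x * partial i \<phi> x)"
    using L1loc_integrable_test[OF D(1) dphi] L1loc_integrable_test[OF g dphi] assms(2)
    by (intro integral_cong_AE) (auto simp: ae_eq_def elim: eventually_mono)
  moreover have "(LINT x|lebesgue_on \<Omega>. g' x * \<phi> x) = (LINT x|lebesgue_on \<Omega>. f' x * \<phi> x)"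
    using L1loc_integrable_test[OF D(2) phi] L1loc_integrable_test[OF g' phi] assms(3)
    by (intro integral_cong_AE) (auto simp: ae_eq_def elim: eventually_mono)
  ultimately show "(LINT x|lebesgue_on \<Omega>. g x * partial i \<phi> x) = - (LINT x|lebesgue_on \<Omega>. g' x * \<phi> x)"
    using D(3)[OF phi] by simp
qed

lemma has_weak_partial_unique:
  assumes "has_weak_partial \<Omega> i f g" "has_weak_partial \<Omega> i f g'"
  shows "ae_eq \<Omega> g g'"
proof -
  have "(\<lambda>x. g x + (- 1) * g' x) \<in> L1loc \<Omega>"
    by (intro L1loc_add L1loc_cmult has_weak_partialD(2)[OF assms(1)] has_weak_partialD(2)[OF assms(2)])
  then have "AE x in lebesgue_on \<Omega>. g x + (- 1) * g' x = 0"
  proof (rule fundamental_lemma)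
    fix \<phi> assume phi: "\<phi> \<in> test_functions \<Omega>"
    note D = has_weak_partialD[OF assms(1)] has_weak_partialD[OF assms(2)]
    show "(LINT x|lebesgue_on \<Omega>. (g x + (- 1) * g' x) * \<phi> x) = 0"
      using D(3)[OF phi] D(6)[OF phi]
        L1loc_integrable_test[OF D(2) phi] L1loc_integrable_test[OF D(5) phi]
      by (simp add: left_diff_distrib)
  qed
  then show ?thesis unfolding ae_eq_def by eventually_elim simp
qed

lemma integral_lebesgue_on_\<Omega>:
  fixes g :: "real^3 \<Rightarrow> real"
  assumes "g \<in> borel_measurable borel" "\<And>x. x \<notin> \<Omega> \<Longrightarrow> g x = 0"
  shows "(LINT x|lebesgue_on \<Omega>. g x) = (LINT x|lborel. g x)"
proof -
  have eq: "(\<lambda>x. indicator \<Omega> x *\<^sub>R g x) = g"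
    by (rule ext) (auto simp: indicator_def assms(2))
  have "(LINT x|lebesgue_on \<Omega>. g x) = (LINT x|lebesgue. g x)"
    using integral_restrict_space[of \<Omega> lebesgue g] unfolding eq by simp
  then show ?thesis using assms(1) by (simp add: integral_completion)
qed

lemma integral_partial_test:
  assumes "\<phi> \<in> test_functions \<Omega>"
  shows "(LINT x|lebesgue_on \<Omega>. partial i \<phi> x) = 0"
  using integral_lebesgue_on_\<Omega>[OF test_functions_borel test_functions_eq_0, OF partial_test_functions partial_test_functions]
    integral_partial_test_functions assms by auto

lemma has_weak_partial_const: "has_weak_partial \<Omega> i (\<lambda>x. c) (\<lambda>x. 0)"
proof -
  have "(\<lambda>x. c) \<in> L1loc \<Omega>" for c :: real by (rule integrable_imp_L1loc) simp
  then show ?thesis using integral_partial_test by (simp add: has_weak_partial_def)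
qed

text \<open>Extension by zero may create a jump across the boundary. Hence differentiating the
  mollification agrees with mollifying the weak derivative only at points whose surrounding cube
  stays in \<Omega>.\<close>

lemma conv_partial_moll:
  assumes w: "has_weak_partial \<Omega> i f f'"
    and fi: "integrable (lebesgue_on \<Omega>) f" "integrable (lebesgue_on \<Omega>) f'"
    and F: "integrable lborel F" "AE x in lebesgue. F x = indicator \<Omega> x * f x"
    and F': "integrable lborel F'" "AE x in lebesgue. F' x = indicator \<Omega> x * f' x"
    and x: "\<And>y. (\<And>i. \<bar>x $ i - y $ i\<bar> \<le> 1 / Suc n) \<Longrightarrow> y \<in> \<Omega>"
  shows "conv F (partial i (moll n)) x = conv F' (moll n) x"
proof -
  let ?t = "\<lambda>y. moll n (x - y)"
  have t: "?t \<in> test_functions \<Omega>" by (rule moll_reflect_test_functions(1)[OF x])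
  have dt: "partial i ?t = (\<lambda>y. - partial i (moll n) (x - y))"
    by (rule ext, rule moll_reflect_test_functions(2)[OF x])
  have "- conv F (partial i (moll n)) x = (LINT y|lborel. F y * partial i ?t y)"
    by (simp add: dt conv_def)
  also have "\<dots> = (LINT y|lebesgue_on \<Omega>. f y * partial i ?t y)"
    using test_functions_borel[OF partial_test_functions[OF t]]
    by (intro lebesgue_on_borel_representative_integral[symmetric, OF _ _ _ fi(1) F]) auto
  also have "\<dots> = - (LINT y|lebesgue_on \<Omega>. f' y * ?t y)"
    using has_weak_partialD(3)[OF w t] .
  also have "(LINT y|lebesgue_on \<Omega>. f' y * ?t y) = (LINT y|lborel. F' y * ?t y)"
    using test_functions_borel[OF t]
    by (intro lebesgue_on_borel_representative_integral[OF _ _ _ fi(2) F']) auto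
  finally show ?thesis by (simp add: conv_def)
qed

text \<open>Only \<open>f\<close> is mollified: its mollification times \<open>\<phi>\<close> is
  then a test function for the weak derivative of \<open>g\<close>. In the limit, the terms with the
  mollified \<open>f\<close> converge almost everywhere under the bound for \<open>f\<close>. The
  term with the mollified derivative converges in L1 against a factor kept bounded by the bound for
  \<open>g\<close>.\<close>

lemma has_weak_partial_mult:
  assumes wf: "has_weak_partial \<Omega> i f f'" and wg: "has_weak_partial \<Omega> i g g'"
    and fi: "integrable (lebesgue_on \<Omega>) f" "integrable (lebesgue_on \<Omega>) f'"
    and gi: "integrable (lebesgue_on \<Omega>) g" "integrable (lebesgue_on \<Omega>) g'"
    and fb: "AE x in lebesgue_on \<Omega>. \<bar>f x\<bar> \<le> Mf" and gb: "AE x in lebesgue_on \<Omega>. \<bar>g x\<bar> \<le> Mg"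
  shows "has_weak_partial \<Omega> i (\<lambda>x. f x * g x) (\<lambda>x. f x * g' x + f' x * g x)"
proof -
  have int: "integrable (lebesgue_on \<Omega>) (\<lambda>x. f x * g x)" "integrable (lebesgue_on \<Omega>) (\<lambda>x. f x * g' x)"
    "integrable (lebesgue_on \<Omega>) (\<lambda>x. f' x * g x)"
    using integrable_mult_bounded[OF fi(1) _ gb] integrable_mult_bounded[OF fi(2) _ gb]
      integrable_mult_bounded[OF gi(2) _ fb] fi(1) gi(1) by (auto simp: mult.commute)
  note rep = lebesgue_on_borel_representative[OF \<Omega>_sets(1)]
  obtain F where F: "integrable lborel F" "AE x in lebesgue. F x = indicator \<Omega> x * f x" using rep[OF fi(1)] by blast
  obtain F' where F': "integrable lborel F'" "AE x in lebesgue. F' x = indicator \<Omega> x * f' x" using rep[OF fi(2)] by blast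
  obtain G where G: "integrable lborel G" "AE x in lebesgue. G x = indicator \<Omega> x * g x" using rep[OF gi(1)] by blast
  obtain G' where G': "integrable lborel G'" "AE x in lebesgue. G' x = indicator \<Omega> x * g' x" using rep[OF gi(2)] by blast
  \<comment> \<open>The representatives vanish outside \<Omega>, so their global bounds must be
    nonnegative.\<close>
  define M where "M = max Mf 0"
  define L where "L = max Mg 0"
  have "AE x in lebesgue. \<bar>F x\<bar> \<le> M"
    using F(2) fb[unfolded AE_lebesgue_on_iff[OF \<Omega>_sets(1)]]
    by eventually_elim (auto simp: indicator_def M_def)
  then have Fb: "AE x in lborel. \<bar>F x\<bar> \<le> M" by (simp add: AE_completion_iff)
  have "AE x in lebesgue. \<bar>G x\<bar> \<le> L"
    using G(2) gb[unfolded AE_lebesgue_on_iff[OF \<Omega>_sets(1)]]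
    by eventually_elim (auto simp: indicator_def L_def)
  then have Gb: "AE x in lborel. \<bar>G x\<bar> \<le> L" by (simp add: AE_completion_iff)
  have [measurable]: "F \<in> borel_measurable borel" "F' \<in> borel_measurable borel"
    "G \<in> borel_measurable borel" "G' \<in> borel_measurable borel"
    using F G F' G' by auto
  have FG: "integrable lborel (\<lambda>x. F x * G x)" "integrable lborel (\<lambda>x. F x * G' x)" "integrable lborel (\<lambda>x. F' x * G x)"
    using integrable_mult_bounded[OF F(1) _ Gb] integrable_mult_bounded[OF F'(1) _ Gb]
      integrable_mult_bounded[OF G'(1) _ Fb] by (auto simp: mult.commute)
  \<comment> \<open>L1 convergence yields almost everywhere convergence only along a subsequence.
    The term with the derivative \<open>F'\<close> converges along the full sequence and is
    restricted to it afterwards.\<close>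
  obtain r :: "nat \<Rightarrow> nat" where r: "strict_mono r"
    "AE x in lborel. (\<lambda>k. conv F (moll (r k)) x) \<longlonglongrightarrow> F x"
    using conv_moll_AE_subseq[OF F(1)] by blast
  show ?thesis
    unfolding has_weak_partial_def
  proof (intro conjI ballI integrable_imp_L1loc)
    fix \<phi> assume phi: "\<phi> \<in> test_functions \<Omega>"
    let ?K = "closure {x. \<phi> x \<noteq> 0}"
    let ?d = "partial i \<phi>"
    note K = test_functionsD(5,6)[OF phi]
    have dphi: "?d \<in> test_functions \<Omega>" by (rule partial_test_functions[OF phi])
    obtain C where C: "\<And>x. \<bar>\<phi> x\<bar> \<le> C" using test_functions_bounded[OF phi] by blast
    obtain D where D: "\<And>x. \<bar>?d x\<bar> \<le> D" using test_functions_bounded[OF dphi] by blast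
    have [measurable]: "\<phi> \<in> borel_measurable borel" "?d \<in> borel_measurable borel"
      using test_functions_borel phi dphi by auto
    have [measurable]: "conv F (moll n) \<in> borel_measurable borel" "conv F' (moll n) \<in> borel_measurable borel" for n
      using conv_measurable[OF F(1)] conv_measurable[OF F'(1)] by auto
    have cF: "\<bar>conv F (moll n) x\<bar> \<le> M" for n x by (rule abs_conv_moll_le[OF F(1) Fb])
    have M0: "0 \<le> M" "0 \<le> C" "0 \<le> D" "0 \<le> L"
      using C[of 0] D[of 0] by (auto simp: M_def L_def)
    \<comment> \<open>For large \<open>n\<close> the cubes around the support of
      \<open>\<phi>\<close> lie in \<Omega>, so that \<open>conv_partial_moll\<close> applies on the
      support; elsewhere the factor \<open>\<phi> x\<close> removes the derivative of the
      mollification.\<close>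
    have e: "\<forall>\<^sub>F n in sequentially.
      (LINT x|lborel. G x * (conv F (moll n) x * ?d x)) + (LINT x|lborel. G x * (conv F' (moll n) x * \<phi> x))
        = - (LINT x|lborel. G' x * (conv F (moll n) x * \<phi> x))"
      using moll_neighbourhood[OF K(1) open_\<Omega> K(2)]
    proof eventually_elim
      case (elim n)
      let ?f = "conv F (moll n)"
      let ?z = "\<lambda>x. ?f x * \<phi> x"
      have z: "?z \<in> test_functions \<Omega>"
        by (rule test_functions_mult[OF phi Ck_conv(2)[OF F(1) moll_test_functions]])
      have "?f differentiable (at x)" for x
        using conv_has_derivative[OF F(1) moll_test_functions] differentiable_def by blast
      then have dz: "partial i ?z x = ?f x * ?d x + conv F' (moll n) x * \<phi> x" for x
      proof -
        have "partial i ?z x = ?f x * ?d x + partial i ?f x * \<phi> x"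
          by (rule partial_mult) (use \<open>\<And>x. ?f differentiable (at x)\<close> test_functionsD(2)[OF phi] in auto)
        also have "partial i ?f x * \<phi> x = conv F' (moll n) x * \<phi> x"
        proof (cases "x \<in> ?K")
          case True
          have "partial i ?f x = conv F' (moll n) x"
            unfolding Ck_conv(1)[OF F(1) moll_test_functions]
            by (rule conv_partial_moll[OF wf fi F F']) (use elim True in blast)
          then show ?thesis by simp
        next
          case False
          then show ?thesis using closure_subset[of "{x. \<phi> x \<noteq> 0}"] by auto
        qed
        finally show ?thesis .
      qed
      have "(LINT x|lborel. G x * partial i ?z x) = (LINT x|lebesgue_on \<Omega>. g x * partial i ?z x)"
        using test_functions_borel[OF partial_test_functions[OF z]]
          test_functions_eq_0[OF partial_test_functions[OF z]]
        by (intro lebesgue_on_borel_representative_integral[OF _ _ _ gi(1) G, symmetric]) auto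
      also have "\<dots> = - (LINT x|lebesgue_on \<Omega>. g' x * ?z x)"
        by (rule has_weak_partialD(3)[OF wg z])
      also have "(LINT x|lebesgue_on \<Omega>. g' x * ?z x) = (LINT x|lborel. G' x * ?z x)"
        using test_functions_borel[OF z] test_functions_eq_0[OF z]
        by (intro lebesgue_on_borel_representative_integral[OF _ _ _ gi(2) G']) auto
      finally have "(LINT x|lborel. G x * (?f x * ?d x + conv F' (moll n) x * \<phi> x)) = - (LINT x|lborel. G' x * ?z x)"
        by (simp add: dz)
      moreover have "integrable lborel (\<lambda>x. G x * (?f x * ?d x))"
        by (rule integrable_mult_bounded[OF G(1), where C="M * D"])
          (use cF D M0 in \<open>auto simp: abs_mult intro!: mult_mono\<close>)
      moreover have "integrable lborel (\<lambda>x. G x * (conv F' (moll n) x * \<phi> x))"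
      proof -
        have "integrable lborel (\<lambda>x. conv F' (moll n) x * (G x * \<phi> x))"
          using Gb by (intro integrable_mult_bounded[OF conv_moll_L1(1)[OF F'(1)], where C="L * C"])
            (auto simp: abs_mult elim!: eventually_mono intro!: mult_mono C M0)
        then show ?thesis by (simp add: mult_ac)
      qed
      ultimately show ?case by (simp add: distrib_left)
    qed
    have l1: "(\<lambda>k. LINT x|lborel. H x * (conv F (moll (r k)) x * \<psi> x)) \<longlonglongrightarrow> (LINT x|lborel. H x * (F x * \<psi> x))"
      if [measurable]: "\<psi> \<in> borel_measurable borel" and E: "\<And>x. \<bar>\<psi> x\<bar> \<le> E" and H: "integrable lborel H" for H \<psi> E
    proof (rule integral_dominated_convergence[where w="\<lambda>x. \<bar>H x\<bar> * (M * E)"])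
      have [measurable]: "H \<in> borel_measurable borel" using H by auto
      show "(\<lambda>x. H x * (F x * \<psi> x)) \<in> borel_measurable lborel" by simp
      show "(\<lambda>x. H x * (conv F (moll (r k)) x * \<psi> x)) \<in> borel_measurable lborel" for k by simp
      show "integrable lborel (\<lambda>x. \<bar>H x\<bar> * (M * E))"
        using H by (intro integrable_mult_left integrable_abs)
      show "AE x in lborel. (\<lambda>k. H x * (conv F (moll (r k)) x * \<psi> x)) \<longlonglongrightarrow> H x * (F x * \<psi> x)"
        using r(2) by eventually_elim (intro tendsto_intros)
      show "AE x in lborel. norm (H x * (conv F (moll (r k)) x * \<psi> x)) \<le> \<bar>H x\<bar> * (M * E)" for k
        using cF E M0(1) by (auto simp: abs_mult intro!: AE_I2 mult_left_mono mult_mono)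
    qed
    have l2: "(\<lambda>k. LINT x|lborel. G x * (conv F' (moll k) x * \<phi> x)) \<longlonglongrightarrow> (LINT x|lborel. G x * (F' x * \<phi> x))"
    proof (rule LIM_zero_cancel, rule Lim_null_comparison)
      show "(\<lambda>k. L * C * (LINT x|lborel. \<bar>conv F' (moll k) x - F' x\<bar>)) \<longlonglongrightarrow> 0"
        using moll_conv_integrable[OF F'(1)] by (auto simp: moll_conv_def intro: tendsto_mult_right_zero)
      show "\<forall>\<^sub>F k in sequentially. norm ((LINT x|lborel. G x * (conv F' (moll k) x * \<phi> x)) - (LINT x|lborel. G x * (F' x * \<phi> x)))
          \<le> L * C * (LINT x|lborel. \<bar>conv F' (moll k) x - F' x\<bar>)"
      proof (rule always_eventually, rule allI)
        fix k
        have i: "integrable lborel (\<lambda>x. G x * (H x * \<phi> x))" if "integrable lborel H" for H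
        proof -
          have "integrable lborel (\<lambda>x. H x * (G x * \<phi> x))"
            using Gb by (intro integrable_mult_bounded[OF that, where C="L * C"])
              (auto simp: abs_mult elim!: eventually_mono intro!: mult_mono C M0)
          then show ?thesis by (simp add: mult_ac)
        qed
        have di: "integrable lborel (\<lambda>x. conv F' (moll k) x - F' x)"
          using conv_moll_L1(1)[OF F'(1)] F'(1) by auto
        have "(LINT x|lborel. G x * (conv F' (moll k) x * \<phi> x)) - (LINT x|lborel. G x * (F' x * \<phi> x))
          = (LINT x|lborel. G x * ((conv F' (moll k) x - F' x) * \<phi> x))"
          using i[OF conv_moll_L1(1)[OF F'(1)]] i[OF F'(1)] by (simp add: algebra_simps)
        also have "norm \<dots> \<le> (LINT x|lborel. norm (G x * ((conv F' (moll k) x - F' x) * \<phi> x)))"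
          by (rule integral_norm_bound)
        also have "\<dots> \<le> (LINT x|lborel. L * C * \<bar>conv F' (moll k) x - F' x\<bar>)"
        proof (rule integral_mono_AE)
          show "AE x in lborel. norm (G x * ((conv F' (moll k) x - F' x) * \<phi> x)) \<le> L * C * \<bar>conv F' (moll k) x - F' x\<bar>"
            using Gb
          proof eventually_elim
            case (elim x)
            have "(\<bar>G x\<bar> * \<bar>\<phi> x\<bar>) * \<bar>conv F' (moll k) x - F' x\<bar> \<le> (L * C) * \<bar>conv F' (moll k) x - F' x\<bar>"
              using elim C[of x] M0 by (intro mult_right_mono mult_mono) auto
            then show ?case by (simp add: abs_mult mult_ac)
          qed
        qed (use i[OF di] di in auto)
        finally show "norm ((LINT x|lborel. G x * (conv F' (moll k) x * \<phi> x)) - (LINT x|lborel. G x * (F' x * \<phi> x)))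
          \<le> L * C * (LINT x|lborel. \<bar>conv F' (moll k) x - F' x\<bar>)" by simp
      qed
    qed
    have s1: "(\<lambda>k. (LINT x|lborel. G x * (conv F (moll (r k)) x * ?d x)) + (LINT x|lborel. G x * (conv F' (moll (r k)) x * \<phi> x)))
        \<longlonglongrightarrow> (LINT x|lborel. G x * (F x * ?d x)) + (LINT x|lborel. G x * (F' x * \<phi> x))"
      using l1[OF _ D G(1)] LIMSEQ_subseq_LIMSEQ[OF l2 r(1)] by (intro tendsto_add) (auto simp: comp_def)
    have s2: "(\<lambda>k. - (LINT x|lborel. G' x * (conv F (moll (r k)) x * \<phi> x))) \<longlonglongrightarrow> - (LINT x|lborel. G' x * (F x * \<phi> x))"
      using l1[OF _ C G'(1)] by (intro tendsto_minus) auto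
    have s3: "\<forall>\<^sub>F k in sequentially.
      (LINT x|lborel. G x * (conv F (moll (r k)) x * ?d x)) + (LINT x|lborel. G x * (conv F' (moll (r k)) x * \<phi> x))
        = - (LINT x|lborel. G' x * (conv F (moll (r k)) x * \<phi> x))"
      using eventually_subseq[OF r(1) e] .
    have lim: "(LINT x|lborel. G x * (F x * ?d x)) + (LINT x|lborel. G x * (F' x * \<phi> x)) = - (LINT x|lborel. G' x * (F x * \<phi> x))"
      by (rule LIMSEQ_unique[OF Lim_transform_eventually[OF s1 s3] s2])
    have rp: "(LINT x|lebesgue_on \<Omega>. h x * \<psi> x) = (LINT x|lborel. H x * \<psi> x)"
      if "integrable (lebesgue_on \<Omega>) h" "integrable lborel H" "AE x in lebesgue. H x = indicator \<Omega> x * h x"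
        "\<psi> \<in> test_functions \<Omega>" for h H \<psi>
      using test_functions_borel[OF that(4)] test_functions_eq_0[OF that(4)]
      by (intro lebesgue_on_borel_representative_integral[OF _ _ _ that(1-3)]) auto
    have a: "AE x in lebesgue. F x * G x = indicator \<Omega> x * (f x * g x)"
      "AE x in lebesgue. F x * G' x = indicator \<Omega> x * (f x * g' x)"
      "AE x in lebesgue. F' x * G x = indicator \<Omega> x * (f' x * g x)"
      using F(2) G(2) F'(2) G'(2) by (eventually_elim; simp add: indicator_def)+
    have "(LINT x|lebesgue_on \<Omega>. f x * g x * ?d x) = (LINT x|lborel. F x * G x * ?d x)"
      by (rule rp[OF int(1) FG(1) a(1) dphi])
    moreover have "(LINT x|lebesgue_on \<Omega>. (f x * g' x + f' x * g x) * \<phi> x)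
        = (LINT x|lborel. F x * G' x * \<phi> x) + (LINT x|lborel. F' x * G x * \<phi> x)"
      using rp[OF int(2) FG(2) a(2) phi] rp[OF int(3) FG(3) a(3) phi]
        L1loc_integrable_test[OF integrable_imp_L1loc[OF int(2)] phi]
        L1loc_integrable_test[OF integrable_imp_L1loc[OF int(3)] phi]
      by (simp add: distrib_right)
    ultimately show "(LINT x|lebesgue_on \<Omega>. f x * g x * ?d x) = - (LINT x|lebesgue_on \<Omega>. (f x * g' x + f' x * g x) * \<phi> x)"
      using lim by (simp add: mult.assoc mult.left_commute[of _ "G _"] mult.left_commute[of _ "G' _"])
  qed (rule int(1), rule Bochner_Integration.integrable_add[OF int(2,3)])
qed

end

section \<open>Square integrable functions and limits of products\<close>

lemma integral_Cauchy_Schwarz: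
  fixes f g :: "'a \<Rightarrow> real"
  assumes [measurable]: "f \<in> borel_measurable M" "g \<in> borel_measurable M"
    and f: "integrable M (\<lambda>x. (f x)\<^sup>2)" and g: "integrable M (\<lambda>x. (g x)\<^sup>2)"
  shows "integrable M (\<lambda>x. f x * g x)"
    and "\<bar>LINT x|M. f x * g x\<bar> \<le> sqrt (LINT x|M. (f x)\<^sup>2) * sqrt (LINT x|M. (g x)\<^sup>2)"
proof -
  have young: "2 * \<bar>a * b\<bar> \<le> a\<^sup>2 + b\<^sup>2" for a b :: real
    using sum_squares_bound[of "\<bar>a\<bar>" "\<bar>b\<bar>"] by (simp add: abs_mult)
  show fg: "integrable M (\<lambda>x. f x * g x)"
  proof (rule Bochner_Integration.integrable_bound[of M "\<lambda>x. (f x)\<^sup>2 + (g x)\<^sup>2"])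
    show "AE x in M. norm (f x * g x) \<le> norm ((f x)\<^sup>2 + (g x)\<^sup>2)"
    proof (rule AE_I2)
      fix x
      show "norm (f x * g x) \<le> norm ((f x)\<^sup>2 + (g x)\<^sup>2)"
        using young[of "f x" "g x"] by simp
    qed
  qed (use f g in auto)
  let ?A = "LINT x|M. (f x)\<^sup>2" and ?B = "LINT x|M. (g x)\<^sup>2" and ?I = "LINT x|M. f x * g x"
  have nn: "0 \<le> t\<^sup>2 * ?A + 2 * t * ?I + ?B" for t
  proof -
    have "0 \<le> (LINT x|M. (t * f x + g x)\<^sup>2)" by simp
    also have "\<dots> = (LINT x|M. t\<^sup>2 * (f x)\<^sup>2 + 2 * t * (f x * g x) + (g x)\<^sup>2)"
      by (intro Bochner_Integration.integral_cong) (auto simp: power2_eq_square algebra_simps)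
    also have "\<dots> = t\<^sup>2 * ?A + 2 * t * ?I + ?B" using f g fg by simp
    finally show ?thesis .
  qed
  have A: "0 \<le> ?A" and B: "0 \<le> ?B" by simp_all
  have "?I\<^sup>2 \<le> ?A * ?B"
  proof (cases "?A = 0")
    case False
    with A have A0: "0 < ?A" by linarith
    \<comment> \<open>The quadratic polynomial is evaluated at its minimiser and multiplied by its
      leading coefficient.\<close>
    have "0 \<le> ?A * ((- ?I / ?A)\<^sup>2 * ?A + 2 * (- ?I / ?A) * ?I + ?B)"
      using nn A by (intro mult_nonneg_nonneg)
    also have "\<dots> = ?A * ?B - ?I\<^sup>2" using A0 by (simp add: field_simps power2_eq_square)
    finally show ?thesis by simp
  next
    case True
    have "?I = 0"
    proof (rule ccontr)
      assume "?I \<noteq> 0"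
      \<comment> \<open>With \<open>?A = 0\<close> the polynomial is affine; at this point its value
        would be -1.\<close>
      then show False using nn[of "- (?B + 1) / (2 * ?I)"] True by (simp add: field_simps)
    qed
    then show ?thesis using A B by simp
  qed
  then have "sqrt (?I\<^sup>2) \<le> sqrt (?A * ?B)" by (rule real_sqrt_le_mono)
  then show "\<bar>?I\<bar> \<le> sqrt ?A * sqrt ?B" by (simp add: real_sqrt_mult)
qed

lemma integrable_square_diff:
  fixes f g :: "'a \<Rightarrow> real"
  assumes "f \<in> borel_measurable M" "g \<in> borel_measurable M"
    and f: "integrable M (\<lambda>x. (f x)\<^sup>2)" and g: "integrable M (\<lambda>x. (g x)\<^sup>2)"
  shows "integrable M (\<lambda>x. (f x - g x)\<^sup>2)"
  using integral_Cauchy_Schwarz(1)[OF assms] f g by (simp add: power2_diff mult.assoc)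

lemma tendsto_integral_L2:
  fixes a :: "nat \<Rightarrow> 'a \<Rightarrow> real"
  assumes [measurable]: "\<And>k. a k \<in> borel_measurable M" "f \<in> borel_measurable M" "c \<in> borel_measurable M"
    and a: "\<And>k. integrable M (\<lambda>x. (a k x)\<^sup>2)" and f: "integrable M (\<lambda>x. (f x)\<^sup>2)"
    and c: "integrable M (\<lambda>x. (c x)\<^sup>2)"
    and l: "(\<lambda>k. sqrt (LINT x|M. (a k x - f x)\<^sup>2)) \<longlonglongrightarrow> 0"
  shows "(\<lambda>k. LINT x|M. a k x * c x) \<longlonglongrightarrow> (LINT x|M. f x * c x)"
proof (rule LIM_zero_cancel, rule Lim_null_comparison)
  let ?d = "\<lambda>k x. a k x - f x"
  show "(\<lambda>k. sqrt (LINT x|M. (?d k x)\<^sup>2) * sqrt (LINT x|M. (c x)\<^sup>2)) \<longlonglongrightarrow> 0"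
    using l by (rule tendsto_mult_left_zero)
  show "\<forall>\<^sub>F k in sequentially. norm ((LINT x|M. a k x * c x) - (LINT x|M. f x * c x))
      \<le> sqrt (LINT x|M. (?d k x)\<^sup>2) * sqrt (LINT x|M. (c x)\<^sup>2)"
  proof (rule always_eventually, rule allI)
    fix k
    have "integrable M (\<lambda>x. (?d k x)\<^sup>2)"
      using a[of k] f by (intro integrable_square_diff) auto
    from integral_Cauchy_Schwarz(2)[OF _ _ this c]
    show "norm ((LINT x|M. a k x * c x) - (LINT x|M. f x * c x))
      \<le> sqrt (LINT x|M. (?d k x)\<^sup>2) * sqrt (LINT x|M. (c x)\<^sup>2)"
      using integral_Cauchy_Schwarz(1)[OF _ _ a[of k] c] integral_Cauchy_Schwarz(1)[OF _ _ f c]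
      by (simp add: left_diff_distrib)
  qed
qed

text \<open>The product \<open>a b\<close> equals \<open>(a - f) (b - g) + a g + b f - f g\<close>.
  The first term vanishes in the limit by Cauchy-Schwarz, and the next two are linear in a
  converging factor, with fixed square integrable weights.\<close>

lemma tendsto_integral_L2_mult:
  fixes a b :: "nat \<Rightarrow> 'a \<Rightarrow> real"
  assumes [measurable]: "\<And>k. a k \<in> borel_measurable M" "f \<in> borel_measurable M"
    "\<And>k. b k \<in> borel_measurable M" "g \<in> borel_measurable M" "c \<in> borel_measurable M"
    and a: "\<And>k. integrable M (\<lambda>x. (a k x)\<^sup>2)" and f: "integrable M (\<lambda>x. (f x)\<^sup>2)"
    and b: "\<And>k. integrable M (\<lambda>x. (b k x)\<^sup>2)" and g: "integrable M (\<lambda>x. (g x)\<^sup>2)"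
    and c: "\<And>x. \<bar>c x\<bar> \<le> C"
    and la: "(\<lambda>k. sqrt (LINT x|M. (a k x - f x)\<^sup>2)) \<longlonglongrightarrow> 0"
    and lb: "(\<lambda>k. sqrt (LINT x|M. (b k x - g x)\<^sup>2)) \<longlonglongrightarrow> 0"
  shows "(\<lambda>k. LINT x|M. a k x * b k x * c x) \<longlonglongrightarrow> (LINT x|M. f x * g x * c x)"
proof -
  have sq: "integrable M (\<lambda>x. (h x * c x)\<^sup>2)" if "h \<in> borel_measurable M" "integrable M (\<lambda>x. (h x)\<^sup>2)" for h
    using integrable_mult_bounded[OF that(2), of "\<lambda>x. (c x)\<^sup>2" "C\<^sup>2"] c that(1)
    by (auto simp: power_mult_distrib intro!: AE_I2 power2_le_iff_abs_le[THEN iffD2] order_trans[OF abs_ge_zero])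
  let ?da = "\<lambda>k x. a k x - f x" and ?db = "\<lambda>k x. b k x - g x"
  have dai: "integrable M (\<lambda>x. (?da k x)\<^sup>2)" and dbi: "integrable M (\<lambda>x. (?db k x)\<^sup>2)" for k
    using a[of k] f b[of k] g by (auto intro!: integrable_square_diff)
  note CS = integral_Cauchy_Schwarz(1)
  have fc: "integrable M (\<lambda>x. (f x * c x)\<^sup>2)" and gc: "integrable M (\<lambda>x. (g x * c x)\<^sup>2)"
    using sq f g by auto
  have dac: "integrable M (\<lambda>x. (?da k x * c x)\<^sup>2)" for k using dai by (intro sq) auto
  have l1: "(\<lambda>k. LINT x|M. a k x * (g x * c x)) \<longlonglongrightarrow> (LINT x|M. f x * (g x * c x))"
    by (rule tendsto_integral_L2) (use a f gc la in auto)
  have l2: "(\<lambda>k. LINT x|M. b k x * (f x * c x)) \<longlonglongrightarrow> (LINT x|M. g x * (f x * c x))"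
    by (rule tendsto_integral_L2) (use b g fc lb in auto)
  have l3: "(\<lambda>k. LINT x|M. ?da k x * c x * ?db k x) \<longlonglongrightarrow> 0"
  proof (rule Lim_null_comparison)
    show "(\<lambda>k. (\<bar>C\<bar> * sqrt (LINT x|M. (?da k x)\<^sup>2)) * sqrt (LINT x|M. (?db k x)\<^sup>2)) \<longlonglongrightarrow> 0"
      using tendsto_mult[OF tendsto_mult_right_zero[OF la, of "\<bar>C\<bar>"] lb] by simp
    show "\<forall>\<^sub>F k in sequentially. norm (LINT x|M. ?da k x * c x * ?db k x)
      \<le> (\<bar>C\<bar> * sqrt (LINT x|M. (?da k x)\<^sup>2)) * sqrt (LINT x|M. (?db k x)\<^sup>2)"
    proof (rule always_eventually, rule allI)
      fix k
      have "(LINT x|M. (?da k x * c x)\<^sup>2) \<le> (LINT x|M. C\<^sup>2 * (?da k x)\<^sup>2)"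
      proof (rule integral_mono)
        fix x
        have "(c x)\<^sup>2 \<le> C\<^sup>2" using c[of x] by (metis abs_ge_zero power2_abs power_mono)
        then show "(?da k x * c x)\<^sup>2 \<le> C\<^sup>2 * (?da k x)\<^sup>2"
          by (simp add: power_mult_distrib mult.commute mult_right_mono)
      qed (use dac dai in auto)
      then have "sqrt (LINT x|M. (?da k x * c x)\<^sup>2) \<le> sqrt (C\<^sup>2 * (LINT x|M. (?da k x)\<^sup>2))"
        by (intro real_sqrt_le_mono) simp
      then have "sqrt (LINT x|M. (?da k x * c x)\<^sup>2) \<le> \<bar>C\<bar> * sqrt (LINT x|M. (?da k x)\<^sup>2)"
        by (simp add: real_sqrt_mult)
      moreover have "norm (LINT x|M. ?da k x * c x * ?db k x)
        \<le> sqrt (LINT x|M. (?da k x * c x)\<^sup>2) * sqrt (LINT x|M. (?db k x)\<^sup>2)"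
        using integral_Cauchy_Schwarz(2)[OF _ _ dac dbi] by simp
      moreover have "0 \<le> sqrt (LINT x|M. (?db k x)\<^sup>2)" by simp
      ultimately show "norm (LINT x|M. ?da k x * c x * ?db k x)
        \<le> (\<bar>C\<bar> * sqrt (LINT x|M. (?da k x)\<^sup>2)) * sqrt (LINT x|M. (?db k x)\<^sup>2)"
        using mult_right_mono order_trans by blast
    qed
  qed
  have eq: "(LINT x|M. a k x * b k x * c x) = (LINT x|M. ?da k x * c x * ?db k x)
      + (LINT x|M. a k x * (g x * c x)) + (LINT x|M. b k x * (f x * c x)) - (LINT x|M. f x * (g x * c x))" for k
  proof -
    have "(LINT x|M. a k x * b k x * c x) = (LINT x|M. ?da k x * c x * ?db k x
      + a k x * (g x * c x) + b k x * (f x * c x) - f x * (g x * c x))"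
      by (intro Bochner_Integration.integral_cong) (auto simp: algebra_simps)
    then show ?thesis
      using CS[OF _ _ dac dbi, of k k] CS[OF _ _ a[of k] gc] CS[OF _ _ b[of k] fc] CS[OF _ _ f gc] by simp
  qed
  have "(\<lambda>k. (LINT x|M. ?da k x * c x * ?db k x)
      + (LINT x|M. a k x * (g x * c x)) + (LINT x|M. b k x * (f x * c x)) - (LINT x|M. f x * (g x * c x)))
     \<longlonglongrightarrow> 0 + (LINT x|M. f x * (g x * c x)) + (LINT x|M. g x * (f x * c x)) - (LINT x|M. f x * (g x * c x))"
    by (intro tendsto_intros l1 l2 l3)
  then show ?thesis unfolding eq by (simp add: mult_ac)
qed

subsection \<open>Sobolev spaces\<close>

lemma L2D:
  assumes "f \<in> L2 \<Omega>"
  shows "f \<in> borel_measurable (lebesgue_on \<Omega>)" "integrable (lebesgue_on \<Omega>) (\<lambda>x. (norm (f x))\<^sup>2)"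
  using assms by (auto simp: L2_def)

lemma LinfD:
  assumes "f \<in> Linf \<Omega>"
  shows "f \<in> borel_measurable (lebesgue_on \<Omega>)" "\<exists>C. AE x in lebesgue_on \<Omega>. \<bar>f x\<bar> \<le> C"
  using assms by (auto simp: Linf_def)

lemma LinfI:
  assumes "f \<in> borel_measurable (lebesgue_on \<Omega>)" "AE x in lebesgue_on \<Omega>. \<bar>f x\<bar> \<le> C"
  shows "f \<in> Linf \<Omega>"
  using assms by (auto simp: Linf_def)

lemma H10_imp_H1: "f \<in> H10 \<Omega> \<Longrightarrow> f \<in> H1 \<Omega>"
  by (simp add: H10_def)

lemma weak_star_limit_minus:
  assumes "weak_star_limit \<Omega> R \<rho>"
  shows "weak_star_limit \<Omega> (\<lambda>\<epsilon> x. - R \<epsilon> x) (\<lambda>x. - \<rho> x)"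
  using assms unfolding weak_star_limit_def Linf_def by (auto intro: tendsto_minus)

lemma borel_measurable_vecI:
  fixes f :: "'a \<Rightarrow> 'c::euclidean_space^3"
  assumes "\<And>i. (\<lambda>x. f x $ i) \<in> borel_measurable M"
  shows "f \<in> borel_measurable M"
proof (subst borel_measurable_euclidean_space, rule ballI)
  fix b :: "'c^3"
  assume "b \<in> Basis"
  then obtain i u where b: "b = axis i u" by (auto simp: Basis_vec_def)
  have "(\<lambda>x. f x $ i \<bullet> u) \<in> borel_measurable M" using assms by simp
  then show "(\<lambda>x. f x \<bullet> b) \<in> borel_measurable M" by (simp add: b inner_axis)
qed

lemma norm_vec_power2: "(norm (x :: 'c::euclidean_space^3))\<^sup>2 = (\<Sum>i\<in>UNIV. (norm (x $ i))\<^sup>2)"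
  by (simp add: power2_norm_eq_inner inner_vec_def)

context bounded_open
begin

lemma L2_boundI:
  assumes [measurable]: "f \<in> borel_measurable (lebesgue_on \<Omega>)"
    and h: "integrable (lebesgue_on \<Omega>) h"
    and "AE x in lebesgue_on \<Omega>. (norm (f x))\<^sup>2 \<le> h x"
  shows "f \<in> L2 \<Omega>"
proof -
  have "integrable (lebesgue_on \<Omega>) (\<lambda>x. (norm (f x))\<^sup>2)"
  proof (rule Bochner_Integration.integrable_bound[OF h])
    show "AE x in lebesgue_on \<Omega>. norm ((norm (f x))\<^sup>2) \<le> norm (h x)"
      using assms(3) by eventually_elim simp
  qed simp
  then show ?thesis by (simp add: L2_def)
qed

lemma L2_add:
  assumes f: "f \<in> L2 \<Omega>" and g: "g \<in> L2 \<Omega>"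
  shows "(\<lambda>x. f x + g x) \<in> L2 \<Omega>"
proof (rule L2_boundI[where h="\<lambda>x. 2 * (norm (f x))\<^sup>2 + 2 * (norm (g x))\<^sup>2"])
  show "AE x in lebesgue_on \<Omega>. (norm (f x + g x))\<^sup>2 \<le> 2 * (norm (f x))\<^sup>2 + 2 * (norm (g x))\<^sup>2"
  proof (rule AE_I2)
    fix x
    have "(norm (f x + g x))\<^sup>2 \<le> (norm (f x) + norm (g x))\<^sup>2"
      by (intro power_mono norm_triangle_ineq) simp
    also have "\<dots> \<le> 2 * (norm (f x))\<^sup>2 + 2 * (norm (g x))\<^sup>2"
      using sum_squares_bound[of "norm (f x)" "norm (g x)"] by (simp add: power2_sum)
    finally show "(norm (f x + g x))\<^sup>2 \<le> 2 * (norm (f x))\<^sup>2 + 2 * (norm (g x))\<^sup>2" .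
  qed
qed (use L2D[OF f] L2D[OF g] in auto)

lemma L2_scaleR_bounded:
  assumes f: "f \<in> L2 \<Omega>" and [measurable]: "g \<in> borel_measurable (lebesgue_on \<Omega>)"
    and g: "AE x in lebesgue_on \<Omega>. \<bar>g x\<bar> \<le> C"
  shows "(\<lambda>x. g x *\<^sub>R f x) \<in> L2 \<Omega>"
proof (rule L2_boundI[where h="\<lambda>x. C\<^sup>2 * (norm (f x))\<^sup>2"])
  show "AE x in lebesgue_on \<Omega>. (norm (g x *\<^sub>R f x))\<^sup>2 \<le> C\<^sup>2 * (norm (f x))\<^sup>2"
    using g
  proof eventually_elim
    case (elim x)
    then have "(g x)\<^sup>2 \<le> C\<^sup>2" by (metis abs_ge_zero power2_abs power_mono)
    then show ?case by (simp add: power_mult_distrib mult_right_mono)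
  qed
qed (use L2D[OF f] in auto)

lemma L2_scaleR: "f \<in> L2 \<Omega> \<Longrightarrow> (\<lambda>x. c *\<^sub>R f x) \<in> L2 \<Omega>"
  by (rule L2_scaleR_bounded[where C="\<bar>c\<bar>"]) auto

lemma L2_diff: "f \<in> L2 \<Omega> \<Longrightarrow> g \<in> L2 \<Omega> \<Longrightarrow> (\<lambda>x. f x - g x) \<in> L2 \<Omega>"
  using L2_add[of f "\<lambda>x. (-1) *\<^sub>R g x"] L2_scaleR[of g "-1"] by simp

lemma L2_cong_AE:
  assumes f: "f \<in> L2 \<Omega>" and ae: "ae_eq \<Omega> f g"
  shows "g \<in> L2 \<Omega>"
proof (rule L2_boundI[OF _ L2D(2)[OF f]])
  show "g \<in> borel_measurable (lebesgue_on \<Omega>)"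
    by (rule borel_measurable_lebesgue_on_AE[OF \<Omega>_sets(1) L2D(1)[OF f]]) (use ae in \<open>simp add: ae_eq_def\<close>)
  show "AE x in lebesgue_on \<Omega>. (norm (g x))\<^sup>2 \<le> (norm (f x))\<^sup>2"
    using ae unfolding ae_eq_def by eventually_elim simp
qed

lemma L2_inner_integrable:
  assumes f: "f \<in> L2 \<Omega>" and g: "g \<in> L2 \<Omega>"
  shows "integrable (lebesgue_on \<Omega>) (\<lambda>x. f x \<bullet> g x)"
proof (rule Bochner_Integration.integrable_bound[of _ "\<lambda>x. norm (f x) * norm (g x)"])
  show "integrable (lebesgue_on \<Omega>) (\<lambda>x. norm (f x) * norm (g x))"
    using L2D[OF f] L2D[OF g] by (intro integral_Cauchy_Schwarz) auto
  show "(\<lambda>x. f x \<bullet> g x) \<in> borel_measurable (lebesgue_on \<Omega>)"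
    using L2D(1)[OF f] L2D(1)[OF g] by measurable
qed (simp add: Cauchy_Schwarz_ineq2)

lemma L2_mult_integrable: "f \<in> L2 \<Omega> \<Longrightarrow> g \<in> L2 \<Omega> \<Longrightarrow> integrable (lebesgue_on \<Omega>) (\<lambda>x. f x * g x)"
  for f g :: "real^3 \<Rightarrow> real"
  using L2_inner_integrable[of f g] by simp

lemma L2_const: "(\<lambda>x. c) \<in> L2 \<Omega>"
  by (simp add: L2_def)

lemma L2_integrable: "f \<in> L2 \<Omega> \<Longrightarrow> integrable (lebesgue_on \<Omega>) f" for f :: "real^3 \<Rightarrow> real"
  using L2_mult_integrable[OF _ L2_const[of 1]] by simp

lemma L2_vec:
  fixes f :: "real^3 \<Rightarrow> 'c::euclidean_space^3"
  assumes "\<And>i. (\<lambda>x. f x $ i) \<in> L2 \<Omega>"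
  shows "f \<in> L2 \<Omega>"
  using assms borel_measurable_vecI[of f] by (simp add: L2_def norm_vec_power2)

lemma L2_vec_nth:
  fixes f :: "real^3 \<Rightarrow> 'c::euclidean_space^3"
  assumes f: "f \<in> L2 \<Omega>"
  shows "(\<lambda>x. f x $ i) \<in> L2 \<Omega>"
proof (rule L2_boundI[OF _ L2D(2)[OF f]])
  show "(\<lambda>x. f x $ i) \<in> borel_measurable (lebesgue_on \<Omega>)"
    by (rule measurable_compose[OF L2D(1)[OF f] borel_measurable_continuous_onI])
      (intro continuous_intros)
  show "AE x in lebesgue_on \<Omega>. (norm (f x $ i))\<^sup>2 \<le> (norm (f x))\<^sup>2"
    by (intro AE_I2 power_mono Finite_Cartesian_Product.norm_nth_le) simp
qed

lemma Linf_mult_L2: "g \<in> Linf \<Omega> \<Longrightarrow> f \<in> L2 \<Omega> \<Longrightarrow> (\<lambda>x. g x * f x) \<in> L2 \<Omega>"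
  using L2_scaleR_bounded[of f g] LinfD[of g] unfolding real_scaleR_def by blast

lemma Linf_mult:
  assumes "f \<in> Linf \<Omega>" "g \<in> Linf \<Omega>"
  shows "(\<lambda>x. f x * g x) \<in> Linf \<Omega>"
proof -
  obtain C D where CD: "AE x in lebesgue_on \<Omega>. \<bar>f x\<bar> \<le> C" "AE x in lebesgue_on \<Omega>. \<bar>g x\<bar> \<le> D"
    using LinfD assms by metis
  have "AE x in lebesgue_on \<Omega>. \<bar>f x * g x\<bar> \<le> C * D"
    using CD by eventually_elim (auto simp: abs_mult intro!: mult_mono')
  then show ?thesis using LinfD(1) assms by (auto simp: Linf_def)
qed

lemma Linf_diff_const:
  assumes "f \<in> Linf \<Omega>"
  shows "(\<lambda>x. f x - c) \<in> Linf \<Omega>"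
proof -
  obtain C where C: "AE x in lebesgue_on \<Omega>. \<bar>f x\<bar> \<le> C" using LinfD assms by metis
  have "AE x in lebesgue_on \<Omega>. \<bar>f x - c\<bar> \<le> C + \<bar>c\<bar>" using C by eventually_elim auto
  then show ?thesis using LinfD(1)[OF assms] by (auto simp: Linf_def)
qed

text \<open>By uniqueness, any explicitly known weak derivative agrees almost everywhere with the
  one selected by the choice operator. All gradients are computed in this way.\<close>

lemma wpartial_eq_AE:
  assumes "has_weak_partial \<Omega> i f g"
  shows "has_weak_partial \<Omega> i f (wpartial \<Omega> i f)" "ae_eq \<Omega> (wpartial \<Omega> i f) g"
proof -
  show w: "has_weak_partial \<Omega> i f (wpartial \<Omega> i f)"
    unfolding wpartial_def by (rule someI[of "has_weak_partial \<Omega> i f", OF assms])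
  show "ae_eq \<Omega> (wpartial \<Omega> i f) g" by (rule has_weak_partial_unique[OF w assms])
qed

lemma H1D:
  assumes "f \<in> H1 \<Omega>"
  shows "f \<in> L2 \<Omega>" "has_weak_partial \<Omega> i f (wpartial \<Omega> i f)" "wpartial \<Omega> i f \<in> L2 \<Omega>"
proof -
  show "f \<in> L2 \<Omega>" using assms by (simp add: H1_def)
  obtain g where g: "g \<in> L2 \<Omega>" "has_weak_partial \<Omega> i f g" using assms by (auto simp: H1_def)
  show "has_weak_partial \<Omega> i f (wpartial \<Omega> i f)" by (rule wpartial_eq_AE[OF g(2)])
  show "wpartial \<Omega> i f \<in> L2 \<Omega>"
    using L2_cong_AE[OF g(1)] wpartial_eq_AE(2)[OF g(2)] ae_eq_sym by blast
qed

lemma wgrad_L2: "f \<in> H1 \<Omega> \<Longrightarrow> wgrad \<Omega> f \<in> L2 \<Omega>"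
  using H1D(3) by (intro L2_vec) (simp add: wgrad_def)

lemma wgrad_eqI:
  assumes "\<And>i. has_weak_partial \<Omega> i f (\<lambda>x. g x $ i)"
  shows "ae_eq \<Omega> (wgrad \<Omega> f) g"
proof -
  have "AE x in lebesgue_on \<Omega>. \<forall>i\<in>UNIV. wpartial \<Omega> i f x = g x $ i"
    unfolding AE_ball_countable[OF countable_finite[OF finite]]
    using wpartial_eq_AE(2)[OF assms] by (simp add: ae_eq_def)
  then show ?thesis unfolding ae_eq_def by eventually_elim (simp add: wgrad_def vec_eq_iff)
qed

lemma H1I:
  assumes "f \<in> L2 \<Omega>" "g \<in> L2 \<Omega>" "\<And>i. has_weak_partial \<Omega> i f (\<lambda>x. g x $ i)"
  shows "f \<in> H1 \<Omega>"
  using assms L2_vec_nth[OF assms(2)] unfolding H1_def by blast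

lemma H1_wgrad_nth: "f \<in> H1 \<Omega> \<Longrightarrow> has_weak_partial \<Omega> i f (\<lambda>x. wgrad \<Omega> f x $ i)"
  using H1D(2)[of f i] by (simp add: wgrad_def)

lemma H1_add:
  assumes "f \<in> H1 \<Omega>" "g \<in> H1 \<Omega>"
  shows "(\<lambda>x. f x + g x) \<in> H1 \<Omega>"
    and "ae_eq \<Omega> (wgrad \<Omega> (\<lambda>x. f x + g x)) (\<lambda>x. wgrad \<Omega> f x + wgrad \<Omega> g x)"
proof -
  have w: "has_weak_partial \<Omega> i (\<lambda>x. f x + g x) (\<lambda>x. (wgrad \<Omega> f x + wgrad \<Omega> g x) $ i)" for i
    using has_weak_partial_add[OF H1_wgrad_nth[OF assms(1)] H1_wgrad_nth[OF assms(2)]] by simp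
  show "ae_eq \<Omega> (wgrad \<Omega> (\<lambda>x. f x + g x)) (\<lambda>x. wgrad \<Omega> f x + wgrad \<Omega> g x)"
    by (rule wgrad_eqI[OF w])
  show "(\<lambda>x. f x + g x) \<in> H1 \<Omega>"
    by (rule H1I[OF _ _ w]) (use assms H1D(1) wgrad_L2 L2_add in blast)+
qed

lemma H1_const: "(\<lambda>x. c) \<in> H1 \<Omega>" "ae_eq \<Omega> (wgrad \<Omega> (\<lambda>x. c)) (\<lambda>x. 0)"
proof -
  have w: "has_weak_partial \<Omega> i (\<lambda>x. c) (\<lambda>x. (0 :: real^3) $ i)" for i
    using has_weak_partial_const by simp
  show "ae_eq \<Omega> (wgrad \<Omega> (\<lambda>x. c)) (\<lambda>x. 0)" by (rule wgrad_eqI[OF w])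
  show "(\<lambda>x. c) \<in> H1 \<Omega>" by (rule H1I[OF L2_const L2_const w])
qed

lemma H1_cong_AE:
  assumes "f \<in> H1 \<Omega>" "ae_eq \<Omega> f g"
  shows "g \<in> H1 \<Omega>" "ae_eq \<Omega> (wgrad \<Omega> g) (wgrad \<Omega> f)"
proof -
  have "ae_eq \<Omega> h h" for h :: "real^3 \<Rightarrow> real" by (simp add: ae_eq_def)
  then have w: "has_weak_partial \<Omega> i g (\<lambda>x. wgrad \<Omega> f x $ i)" for i
    using has_weak_partial_cong_AE[OF H1_wgrad_nth[OF assms(1)] assms(2)] by blast
  show "ae_eq \<Omega> (wgrad \<Omega> g) (wgrad \<Omega> f)" by (rule wgrad_eqI[OF w])
  show "g \<in> H1 \<Omega>"
    by (rule H1I[OF L2_cong_AE[OF H1D(1)[OF assms(1)] assms(2)] wgrad_L2[OF assms(1)] w])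
qed

lemma H1_Linf_mult:
  assumes f: "f \<in> H1 \<Omega>" "f \<in> Linf \<Omega>" and g: "g \<in> H1 \<Omega>" "g \<in> Linf \<Omega>"
  shows "(\<lambda>x. f x * g x) \<in> H1 \<Omega>" 
    and "ae_eq \<Omega> (wgrad \<Omega> (\<lambda>x. f x * g x)) (\<lambda>x. f x *\<^sub>R wgrad \<Omega> g x + g x *\<^sub>R wgrad \<Omega> f x)"
proof -
  obtain C D where CD: "AE x in lebesgue_on \<Omega>. \<bar>f x\<bar> \<le> C" "AE x in lebesgue_on \<Omega>. \<bar>g x\<bar> \<le> D"
    using LinfD(2) f g by metis
  have w: "has_weak_partial \<Omega> i (\<lambda>x. f x * g x) (\<lambda>x. (f x *\<^sub>R wgrad \<Omega> g x + g x *\<^sub>R wgrad \<Omega> f x) $ i)" for i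
    using has_weak_partial_mult[OF H1D(2)[OF f(1)] H1D(2)[OF g(1)] _ _ _ _ CD, of i]
      L2_integrable H1D(1,3) f(1) g(1) by (simp add: wgrad_def mult.commute)
  show "ae_eq \<Omega> (wgrad \<Omega> (\<lambda>x. f x * g x)) (\<lambda>x. f x *\<^sub>R wgrad \<Omega> g x + g x *\<^sub>R wgrad \<Omega> f x)"
    by (rule wgrad_eqI[OF w])
  show "(\<lambda>x. f x * g x) \<in> H1 \<Omega>"
    by (rule H1I[OF Linf_mult_L2[OF f(2) H1D(1)[OF g(1)]] L2_add[OF
        L2_scaleR_bounded[OF wgrad_L2[OF g(1)] LinfD(1)[OF f(2)] CD(1)]
        L2_scaleR_bounded[OF wgrad_L2[OF f(1)] LinfD(1)[OF g(2)] CD(2)]] w])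
qed

text \<open>Boundedness belongs to the conclusion because the next application of the product rule
  needs it for both factors. This is the only chain rule that the maximum principle uses.\<close>

lemma H1_Linf_power:
  assumes f: "f \<in> H1 \<Omega>" "f \<in> Linf \<Omega>"
  shows "(\<lambda>x. f x ^ Suc k) \<in> H1 \<Omega> \<and> (\<lambda>x. f x ^ Suc k) \<in> Linf \<Omega> \<and>
    ae_eq \<Omega> (wgrad \<Omega> (\<lambda>x. f x ^ Suc k)) (\<lambda>x. (real (Suc k) * f x ^ k) *\<^sub>R wgrad \<Omega> f x)"
proof (induction k)
  case 0
  then show ?case using f by (simp add: ae_eq_def)
next
  case (Suc k)
  let ?g = "\<lambda>x. f x ^ Suc k"
  have g: "?g \<in> H1 \<Omega>" "?g \<in> Linf \<Omega>"
    "ae_eq \<Omega> (wgrad \<Omega> ?g) (\<lambda>x. (real (Suc k) * f x ^ k) *\<^sub>R wgrad \<Omega> f x)"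
    using Suc by auto
  have eq: "(\<lambda>x. f x ^ Suc (Suc k)) = (\<lambda>x. f x * ?g x)" by simp
  have "ae_eq \<Omega> (wgrad \<Omega> (\<lambda>x. f x * ?g x)) (\<lambda>x. (real (Suc (Suc k)) * f x ^ Suc k) *\<^sub>R wgrad \<Omega> f x)"
    using H1_Linf_mult(2)[OF f g(1,2)] g(3) unfolding ae_eq_def
  proof eventually_elim
    case (elim x)
    have "wgrad \<Omega> (\<lambda>x. f x * ?g x) x
        = f x *\<^sub>R ((real (Suc k) * f x ^ k) *\<^sub>R wgrad \<Omega> f x) + f x ^ Suc k *\<^sub>R wgrad \<Omega> f x"
      by (simp only: elim)
    also have "\<dots> = (f x * (real (Suc k) * f x ^ k) + f x ^ Suc k) *\<^sub>R wgrad \<Omega> f x"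
      by (simp only: scaleR_scaleR scaleR_add_left)
    also have "f x * (real (Suc k) * f x ^ k) + f x ^ Suc k = real (Suc (Suc k)) * f x ^ Suc k"
      by (simp add: algebra_simps)
    finally show ?case .
  qed
  then show ?case
    unfolding eq using H1_Linf_mult(1)[OF f g(1,2)] Linf_mult[OF f(2) g(2)] by blast
qed

section \<open>Integration by parts and the convective term\<close>

lemma H10_approx:
  assumes f: "f \<in> H10 \<Omega>"
  obtains \<phi> where "\<And>k. \<phi> k \<in> test_functions \<Omega>"
    "(\<lambda>k. sqrt (LINT x|lebesgue_on \<Omega>. (\<phi> k x - f x)\<^sup>2)) \<longlonglongrightarrow> 0"
    "\<And>i. (\<lambda>k. sqrt (LINT x|lebesgue_on \<Omega>. (partial i (\<phi> k) x - wpartial \<Omega> i f x)\<^sup>2)) \<longlonglongrightarrow> 0"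
  using assms unfolding H10_def l2norm_def by auto

lemma test_functions_L2:
  assumes "\<phi> \<in> test_functions \<Omega>"
  shows "\<phi> \<in> L2 \<Omega>"
proof -
  obtain C where C: "\<And>x. \<bar>\<phi> x\<bar> \<le> C" using test_functions_bounded[OF assms] by blast
  show ?thesis
  proof (rule L2_boundI[where h="\<lambda>x. C\<^sup>2"])
    show "AE x in lebesgue_on \<Omega>. (norm (\<phi> x))\<^sup>2 \<le> C\<^sup>2"
      using C by (intro AE_I2 power_mono) auto
  qed (use borel_measurable_\<Omega>[OF test_functions_borel[OF assms]] in auto)
qed

lemma L2_realD:
  fixes f :: "real^3 \<Rightarrow> real"
  assumes "f \<in> L2 \<Omega>"
  shows "f \<in> borel_measurable (lebesgue_on \<Omega>)" "integrable (lebesgue_on \<Omega>) (\<lambda>x. (f x)\<^sup>2)"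
  using L2D[OF assms] by auto

text \<open>For a test function in place of \<open>f\<close> this is the definition of the weak
  derivative of \<open>g\<close>. Both sides are continuous in \<open>f\<close> for the H1 norm, and
  no boundary term appears although \<open>g\<close> is free at the boundary.\<close>

lemma H10_H1_by_parts:
  assumes f: "f \<in> H10 \<Omega>" and g: "g \<in> H1 \<Omega>"
  shows "(LINT x|lebesgue_on \<Omega>. f x * wpartial \<Omega> i g x) = - (LINT x|lebesgue_on \<Omega>. wpartial \<Omega> i f x * g x)"
proof -
  obtain \<phi> where phi: "\<And>k. \<phi> k \<in> test_functions \<Omega>"
    "(\<lambda>k. sqrt (LINT x|lebesgue_on \<Omega>. (\<phi> k x - f x)\<^sup>2)) \<longlonglongrightarrow> 0"
    "\<And>i. (\<lambda>k. sqrt (LINT x|lebesgue_on \<Omega>. (partial i (\<phi> k) x - wpartial \<Omega> i f x)\<^sup>2)) \<longlonglongrightarrow> 0"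
    by (rule H10_approx[OF f]) blast
  note t = L2_realD[OF test_functions_L2[OF phi(1)]]
    L2_realD[OF test_functions_L2[OF partial_test_functions[OF phi(1)]]]
  note h = L2_realD[OF H1D(1)[OF g]] L2_realD[OF H1D(3)[OF g]]
    L2_realD[OF H1D(1)[OF H10_imp_H1[OF f]]] L2_realD[OF H1D(3)[OF H10_imp_H1[OF f]]]
  have 1: "(\<lambda>k. LINT x|lebesgue_on \<Omega>. \<phi> k x * wpartial \<Omega> i g x) \<longlonglongrightarrow> (LINT x|lebesgue_on \<Omega>. f x * wpartial \<Omega> i g x)"
    by (rule tendsto_integral_L2[OF _ _ _ _ _ _ phi(2)]) (use t h in auto)
  have 2: "(\<lambda>k. LINT x|lebesgue_on \<Omega>. partial i (\<phi> k) x * g x) \<longlonglongrightarrow> (LINT x|lebesgue_on \<Omega>. wpartial \<Omega> i f x * g x)"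
    by (rule tendsto_integral_L2[OF _ _ _ _ _ _ phi(3)]) (use t h in auto)
  have eq: "- (LINT x|lebesgue_on \<Omega>. \<phi> k x * wpartial \<Omega> i g x) = (LINT x|lebesgue_on \<Omega>. partial i (\<phi> k) x * g x)" for k
    using has_weak_partialD(3)[OF H1D(2)[OF g] phi(1)] by (simp add: mult.commute)
  show ?thesis
    using LIMSEQ_unique[OF tendsto_minus[OF 1, unfolded eq] 2] by simp
qed

text \<open>As \<open>f\<close> may be unbounded, \<open>has_weak_partial_mult\<close> does not
  apply. For an approximating test function \<open>\<phi> k\<close>, the derivative of
  \<open>(\<phi> k)\<^sup>2 \<zeta>\<close> has integral zero. Both factors of each product converge
  in L2 and \<open>\<zeta>\<close> and its derivative are bounded, which suffices for the
  limit.\<close>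

lemma H10_square_weak_partial:
  assumes f: "f \<in> H10 \<Omega>"
  shows "has_weak_partial \<Omega> i (\<lambda>x. f x * f x) (\<lambda>x. 2 * (f x * wpartial \<Omega> i f x))"
  unfolding has_weak_partial_def
proof (intro conjI ballI)
  note f1 = H10_imp_H1[OF f]
  have i1: "integrable (lebesgue_on \<Omega>) (\<lambda>x. f x * f x)"
    by (intro L2_mult_integrable H1D(1)[OF f1])
  have i2: "integrable (lebesgue_on \<Omega>) (\<lambda>x. 2 * (f x * wpartial \<Omega> i f x))"
    by (intro integrable_mult_right L2_mult_integrable H1D(1)[OF f1] H1D(3)[OF f1])
  show "(\<lambda>x. f x * f x) \<in> L1loc \<Omega>" "(\<lambda>x. 2 * (f x * wpartial \<Omega> i f x)) \<in> L1loc \<Omega>"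
    using i1 i2 integrable_imp_L1loc by blast+
  obtain \<phi> where phi: "\<And>k. \<phi> k \<in> test_functions \<Omega>"
    "(\<lambda>k. sqrt (LINT x|lebesgue_on \<Omega>. (\<phi> k x - f x)\<^sup>2)) \<longlonglongrightarrow> 0"
    "\<And>i. (\<lambda>k. sqrt (LINT x|lebesgue_on \<Omega>. (partial i (\<phi> k) x - wpartial \<Omega> i f x)\<^sup>2)) \<longlonglongrightarrow> 0"
    by (rule H10_approx[OF f]) blast
  note t = L2_realD[OF test_functions_L2[OF phi(1)]]
    L2_realD[OF test_functions_L2[OF partial_test_functions[OF phi(1)]]]
  note h = L2_realD[OF H1D(1)[OF f1]] L2_realD[OF H1D(3)[OF f1]]
  fix \<zeta> assume zeta: "\<zeta> \<in> test_functions \<Omega>"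
  note dzeta = partial_test_functions[OF zeta]
  note z = borel_measurable_\<Omega>[OF test_functions_borel[OF zeta]] borel_measurable_\<Omega>[OF test_functions_borel[OF dzeta]]
  obtain C where C: "\<And>x. \<bar>\<zeta> x\<bar> \<le> C" using test_functions_bounded[OF zeta] by blast
  obtain D where D: "\<And>x. \<bar>partial i \<zeta> x\<bar> \<le> D" using test_functions_bounded[OF dzeta] by blast
  have 1: "(\<lambda>k. LINT x|lebesgue_on \<Omega>. \<phi> k x * \<phi> k x * partial i \<zeta> x) \<longlonglongrightarrow> (LINT x|lebesgue_on \<Omega>. f x * f x * partial i \<zeta> x)"
    by (rule tendsto_integral_L2_mult[OF _ _ _ _ _ _ _ _ _ D phi(2) phi(2)]) (use t h z in auto)
  have 2: "(\<lambda>k. LINT x|lebesgue_on \<Omega>. \<phi> k x * partial i (\<phi> k) x * \<zeta> x) \<longlonglongrightarrow> (LINT x|lebesgue_on \<Omega>. f x * wpartial \<Omega> i f x * \<zeta> x)"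
    by (rule tendsto_integral_L2_mult[OF _ _ _ _ _ _ _ _ _ C phi(2) phi(3)]) (use t h z in auto)
  have eq: "(LINT x|lebesgue_on \<Omega>. \<phi> k x * \<phi> k x * partial i \<zeta> x) = - (2 * (LINT x|lebesgue_on \<Omega>. \<phi> k x * partial i (\<phi> k) x * \<zeta> x))" for k
  proof -
    have C1: "Ck j (\<lambda>x. \<phi> k x * \<phi> k x)" for j
      by (intro Ck_mult test_functionsD(1)[OF phi(1)])
    have T: "(\<lambda>x. \<phi> k x * \<phi> k x * \<zeta> x) \<in> test_functions \<Omega>"
      by (rule test_functions_mult[OF zeta C1])
    have d: "\<phi> k differentiable (at x)" "\<zeta> differentiable (at x)" for x
      using test_functionsD(2) phi(1) zeta by blast+
    have d2: "(\<lambda>x. \<phi> k x * \<phi> k x) differentiable (at x)" for x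
      using C1[of "Suc 0"] by simp
    have pd: "partial i (\<lambda>x. \<phi> k x * \<phi> k x * \<zeta> x) x
      = \<phi> k x * \<phi> k x * partial i \<zeta> x + 2 * (\<phi> k x * partial i (\<phi> k) x * \<zeta> x)" for x
      by (subst partial_mult[OF d2 d(2)], subst partial_mult[OF d(1) d(1)]) (simp add: algebra_simps)
    have P: "integrable (lebesgue_on \<Omega>) (\<lambda>x. a x * b x * c x)"
      if "a \<in> test_functions \<Omega>" "b \<in> test_functions \<Omega>" "c \<in> test_functions \<Omega>" for a b c
      by (rule L1loc_integrable_test[OF integrable_imp_L1loc that(3)])
        (intro L2_mult_integrable test_functions_L2 that)
    have "(LINT x|lebesgue_on \<Omega>. \<phi> k x * \<phi> k x * partial i \<zeta> x + 2 * (\<phi> k x * partial i (\<phi> k) x * \<zeta> x)) = 0"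
      using integral_partial_test[OF T, of i] by (simp add: pd)
    then show ?thesis
      using P[OF phi(1) phi(1) dzeta] P[OF phi(1) partial_test_functions[OF phi(1)] zeta] by simp
  qed
  have "(LINT x|lebesgue_on \<Omega>. f x * f x * partial i \<zeta> x) = - (2 * (LINT x|lebesgue_on \<Omega>. f x * wpartial \<Omega> i f x * \<zeta> x))"
    by (rule LIMSEQ_unique[OF 1[unfolded eq] tendsto_minus[OF tendsto_mult_left[OF 2]]])
  then show "(LINT x|lebesgue_on \<Omega>. f x * f x * partial i \<zeta> x)
      = - (LINT x|lebesgue_on \<Omega>. 2 * (f x * wpartial \<Omega> i f x) * \<zeta> x)"
    by (simp add: mult.assoc)
qed

lemma has_weak_partial_sum:
  assumes "finite I" "\<And>j. j \<in> I \<Longrightarrow> has_weak_partial \<Omega> i (f j) (g j)"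
  shows "has_weak_partial \<Omega> i (\<lambda>x. \<Sum>j\<in>I. f j x) (\<lambda>x. \<Sum>j\<in>I. g j x)"
  using assms by (induction I) (auto intro: has_weak_partial_const has_weak_partial_add)

lemma vecH10D:
  assumes "u \<in> vecH10 \<Omega>"
  shows "(\<lambda>x. u x $ i) \<in> H10 \<Omega>" "(\<lambda>x. u x $ i) \<in> H1 \<Omega>" "u \<in> L2 \<Omega>" "wjac \<Omega> u \<in> L2 \<Omega>"
    "symgrad \<Omega> u \<in> L2 \<Omega>" "wdiv \<Omega> u \<in> L2 \<Omega>"
proof -
  have h: "(\<lambda>x. u x $ i) \<in> H10 \<Omega>" for i using assms by (simp add: vecH10_def)
  then show "(\<lambda>x. u x $ i) \<in> H10 \<Omega>" .
  have h1: "(\<lambda>x. u x $ i) \<in> H1 \<Omega>" for i using h H10_imp_H1 by blast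
  then show "(\<lambda>x. u x $ i) \<in> H1 \<Omega>" .
  show "u \<in> L2 \<Omega>" using h1 H1D(1) by (intro L2_vec) blast
  have wp: "wpartial \<Omega> j (\<lambda>y. u y $ i) \<in> L2 \<Omega>" for i j using h1 H1D(3) by blast
  show j: "wjac \<Omega> u \<in> L2 \<Omega>"
    by (intro L2_vec) (simp add: wjac_def wp)
  have "(\<lambda>x. transpose (wjac \<Omega> u x)) \<in> L2 \<Omega>"
    by (intro L2_vec) (simp add: wjac_def transpose_def wp)
  then show "symgrad \<Omega> u \<in> L2 \<Omega>"
    unfolding symgrad_def[abs_def] by (intro L2_scaleR L2_add j)
  have "(\<lambda>x. \<Sum>i\<in>I. wpartial \<Omega> i (\<lambda>y. u y $ i) x) \<in> L2 \<Omega>" if "finite I" for I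
    using that by (induction I) (auto intro: L2_const L2_add wp)
  then show "wdiv \<Omega> u \<in> L2 \<Omega>" by (simp add: wdiv_def[abs_def])
qed

lemma vecH10_by_parts:
  assumes u: "u \<in> vecH10 \<Omega>" and f: "f \<in> H1 \<Omega>"
  shows "(LINT x|lebesgue_on \<Omega>. u x \<bullet> wgrad \<Omega> f x) = - (LINT x|lebesgue_on \<Omega>. wdiv \<Omega> u x * f x)"
proof -
  note u1 = vecH10D(1)[OF u] and u2 = vecH10D(2)[OF u]
  have "(LINT x|lebesgue_on \<Omega>. u x \<bullet> wgrad \<Omega> f x) = (LINT x|lebesgue_on \<Omega>. (\<Sum>i\<in>UNIV. u x $ i * wpartial \<Omega> i f x))"
    by (simp add: inner_vec_def wgrad_def)
  also have "\<dots> = (\<Sum>i\<in>UNIV. LINT x|lebesgue_on \<Omega>. u x $ i * wpartial \<Omega> i f x)"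
    by (intro Bochner_Integration.integral_sum L2_mult_integrable H1D(1)[OF u2] H1D(3)[OF f])
  also have "\<dots> = (\<Sum>i\<in>UNIV. - (LINT x|lebesgue_on \<Omega>. wpartial \<Omega> i (\<lambda>y. u y $ i) x * f x))"
    by (intro sum.cong refl H10_H1_by_parts u1 f)
  also have "\<dots> = - (LINT x|lebesgue_on \<Omega>. (\<Sum>i\<in>UNIV. wpartial \<Omega> i (\<lambda>y. u y $ i) x * f x))"
    by (subst Bochner_Integration.integral_sum)
      (auto intro!: L2_mult_integrable H1D(1)[OF f] H1D(3)[OF u2] simp: sum_negf)
  finally show ?thesis by (simp add: wdiv_def sum_distrib_right)
qed

text \<open>Pointwise, \<open>w\<close> paired with the gradient of \<open>u \<bullet> u\<close> is
  twice \<open>((w \<cdot> \<nabla>) u) \<bullet> u\<close>. The weak form of the divergence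
  correction therefore cancels the transport integral for every \<open>w\<close> for which both
  integrals exist.\<close>

lemma Btilde_self:
  assumes u: "u \<in> vecH10 \<Omega>" and "Btilde_integrable \<Omega> w u u"
  shows "Btilde \<Omega> w u u = 0"
proof -
  let ?g = "\<lambda>x. \<chi> i. \<Sum>j\<in>UNIV. 2 * (u x $ j * wpartial \<Omega> i (\<lambda>y. u y $ j) x)"
  have "has_weak_partial \<Omega> i (\<lambda>x. \<Sum>j\<in>UNIV. u x $ j * u x $ j) (\<lambda>x. ?g x $ i)" for i
    using has_weak_partial_sum[OF finite H10_square_weak_partial[OF vecH10D(1)[OF u]]] by simp
  then have "ae_eq \<Omega> (wgrad \<Omega> (\<lambda>x. u x \<bullet> u x)) ?g"
    by (intro wgrad_eqI) (simp add: inner_vec_def)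
  then have ae: "AE x in lebesgue_on \<Omega>. w x \<bullet> wgrad \<Omega> (\<lambda>y. u y \<bullet> u y) x = 2 * ((wjac \<Omega> u x *v w x) \<bullet> u x)"
    unfolding ae_eq_def
  proof eventually_elim
    case (elim x)
    show ?case
      unfolding elim
      by (simp add: inner_vec_def wjac_def matrix_vector_mult_def sum_distrib_left sum_distrib_right)
        (subst sum.swap, simp add: mult_ac)
  qed
  show ?thesis
    using integral_cong_AE[OF _ _ ae] assms(2) by (auto simp: Btilde_def Btilde_integrable_def)
qed

end

subsection \<open>The maximum principle for the density\<close>

text \<open>With \<open>n\<close> odd and \<open>e > d\<close>, the function
  \<open>(a - d) a ^ n\<close> is at least \<open>(e - d) e ^ n\<close> where \<open>a > e\<close>
  and at least \<open>- d d ^ n\<close> elsewhere. Its integral is nonpositive, so the measure of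
  the first set is at most a constant times \<open>(d / e) ^ n\<close>, which tends to 0. Only odd
  exponents occur because the odd powers are the test functions of the transport equation.\<close>

lemma (in finite_measure) AE_le_of_odd_moments:
  fixes a :: "'a \<Rightarrow> real"
  assumes [measurable]: "a \<in> borel_measurable M" and a0: "\<And>x. 0 \<le> a x" and d: "0 \<le> d"
    and int: "\<And>k. integrable M (\<lambda>x. a x ^ k)"
    and le: "\<And>k. (LINT x|M. a x ^ Suc (Suc (2 * k))) \<le> d * (LINT x|M. a x ^ Suc (2 * k))"
  shows "AE x in M. a x \<le> d"
proof -
  have AE_less: "AE x in M. a x \<le> e" if e: "d < e" for e
  proof -
    let ?A = "{x \<in> space M. e < a x}"
    have bound: "(e - d) * measure M ?A \<le> d * measure M (space M) * (d / e) ^ Suc (2 * k)" for k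
    proof -
      let ?n = "Suc (2 * k)"
      have "(LINT x|M. (e - d) * e ^ ?n * indicator ?A x - d * d ^ ?n) \<le> (LINT x|M. a x ^ Suc ?n - d * a x ^ ?n)"
      proof (rule integral_mono)
        fix x assume x: "x \<in> space M"
        have "(e - d) * e ^ ?n * indicator ?A x - d * d ^ ?n \<le> (a x - d) * a x ^ ?n"
        proof (cases "e < a x")
          case True
          have "(e - d) * e ^ ?n \<le> (a x - d) * a x ^ ?n"
            using True e d by (intro mult_mono power_mono) auto
          moreover have "0 \<le> d * d ^ ?n" using d by (intro mult_nonneg_nonneg zero_le_power)
          moreover have "indicator ?A x = (1::real)" using True x by simp
          ultimately show ?thesis by simp
        next
          case False
          have "(d - a x) * a x ^ ?n \<le> d * d ^ ?n"
          proof (cases "a x \<le> d")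
            case True
            then show ?thesis using a0[of x] d by (intro mult_mono power_mono) auto
          next
            case False
            then have "(d - a x) * a x ^ ?n \<le> 0" using a0[of x] by (intro mult_nonpos_nonneg) auto
            also have "0 \<le> d * d ^ ?n" using d by (intro mult_nonneg_nonneg zero_le_power)
            finally show ?thesis .
          qed
          moreover have "(a x - d) * a x ^ ?n = - ((d - a x) * a x ^ ?n)" by (simp add: algebra_simps)
          ultimately show ?thesis using False by simp
        qed
        then show "(e - d) * e ^ ?n * indicator ?A x - d * d ^ ?n \<le> a x ^ Suc ?n - d * a x ^ ?n"
          by (simp add: left_diff_distrib)
      qed (use int in \<open>auto simp del: power_Suc intro!: integrable_real_indicator simp: less_top[symmetric]\<close>)
      also have "\<dots> = (LINT x|M. a x ^ Suc ?n) - d * (LINT x|M. a x ^ ?n)"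
        using int by (simp del: power_Suc)
      also have "\<dots> \<le> 0" using le[of k] by simp
      also have "(LINT x|M. (e - d) * e ^ ?n * indicator ?A x - d * d ^ ?n)
          = (e - d) * e ^ ?n * measure M ?A - d * d ^ ?n * measure M (space M)"
        by (simp del: power_Suc add: less_top[symmetric])
      finally have "(e - d) * measure M ?A * e ^ ?n \<le> d * measure M (space M) * d ^ ?n"
        by (simp add: mult_ac)
      then show ?thesis using d e by (simp only: power_divide pos_le_divide_eq times_divide_eq_right zero_less_power)
    qed
    have "(\<lambda>k. (d / e) ^ k) \<longlonglongrightarrow> 0" using d e by (intro LIMSEQ_power_zero) auto
    then have "(\<lambda>k. (d / e) ^ Suc (2 * k)) \<longlonglongrightarrow> 0"
      by (rule LIMSEQ_subseq_LIMSEQ[unfolded comp_def]) (simp add: strict_mono_def)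
    then have "(\<lambda>k. d * measure M (space M) * (d / e) ^ Suc (2 * k)) \<longlonglongrightarrow> 0"
      by (rule tendsto_mult_right_zero)
    then have "(e - d) * measure M ?A \<le> 0"
      by (rule LIMSEQ_le_const) (use bound in blast)
    then have "measure M ?A = 0" using e by (simp add: mult_le_0_iff measure_le_0_iff)
    then have "?A \<in> null_sets M" by (auto simp: emeasure_eq_measure)
    from AE_not_in[OF this] AE_space show ?thesis by eventually_elim auto
  qed
  have "AE x in M. \<forall>k::nat. a x \<le> d + 1 / real (Suc k)"
    unfolding AE_all_countable by (intro allI AE_less) simp
  then show ?thesis
  proof eventually_elim
    case (elim x)
    have "(\<lambda>k. d + inverse (real (Suc k))) \<longlonglongrightarrow> d + 0"
      by (intro tendsto_intros LIMSEQ_inverse_real_of_nat)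
    then have "a x \<le> d + 0"
      by (rule LIMSEQ_le_const) (use elim in \<open>auto simp: inverse_eq_divide\<close>)
    then show ?case by simp
  qed
qed

context bounded_open
begin

lemma Linf_integrable:
  assumes "f \<in> Linf \<Omega>"
  shows "integrable (lebesgue_on \<Omega>) f"
proof -
  obtain C where "AE x in lebesgue_on \<Omega>. \<bar>f x\<bar> \<le> C" using LinfD(2)[OF assms] by blast
  then show ?thesis by (intro fin.integrable_const_bound[where B=C]) (use LinfD(1)[OF assms] in auto)
qed

text \<open>Odd powers of \<open>f\<close> have a nonnegative derivative, which gives the diffusion
  term a sign, and multiply \<open>f\<close> to an even power, which is a moment of its modulus. The
  power \<open>2k + 1\<close> of \<open>f\<close> times the gradient of \<open>f\<close> is a
  multiple of the gradient of the next power, to which \<open>w\<close> is orthogonal. What remains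
  is the moment inequality of \<open>AE_le_of_odd_moments\<close>, with \<open>d\<close> half the
  length of the interval.\<close>

lemma regularized_density_bounds:
  assumes reg: "regularized_density \<Omega> \<delta>t w \<rho>old \<epsilon> R" and R: "R \<in> Linf \<Omega>"
    and pos: "0 < \<epsilon>" "0 < \<delta>t" and w: "w \<in> L2 \<Omega>"
    and solenoidal: "\<And>\<phi>. \<phi> \<in> H1 \<Omega> \<Longrightarrow> (LINT x|lebesgue_on \<Omega>. w x \<bullet> wgrad \<Omega> \<phi> x) = 0"
    and old: "\<rho>old \<in> borel_measurable (lebesgue_on \<Omega>)" "AE x in lebesgue_on \<Omega>. \<rho>1 \<le> \<rho>old x \<and> \<rho>old x \<le> \<rho>2"
  shows "AE x in lebesgue_on \<Omega>. \<rho>1 \<le> R x \<and> R x \<le> \<rho>2"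
proof (cases "\<rho>1 \<le> \<rho>2")
  \<comment> \<open>If \<open>\<rho>1\<close> exceeds \<open>\<rho>2\<close>, the bounds on
    \<open>\<rho>old\<close> are contradictory and hold only because the domain is null. The main
    case needs \<open>d\<close> nonnegative.\<close>
  case False
  show ?thesis using old(2) by eventually_elim (use False in auto)
next
  case True
  define c where "c = (\<rho>1 + \<rho>2) / 2"
  define d where "d = (\<rho>2 - \<rho>1) / 2"
  define f where "f x = R x - c" for x
  have d0: "0 \<le> d" using True by (simp add: d_def)
  have RH: "R \<in> H1 \<Omega>" using reg by (simp add: regularized_density_def)
  have fL: "f \<in> Linf \<Omega>" unfolding f_def[abs_def] by (rule Linf_diff_const[OF R])
  have fH: "f \<in> H1 \<Omega>" "ae_eq \<Omega> (wgrad \<Omega> f) (wgrad \<Omega> R)"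
  proof -
    have eq: "f = (\<lambda>x. R x + (- c))" by (simp add: f_def fun_eq_iff)
    show "f \<in> H1 \<Omega>" unfolding eq by (rule H1_add(1)[OF RH H1_const(1)])
    show "ae_eq \<Omega> (wgrad \<Omega> f) (wgrad \<Omega> R)"
      using H1_add(2)[OF RH H1_const(1)[of "- c"]] H1_const(2)[of "- c"] unfolding eq[symmetric] ae_eq_def
      by eventually_elim simp
  qed
  have oldL: "\<rho>old \<in> Linf \<Omega>"
    by (rule LinfI[OF old(1), where C="\<bar>\<rho>1\<bar> + \<bar>\<rho>2\<bar>"]) (use old(2) in \<open>eventually_elim, auto\<close>)
  note fm = LinfD(1)[OF fL] and Rm = LinfD(1)[OF R]
  \<comment> \<open>\<open>H1_Linf_power\<close> speaks of positive exponents, hence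
    \<open>k - 1\<close>; exponent 0 is the constant 1.\<close>
  have pow: "(\<lambda>x. f x ^ k) \<in> Linf \<Omega>" for k
    using H1_Linf_power[OF fH(1) fL, of "k - 1"] LinfI[of "\<lambda>x. 1" \<Omega> 1] by (cases k) auto
  have "AE x in lebesgue_on \<Omega>. \<bar>f x\<bar> \<le> d"
  proof (rule fin.AE_le_of_odd_moments)
    show "(\<lambda>x. \<bar>f x\<bar>) \<in> borel_measurable (lebesgue_on \<Omega>)" using fm by measurable
    show ai: "integrable (lebesgue_on \<Omega>) (\<lambda>x. \<bar>f x\<bar> ^ k)" for k
      using integrable_abs[OF Linf_integrable[OF pow[of k]]] by (simp add: power_abs)
    fix k
    let ?\<phi> = "\<lambda>x. f x ^ Suc (2 * k)" and ?\<psi> = "\<lambda>x. f x ^ Suc (Suc (2 * k))"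
    have phi: "?\<phi> \<in> H1 \<Omega>" "?\<phi> \<in> Linf \<Omega>"
      and gphi: "ae_eq \<Omega> (wgrad \<Omega> ?\<phi>) (\<lambda>x. (real (Suc (2 * k)) * f x ^ (2 * k)) *\<^sub>R wgrad \<Omega> f x)"
      using H1_Linf_power[OF fH(1) fL, of "2 * k"] by auto
    have psi: "?\<psi> \<in> H1 \<Omega>"
      and gpsi: "ae_eq \<Omega> (wgrad \<Omega> ?\<psi>) (\<lambda>x. (real (Suc (Suc (2 * k))) * ?\<phi> x) *\<^sub>R wgrad \<Omega> f x)"
      using H1_Linf_power[OF fH(1) fL, of "Suc (2 * k)"] by auto
    let ?A = "LINT x|lebesgue_on \<Omega>. (R x - \<rho>old x) / \<delta>t * ?\<phi> x"
    let ?B = "LINT x|lebesgue_on \<Omega>. (w x \<bullet> wgrad \<Omega> R x) * ?\<phi> x"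
    let ?C = "LINT x|lebesgue_on \<Omega>. wgrad \<Omega> R x \<bullet> wgrad \<Omega> ?\<phi> x"
    have eq: "?A + ?B + \<epsilon> * ?C = 0"
      using reg phi by (simp add: regularized_density_def del: power_Suc)
    have "?B = 0"
    proof -
      have "?B = (LINT x|lebesgue_on \<Omega>. (1 / real (Suc (Suc (2 * k)))) * (w x \<bullet> wgrad \<Omega> ?\<psi> x))"
      proof (rule integral_cong_AE)
        show "(\<lambda>x. (w x \<bullet> wgrad \<Omega> R x) * ?\<phi> x) \<in> borel_measurable (lebesgue_on \<Omega>)"
          using L2_inner_integrable[OF w wgrad_L2[OF RH]] LinfD(1)[OF phi(2)] by measurable
        show "(\<lambda>x. (1 / real (Suc (Suc (2 * k)))) * (w x \<bullet> wgrad \<Omega> ?\<psi> x)) \<in> borel_measurable (lebesgue_on \<Omega>)"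
          using L2_inner_integrable[OF w wgrad_L2[OF psi]] by measurable
        show "AE x in lebesgue_on \<Omega>. (w x \<bullet> wgrad \<Omega> R x) * ?\<phi> x = (1 / real (Suc (Suc (2 * k)))) * (w x \<bullet> wgrad \<Omega> ?\<psi> x)"
          using gpsi fH(2) unfolding ae_eq_def by eventually_elim (simp del: power_Suc of_nat_Suc)
      qed
      then show ?thesis using solenoidal[OF psi] by (simp del: power_Suc)
    qed
    moreover have "0 \<le> ?C"
    proof (rule integral_nonneg_AE)
      show "AE x in lebesgue_on \<Omega>. 0 \<le> wgrad \<Omega> R x \<bullet> wgrad \<Omega> ?\<phi> x"
        using gphi fH(2) unfolding ae_eq_def
        by eventually_elim (simp del: power_Suc of_nat_Suc add: power_mult)
    qed
    ultimately have A: "?A \<le> 0" using eq pos(1) mult_nonneg_nonneg[of \<epsilon> ?C] by linarith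
    have i2: "integrable (lebesgue_on \<Omega>) (\<lambda>x. (R x - \<rho>old x) * ?\<phi> x)"
      using Linf_integrable[OF Linf_mult[OF R phi(2)]] Linf_integrable[OF Linf_mult[OF oldL phi(2)]]
      by (simp add: left_diff_distrib del: power_Suc)
    have "(LINT x|lebesgue_on \<Omega>. \<bar>f x\<bar> ^ Suc (Suc (2 * k)) - d * \<bar>f x\<bar> ^ Suc (2 * k))
        \<le> (LINT x|lebesgue_on \<Omega>. (R x - \<rho>old x) * ?\<phi> x)"
    proof (rule integral_mono_AE)
      show "AE x in lebesgue_on \<Omega>. \<bar>f x\<bar> ^ Suc (Suc (2 * k)) - d * \<bar>f x\<bar> ^ Suc (2 * k) \<le> (R x - \<rho>old x) * ?\<phi> x"
        using old(2)
      proof eventually_elim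
        case (elim x)
        have g: "\<bar>\<rho>old x - c\<bar> \<le> d" using elim by (auto simp: c_def d_def abs_le_iff field_simps)
        have "(\<rho>old x - c) * ?\<phi> x \<le> \<bar>(\<rho>old x - c) * ?\<phi> x\<bar>" by simp
        also have "\<dots> = \<bar>\<rho>old x - c\<bar> * \<bar>f x\<bar> ^ Suc (2 * k)" by (simp only: abs_mult power_abs)
        also have "\<dots> \<le> d * \<bar>f x\<bar> ^ Suc (2 * k)" using g by (rule mult_right_mono) simp
        finally have 1: "(\<rho>old x - c) * ?\<phi> x \<le> d * \<bar>f x\<bar> ^ Suc (2 * k)" .
        have e: "even (Suc (Suc (2 * k)))" by simp
        have 2: "\<bar>f x\<bar> ^ Suc (Suc (2 * k)) = f x * ?\<phi> x"
          using power_even_abs[OF e, of "f x"] by simp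
        have "(R x - \<rho>old x) * ?\<phi> x = f x * ?\<phi> x - (\<rho>old x - c) * ?\<phi> x"
          by (simp add: f_def algebra_simps)
        then show ?case using 1 2 by linarith
      qed
      show "integrable (lebesgue_on \<Omega>) (\<lambda>x. \<bar>f x\<bar> ^ Suc (Suc (2 * k)) - d * \<bar>f x\<bar> ^ Suc (2 * k))"
        by (intro Bochner_Integration.integrable_diff integrable_mult_right ai)
    qed (rule i2)
    also have "\<dots> = \<delta>t * ?A"
    proof -
      have "?A = (LINT x|lebesgue_on \<Omega>. (R x - \<rho>old x) * ?\<phi> x) / \<delta>t"
        by (simp del: power_Suc)
      then show ?thesis using pos(2) by simp
    qed
    also have "\<dots> \<le> 0" by (rule mult_nonneg_nonpos[OF less_imp_le[OF pos(2)] A])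
    finally show "(LINT x|lebesgue_on \<Omega>. \<bar>f x\<bar> ^ Suc (Suc (2 * k))) \<le> d * (LINT x|lebesgue_on \<Omega>. \<bar>f x\<bar> ^ Suc (2 * k))"
      using ai by (simp del: power_Suc)
  qed (use d0 in auto)
  then show ?thesis
    by eventually_elim (auto simp: f_def c_def d_def abs_le_iff field_simps)
qed

text \<open>The indicator of the set where \<open>\<rho>\<close> exceeds \<open>b\<close> is
  integrable and hence an admissible test function. In the limit, the nonnegative function
  \<open>\<rho> - b\<close> on that set has nonpositive integral, so it vanishes almost
  everywhere.\<close>

lemma weak_star_limit_le:
  assumes lim: "weak_star_limit \<Omega> R \<rho>" and b: "\<And>\<epsilon>. 0 < \<epsilon> \<Longrightarrow> AE x in lebesgue_on \<Omega>. R \<epsilon> x \<le> b"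
  shows "AE x in lebesgue_on \<Omega>. \<rho> x \<le> b"
proof -
  have rho: "\<rho> \<in> Linf \<Omega>" and RL: "\<And>\<epsilon>. 0 < \<epsilon> \<Longrightarrow> R \<epsilon> \<in> Linf \<Omega>" using lim by (auto simp: weak_star_limit_def)
  have [measurable]: "\<rho> \<in> borel_measurable (lebesgue_on \<Omega>)" by (rule LinfD(1)[OF rho])
  let ?\<psi> = "indicator {x \<in> space (lebesgue_on \<Omega>). b < \<rho> x} :: _ \<Rightarrow> real"
  have "{x \<in> space (lebesgue_on \<Omega>). b < \<rho> x} \<in> sets (lebesgue_on \<Omega>)" by measurable
  then have psiL: "?\<psi> \<in> Linf \<Omega>"
    by (intro LinfI[where C=1] borel_measurable_indicator AE_I2) (auto split: split_indicator)
  note psi = Linf_integrable[OF psiL]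
  note int = Linf_integrable[OF Linf_mult[OF rho psiL]]
  have "((\<lambda>\<epsilon>. LINT x|lebesgue_on \<Omega>. R \<epsilon> x * ?\<psi> x) \<longlongrightarrow> (LINT x|lebesgue_on \<Omega>. \<rho> x * ?\<psi> x)) (at_right 0)"
    using lim psi by (simp add: weak_star_limit_def)
  moreover have "\<forall>\<^sub>F \<epsilon> in at_right 0. (LINT x|lebesgue_on \<Omega>. R \<epsilon> x * ?\<psi> x) \<le> (LINT x|lebesgue_on \<Omega>. b * ?\<psi> x)"
    using eventually_at_right_less[of "0::real"]
  proof eventually_elim
    case (elim \<epsilon>)
    show ?case
    proof (rule integral_mono_AE[OF Linf_integrable[OF Linf_mult[OF RL[OF elim] psiL]] integrable_mult_right[OF psi]])
      show "AE x in lebesgue_on \<Omega>. R \<epsilon> x * ?\<psi> x \<le> b * ?\<psi> x"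
        using b[OF elim] by eventually_elim (auto simp: indicator_def)
    qed
  qed
  ultimately have "(LINT x|lebesgue_on \<Omega>. \<rho> x * ?\<psi> x) \<le> (LINT x|lebesgue_on \<Omega>. b * ?\<psi> x)"
    by (intro tendsto_upperbound) auto
  then have "(LINT x|lebesgue_on \<Omega>. (\<rho> x - b) * ?\<psi> x) \<le> 0"
    using int integrable_mult_right[OF psi, of b] by (simp add: left_diff_distrib)
  moreover have nn: "AE x in lebesgue_on \<Omega>. 0 \<le> (\<rho> x - b) * ?\<psi> x"
    by (rule AE_I2) (auto simp: indicator_def)
  ultimately have "(LINT x|lebesgue_on \<Omega>. (\<rho> x - b) * ?\<psi> x) = 0"
    using integral_nonneg_AE[OF nn] by linarith
  moreover have "integrable (lebesgue_on \<Omega>) (\<lambda>x. (\<rho> x - b) * ?\<psi> x)"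
    using int integrable_mult_right[OF psi, of b] by (simp add: left_diff_distrib)
  ultimately have "AE x in lebesgue_on \<Omega>. (\<rho> x - b) * ?\<psi> x = 0"
    using integral_nonneg_eq_0_iff_AE nn by blast
  with AE_space show ?thesis by eventually_elim (auto simp: indicator_def split: if_splits)
qed

lemma density_step_bounds:
  assumes step: "density_step \<Omega> \<delta>t w \<rho>old \<rho>" and "0 < \<delta>t" and w: "w \<in> L2 \<Omega>"
    and solenoidal: "\<And>\<phi>. \<phi> \<in> H1 \<Omega> \<Longrightarrow> (LINT x|lebesgue_on \<Omega>. w x \<bullet> wgrad \<Omega> \<phi> x) = 0"
    and old: "\<rho>old \<in> borel_measurable (lebesgue_on \<Omega>)" "AE x in lebesgue_on \<Omega>. \<rho>1 \<le> \<rho>old x \<and> \<rho>old x \<le> \<rho>2"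
  shows "\<rho> \<in> borel_measurable (lebesgue_on \<Omega>)" "AE x in lebesgue_on \<Omega>. \<rho>1 \<le> \<rho> x \<and> \<rho> x \<le> \<rho>2"
proof -
  obtain R where R: "\<And>\<epsilon>. 0 < \<epsilon> \<Longrightarrow> regularized_density \<Omega> \<delta>t w \<rho>old \<epsilon> (R \<epsilon>)" and lim: "weak_star_limit \<Omega> R \<rho>"
    using step by (auto simp: density_step_def)
  have RL: "R \<epsilon> \<in> Linf \<Omega>" if "0 < \<epsilon>" for \<epsilon> using lim that by (simp add: weak_star_limit_def)
  show "\<rho> \<in> borel_measurable (lebesgue_on \<Omega>)"
    using lim LinfD(1) by (auto simp: weak_star_limit_def)
  have b: "AE x in lebesgue_on \<Omega>. \<rho>1 \<le> R \<epsilon> x \<and> R \<epsilon> x \<le> \<rho>2" if "0 < \<epsilon>" for \<epsilon>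
    by (rule regularized_density_bounds[OF R[OF that] RL[OF that] that \<open>0 < \<delta>t\<close> w solenoidal old])
  have "AE x in lebesgue_on \<Omega>. \<rho> x \<le> \<rho>2"
    by (rule weak_star_limit_le[OF lim]) (use b in \<open>auto elim: eventually_mono\<close>)
  moreover have "AE x in lebesgue_on \<Omega>. - \<rho> x \<le> - \<rho>1"
    by (rule weak_star_limit_le[OF weak_star_limit_minus[OF lim]]) (use b in \<open>auto elim: eventually_mono\<close>)
  ultimately show "AE x in lebesgue_on \<Omega>. \<rho>1 \<le> \<rho> x \<and> \<rho> x \<le> \<rho>2" by eventually_elim auto
qed

end

subsection \<open>The energy estimate\<close>

lemma trace_transpose_mult: "trace (transpose A ** A) = (norm A)\<^sup>2" for A :: "real^3^3"
proof -
  have "trace (transpose A ** A) = (\<Sum>i\<in>UNIV. \<Sum>k\<in>UNIV. A $ k $ i * A $ k $ i)"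
    by (simp add: trace_def transpose_def matrix_matrix_mult_def)
  also have "\<dots> = (\<Sum>k\<in>UNIV. \<Sum>i\<in>UNIV. A $ k $ i * A $ k $ i)" by (rule sum.swap)
  finally show ?thesis by (simp add: power2_norm_eq_inner inner_vec_def)
qed

lemma tensor_norm_power2: "(tensor_norm A)\<^sup>2 = (norm A)\<^sup>2 / 2"
  by (simp add: tensor_norm_def trace_transpose_mult)

lemma inner_transpose: "transpose A \<bullet> B = A \<bullet> transpose B" for A B :: "real^3^3"
  unfolding inner_vec_def transpose_def by (simp, subst sum.swap, simp)

text \<open>The antisymmetric part of the Jacobian is Frobenius-orthogonal to symmetric
  matrices.\<close>

lemma symmetric_inner_wjac:
  assumes "transpose A = A"
  shows "A \<bullet> wjac \<Omega> u x = A \<bullet> symgrad \<Omega> u x"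
  using inner_transpose[of A "wjac \<Omega> u x"] assms by (simp add: symgrad_def inner_add_right)

lemma transpose_symgrad: "transpose (symgrad \<Omega> u x) = symgrad \<Omega> u x"
  by (simp add: symgrad_def transpose_def vec_eq_iff add.commute)

text \<open>\<open>Lam\<close> is a Frobenius ball of radius \<open>sqrt 2\<close> cut with the
  subspace of symmetric traceless matrices; the radius reflects the factor 1/2 in
  \<open>tensor_norm\<close>.\<close>

lemma Lam_properties: "convex Lam" "closed Lam" "0 \<in> Lam"
proof -
  let ?S = "{A :: real^3^3. transpose A = A \<and> trace A = 0}"
  have S: "subspace ?S"
    by (auto simp: subspace_def transpose_def trace_def vec_eq_iff sum.distrib simp flip: sum_distrib_left)
  have "tensor_norm A \<le> 1 \<longleftrightarrow> norm A \<le> sqrt 2" for A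
  proof -
    have "tensor_norm A \<le> 1 \<longleftrightarrow> (tensor_norm A)\<^sup>2 \<le> 1\<^sup>2"
      by (subst power_mono_iff) (auto simp: tensor_norm_def trace_transpose_mult)
    also have "\<dots> \<longleftrightarrow> (norm A)\<^sup>2 \<le> (sqrt 2)\<^sup>2" by (simp add: tensor_norm_power2)
    also have "\<dots> \<longleftrightarrow> norm A \<le> sqrt 2" by (subst power_mono_iff) auto
    finally show ?thesis .
  qed
  then have L: "Lam = cball 0 (sqrt 2) \<inter> ?S" by (intro set_eqI) (simp add: Lam_def)
  show "convex Lam" unfolding L by (intro convex_Int convex_cball subspace_imp_convex S)
  show "closed Lam" unfolding L by (intro closed_Int closed_cball closed_subspace S)
  show "0 \<in> Lam" unfolding L using subspace_0[OF S] by simp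
qed

text \<open>Comparing the projection with 0 leaves
  \<open>\<theta> (S - S0) \<bullet> S \<le> c (S \<bullet> D)\<close>. Young's inequality bounds
  \<open>(S - S0) \<bullet> S\<close> from below by half the difference of the squared norms, which
  is the telescoping quantity.\<close>

lemma proj_Lam_inequality:
  assumes S: "S = proj_Lam (S + c *\<^sub>R D + \<theta> *\<^sub>R (S0 - S))" and "0 \<le> \<theta>"
  shows "\<theta> / 2 * ((norm S)\<^sup>2 - (norm S0)\<^sup>2) \<le> c * (S \<bullet> D)"
proof -
  let ?Y = "S + c *\<^sub>R D + \<theta> *\<^sub>R (S0 - S)"
  have "(?Y - closest_point Lam ?Y) \<bullet> (0 - closest_point Lam ?Y) \<le> 0"
    by (rule closest_point_dot[OF Lam_properties])
  then have "(?Y - S) \<bullet> (0 - S) \<le> 0" using S by (simp add: proj_Lam_def)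
  then have 1: "\<theta> * ((norm S)\<^sup>2 - S0 \<bullet> S) \<le> c * (S \<bullet> D)"
    by (simp add: inner_simps power2_norm_eq_inner inner_commute algebra_simps)
  have "S0 \<bullet> S \<le> ((norm S)\<^sup>2 + (norm S0)\<^sup>2) / 2"
    using inner_ge_zero[of "S0 - S"]
    by (simp add: inner_simps power2_norm_eq_inner inner_commute field_simps)
  then have "\<theta> * (((norm S)\<^sup>2 - (norm S0)\<^sup>2) / 2) \<le> \<theta> * ((norm S)\<^sup>2 - S0 \<bullet> S)"
    using \<open>0 \<le> \<theta>\<close> by (intro mult_left_mono) (auto simp: field_simps)
  with 1 show ?thesis by simp
qed

lemma l2norm_power2: "(l2norm \<Omega> f)\<^sup>2 = (LINT x|lebesgue_on \<Omega>. (norm (f x))\<^sup>2)"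
  by (simp add: l2norm_def)

lemma tensor_l2norm_power2: "(tensor_l2norm \<Omega> f)\<^sup>2 = (LINT x|lebesgue_on \<Omega>. (norm (f x))\<^sup>2) / 2"
  by (simp add: tensor_l2norm_def tensor_norm_power2)

lemma tensorLam_L2: "S \<in> tensorLam \<Omega> \<Longrightarrow> S \<in> L2 \<Omega>"
  by (simp add: tensorLam_def)

lemma norm_diff_scaleR_power2:
  fixes x y :: "'a::real_inner"
  shows "(norm (x - c *\<^sub>R y))\<^sup>2 = x \<bullet> x - 2 * c * (y \<bullet> x) + c\<^sup>2 * (norm y)\<^sup>2"
  unfolding power2_norm_eq_inner
  by (simp add: inner_diff_left inner_diff_right inner_commute[of x y] power2_eq_square algebra_simps)

context bounded_open
begin

lemma weighted_square_integrable:
  assumes f: "f \<in> L2 \<Omega>" and c: "c \<in> Linf \<Omega>"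
  shows "integrable (lebesgue_on \<Omega>) (\<lambda>x. c x * (norm (f x))\<^sup>2)"
proof -
  obtain C where "AE x in lebesgue_on \<Omega>. \<bar>c x\<bar> \<le> C" using LinfD(2)[OF c] by blast
  from integrable_mult_bounded[OF L2D(2)[OF f] LinfD(1)[OF c] this]
  show ?thesis by (simp add: mult.commute)
qed

lemma integral_sqrt_weight:
  assumes f: "f \<in> L2 \<Omega>" and c: "c \<in> Linf \<Omega>" "AE x in lebesgue_on \<Omega>. 0 \<le> c x"
  shows "(LINT x|lebesgue_on \<Omega>. (norm (sqrt (c x) *\<^sub>R f x))\<^sup>2) = (LINT x|lebesgue_on \<Omega>. c x * (norm (f x))\<^sup>2)"
proof (rule integral_cong_AE)
  have [measurable]: "f \<in> borel_measurable (lebesgue_on \<Omega>)" "c \<in> borel_measurable (lebesgue_on \<Omega>)"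
    using L2D(1)[OF f] LinfD(1)[OF c(1)] .
  show "(\<lambda>x. (norm (sqrt (c x) *\<^sub>R f x))\<^sup>2) \<in> borel_measurable (lebesgue_on \<Omega>)" by measurable
  show "(\<lambda>x. c x * (norm (f x))\<^sup>2) \<in> borel_measurable (lebesgue_on \<Omega>)" by measurable
  show "AE x in lebesgue_on \<Omega>. (norm (sqrt (c x) *\<^sub>R f x))\<^sup>2 = c x * (norm (f x))\<^sup>2"
    using c(2) by eventually_elim (simp add: power_mult_distrib)
qed

text \<open>The coefficient \<open>m\<close> is continuous only on the interval and may be arbitrary
  outside. Composition is therefore done with its cut-off, which is Borel, and the result is
  transferred along almost everywhere equality.\<close>

lemma coefficient_Linf:
  fixes a b :: real
  assumes cont: "continuous_on {a..b} m" and rho: "\<rho> \<in> borel_measurable (lebesgue_on \<Omega>)"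
    "AE x in lebesgue_on \<Omega>. a \<le> \<rho> x \<and> \<rho> x \<le> b"
    and bd: "\<forall>s\<in>{a..b}. 0 \<le> m s \<and> m s \<le> C"
  shows "(\<lambda>x. m (\<rho> x)) \<in> Linf \<Omega>" "AE x in lebesgue_on \<Omega>. 0 \<le> m (\<rho> x)"
proof -
  show "AE x in lebesgue_on \<Omega>. 0 \<le> m (\<rho> x)"
    using rho(2) by eventually_elim (use bd in auto)
  have "(\<lambda>s. indicator {a..b} s *\<^sub>R m s) \<in> borel_measurable borel"
    by (rule borel_measurable_continuous_on_indicator[OF _ cont]) simp
  from measurable_compose[OF rho(1) this]
  have "(\<lambda>x. indicator {a..b} (\<rho> x) *\<^sub>R m (\<rho> x)) \<in> borel_measurable (lebesgue_on \<Omega>)" .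
  then have "(\<lambda>x. m (\<rho> x)) \<in> borel_measurable (lebesgue_on \<Omega>)"
  proof (rule borel_measurable_lebesgue_on_AE[OF \<Omega>_sets(1)])
    show "AE x in lebesgue_on \<Omega>. indicator {a..b} (\<rho> x) *\<^sub>R m (\<rho> x) = m (\<rho> x)"
      using rho(2) by eventually_elim simp
  qed
  then show "(\<lambda>x. m (\<rho> x)) \<in> Linf \<Omega>"
  proof (rule LinfI)
    show "AE x in lebesgue_on \<Omega>. \<bar>m (\<rho> x)\<bar> \<le> C"
      using rho(2) by eventually_elim (use bd in auto)
  qed
qed

lemma bounded_Linf:
  assumes "\<rho> \<in> borel_measurable (lebesgue_on \<Omega>)" "AE x in lebesgue_on \<Omega>. a \<le> \<rho> x \<and> \<rho> x \<le> b"
  shows "\<rho> \<in> Linf \<Omega>"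
  by (rule LinfI[OF assms(1), where C="\<bar>a\<bar> + \<bar>b\<bar>"]) (use assms(2) in \<open>eventually_elim, auto\<close>)

lemma integral_inner_cong_AE:
  assumes "f \<in> L2 \<Omega>" "g \<in> L2 \<Omega>" "ae_eq \<Omega> f f'"
  shows "(LINT x|lebesgue_on \<Omega>. f' x \<bullet> g x) = (LINT x|lebesgue_on \<Omega>. f x \<bullet> g x)"
proof (rule integral_cong_AE)
  show "AE x in lebesgue_on \<Omega>. f' x \<bullet> g x = f x \<bullet> g x"
    using assms(3) unfolding ae_eq_def by eventually_elim simp
qed (use L2_inner_integrable[OF assms(1,2)] L2_inner_integrable[OF L2_cong_AE[OF assms(1,3)] assms(2)] in auto)

text \<open>This is the projection inequality with \<open>c = r * a x\<close>, divided by
  \<open>r\<close> and integrated. Since the stress is symmetric, \<open>symgrad\<close> may be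
  replaced by the full Jacobian, against which the momentum equation tests.\<close>

lemma plastic_dissipation:
  assumes S: "S \<in> tensorLam \<Omega>" "S' \<in> tensorLam \<Omega>" and u: "u \<in> vecH10 \<Omega>" and a: "a \<in> Linf \<Omega>"
    and proj: "ae_eq \<Omega> S' (\<lambda>x. proj_Lam (S' x + (r * a x) *\<^sub>R symgrad \<Omega> u x + \<theta> *\<^sub>R (S x - S' x)))"
    and pos: "0 < r" "0 \<le> \<theta>"
  shows "\<theta> / (2 * r) * ((LINT x|lebesgue_on \<Omega>. (norm (S' x))\<^sup>2) - (LINT x|lebesgue_on \<Omega>. (norm (S x))\<^sup>2))
    \<le> (LINT x|lebesgue_on \<Omega>. (a x *\<^sub>R S' x) \<bullet> wjac \<Omega> u x)"
proof -
  note S2 = tensorLam_L2[OF S(1)] tensorLam_L2[OF S(2)]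
  obtain C where C: "AE x in lebesgue_on \<Omega>. \<bar>a x\<bar> \<le> C" using LinfD(2)[OF a] by blast
  have sym: "AE x in lebesgue_on \<Omega>. transpose (S' x) = S' x"
    using S(2) by (auto simp: tensorLam_def Lam_def elim: eventually_mono)
  have "(LINT x|lebesgue_on \<Omega>. \<theta> / (2 * r) * ((norm (S' x))\<^sup>2 - (norm (S x))\<^sup>2))
      \<le> (LINT x|lebesgue_on \<Omega>. (a x *\<^sub>R S' x) \<bullet> wjac \<Omega> u x)"
  proof (rule integral_mono_AE)
    show "integrable (lebesgue_on \<Omega>) (\<lambda>x. (a x *\<^sub>R S' x) \<bullet> wjac \<Omega> u x)"
      by (rule L2_inner_integrable[OF L2_scaleR_bounded[OF S2(2) LinfD(1)[OF a] C] vecH10D(4)[OF u]])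
    show "integrable (lebesgue_on \<Omega>) (\<lambda>x. \<theta> / (2 * r) * ((norm (S' x))\<^sup>2 - (norm (S x))\<^sup>2))"
      using L2D(2)[OF S2(1)] L2D(2)[OF S2(2)] by auto
    show "AE x in lebesgue_on \<Omega>. \<theta> / (2 * r) * ((norm (S' x))\<^sup>2 - (norm (S x))\<^sup>2) \<le> (a x *\<^sub>R S' x) \<bullet> wjac \<Omega> u x"
      using sym proj unfolding ae_eq_def
    proof eventually_elim
      case (elim x)
      have "\<theta> / 2 * ((norm (S' x))\<^sup>2 - (norm (S x))\<^sup>2) \<le> r * a x * (S' x \<bullet> symgrad \<Omega> u x)"
        by (rule proj_Lam_inequality[OF elim(2) pos(2)])
      then have "\<theta> / 2 * ((norm (S' x))\<^sup>2 - (norm (S x))\<^sup>2) / r \<le> r * a x * (S' x \<bullet> symgrad \<Omega> u x) / r"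
        using pos(1) by (intro divide_right_mono) auto
      then show ?case using pos(1) symmetric_inner_wjac[OF elim(1), of \<Omega> u x] by simp
    qed
  qed
  then show ?thesis using L2D(2)[OF S2(1)] L2D(2)[OF S2(2)] by simp
qed

text \<open>Testing the Poisson problem for \<open>q'\<close> with \<open>p + q\<close> turns the
  pressure work, times \<open>\<kappa>\<close>, into the inner products of the gradient of
  \<open>q'\<close> with those of \<open>p\<close> and \<open>q\<close>. Expanding the squared
  gradient of \<open>p + q'\<close> then leaves the squared gradient of \<open>q' - q\<close> minus
  that of \<open>q\<close>. The first is at most \<open>\<kappa>\<^sup>2\<close> times the squared
  norm of \<open>u' - u\<close>; the second has a favourable sign.\<close>

lemma pressure_work:
  assumes u: "u \<in> L2 \<Omega>" "u' \<in> L2 \<Omega>"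
    and H: "p \<in> H1 \<Omega>" "q \<in> H1 \<Omega>" "q' \<in> H1 \<Omega>" and p': "ae_eq \<Omega> p' (\<lambda>x. p x + q' x)"
    and pos: "0 < \<kappa>"
    and orth: "\<And>\<phi>. \<phi> \<in> H1 \<Omega> \<Longrightarrow>
      (LINT x|lebesgue_on \<Omega>. wgrad \<Omega> q x \<bullet> wgrad \<Omega> \<phi> x) = \<kappa> * (LINT x|lebesgue_on \<Omega>. u x \<bullet> wgrad \<Omega> \<phi> x)"
    and orth': "\<And>\<phi>. \<phi> \<in> H1 \<Omega> \<Longrightarrow>
      (LINT x|lebesgue_on \<Omega>. wgrad \<Omega> q' x \<bullet> wgrad \<Omega> \<phi> x) = \<kappa> * (LINT x|lebesgue_on \<Omega>. u' x \<bullet> wgrad \<Omega> \<phi> x)"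
  shows "(LINT x|lebesgue_on \<Omega>. (norm (wgrad \<Omega> p' x))\<^sup>2) - (LINT x|lebesgue_on \<Omega>. (norm (wgrad \<Omega> p x))\<^sup>2)
      \<le> 2 * \<kappa> * (LINT x|lebesgue_on \<Omega>. wgrad \<Omega> (\<lambda>x. p x + q x) x \<bullet> u' x)
        + \<kappa>\<^sup>2 * (LINT x|lebesgue_on \<Omega>. (norm (u' x - u x))\<^sup>2)"
proof -
  let ?I = "\<lambda>f. LINT x|lebesgue_on \<Omega>. f x"
  let ?gp = "wgrad \<Omega> p" and ?gq = "wgrad \<Omega> q" and ?gq' = "wgrad \<Omega> q'"
  note g = wgrad_L2[OF H(1)] wgrad_L2[OF H(2)] wgrad_L2[OF H(3)]
  note i = L2_inner_integrable
  note gi [simp] = i[OF g(1) g(1)] i[OF g(1) g(2)] i[OF g(1) g(3)] i[OF g(2) g(2)] i[OF g(2) g(3)] i[OF g(3) g(3)]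
    i[OF u(1) g(1)] i[OF u(1) g(2)] i[OF u(1) g(3)] i[OF u(2) g(1)] i[OF u(2) g(2)] i[OF u(2) g(3)]
    i[OF u(1) u(1)] i[OF u(1) u(2)] i[OF u(2) u(2)]
  define P Q' X Y Q U where "P = (LINT x|lebesgue_on \<Omega>. ?gp x \<bullet> ?gp x)" and "Q' = (LINT x|lebesgue_on \<Omega>. ?gq' x \<bullet> ?gq' x)"
    and "X = (LINT x|lebesgue_on \<Omega>. ?gp x \<bullet> ?gq' x)" and "Y = (LINT x|lebesgue_on \<Omega>. ?gq x \<bullet> ?gq' x)"
    and "Q = (LINT x|lebesgue_on \<Omega>. ?gq x \<bullet> ?gq x)" and "U = (LINT x|lebesgue_on \<Omega>. (norm (u' x - u x))\<^sup>2)"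
  have P': "(LINT x|lebesgue_on \<Omega>. (norm (wgrad \<Omega> p' x))\<^sup>2) = P + 2 * X + Q'"
  proof -
    have h: "p' \<in> H1 \<Omega>" "ae_eq \<Omega> (wgrad \<Omega> p') (\<lambda>x. ?gp x + ?gq' x)"
      using H1_cong_AE[OF H1_add(1)[OF H(1,3)] ae_eq_sym[OF p']] H1_add(2)[OF H(1,3)] ae_eq_trans by blast+
    have "(LINT x|lebesgue_on \<Omega>. (norm (wgrad \<Omega> p' x))\<^sup>2)
        = (LINT x|lebesgue_on \<Omega>. ?gp x \<bullet> ?gp x + 2 * (?gp x \<bullet> ?gq' x) + ?gq' x \<bullet> ?gq' x)"
    proof (rule integral_cong_AE)
      show "AE x in lebesgue_on \<Omega>. (norm (wgrad \<Omega> p' x))\<^sup>2 = ?gp x \<bullet> ?gp x + 2 * (?gp x \<bullet> ?gq' x) + ?gq' x \<bullet> ?gq' x"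
        using h(2) unfolding ae_eq_def
        by eventually_elim (simp add: power2_norm_eq_inner inner_simps inner_commute)
      show "(\<lambda>x. (norm (wgrad \<Omega> p' x))\<^sup>2) \<in> borel_measurable (lebesgue_on \<Omega>)"
        using L2D(2)[OF wgrad_L2[OF h(1)]] by (rule borel_measurable_integrable)
    qed (intro borel_measurable_integrable Bochner_Integration.integrable_add integrable_mult_right gi)
    then show ?thesis by (simp add: P_def X_def Q'_def)
  qed
  have P: "(LINT x|lebesgue_on \<Omega>. (norm (?gp x))\<^sup>2) = P" by (simp add: P_def power2_norm_eq_inner)
  have W: "\<kappa> * (LINT x|lebesgue_on \<Omega>. wgrad \<Omega> (\<lambda>x. p x + q x) x \<bullet> u' x) = X + Y"
  proof -
    have "\<kappa> * (LINT x|lebesgue_on \<Omega>. wgrad \<Omega> (\<lambda>x. p x + q x) x \<bullet> u' x)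
        = (LINT x|lebesgue_on \<Omega>. ?gq' x \<bullet> wgrad \<Omega> (\<lambda>x. p x + q x) x)"
      using orth'[OF H1_add(1)[OF H(1,2)]] by (simp add: inner_commute)
    also have "\<dots> = (LINT x|lebesgue_on \<Omega>. wgrad \<Omega> (\<lambda>x. p x + q x) x \<bullet> ?gq' x)"
      by (simp add: inner_commute)
    also have "\<dots> = (LINT x|lebesgue_on \<Omega>. (?gp x + ?gq x) \<bullet> ?gq' x)"
      by (rule integral_inner_cong_AE[OF L2_add[OF g(1,2)] g(3) ae_eq_sym[OF H1_add(2)[OF H(1,2)]]])
    also have "\<dots> = X + Y" by (simp add: X_def Y_def inner_add_left)
    finally show ?thesis .
  qed
  \<comment> \<open>The contraction property of the projection onto gradients follows from one
    nonnegative square: the orthogonality relations make the cross term minus twice the squared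
    gradient of \<open>q' - q\<close>. Both problems, each tested with both functions, are needed,
    which is why \<open>Y\<close> occurs twice in \<open>o\<close>.\<close>
  have Z: "Q' - 2 * Y + Q \<le> \<kappa>\<^sup>2 * U"
  proof -
    define a b c d where "a = (LINT x|lebesgue_on \<Omega>. u' x \<bullet> ?gq' x)" and "b = (LINT x|lebesgue_on \<Omega>. u' x \<bullet> ?gq x)"
      and "c = (LINT x|lebesgue_on \<Omega>. u x \<bullet> ?gq' x)" and "d = (LINT x|lebesgue_on \<Omega>. u x \<bullet> ?gq x)"
    have o: "Q' = \<kappa> * a" "Y = \<kappa> * b" "Y = \<kappa> * c" "Q = \<kappa> * d"
      using orth'[OF H(3)] orth'[OF H(2)] orth[OF H(3)] orth[OF H(2)]
      by (simp_all add: Q'_def Y_def Q_def a_def b_def c_def d_def inner_commute)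
    have U: "integrable (lebesgue_on \<Omega>) (\<lambda>x. (norm (u' x - u x))\<^sup>2)"
      by (rule L2D(2)[OF L2_diff[OF u(2,1)]])
    have "0 \<le> (LINT x|lebesgue_on \<Omega>. (norm ((?gq' x - ?gq x) - \<kappa> *\<^sub>R (u' x - u x)))\<^sup>2)" by simp
    also have "\<dots> = (LINT x|lebesgue_on \<Omega>. ?gq' x \<bullet> ?gq' x - 2 * (?gq x \<bullet> ?gq' x) + ?gq x \<bullet> ?gq x
        - 2 * \<kappa> * (u' x \<bullet> ?gq' x - u' x \<bullet> ?gq x - u x \<bullet> ?gq' x + u x \<bullet> ?gq x)
        + \<kappa>\<^sup>2 * (norm (u' x - u x))\<^sup>2)"
    proof (intro Bochner_Integration.integral_cong refl)
      fix x
      let ?X = "?gq' x - ?gq x" and ?D = "u' x - u x"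
      have "(norm (?X - \<kappa> *\<^sub>R ?D))\<^sup>2 = ?X \<bullet> ?X - 2 * \<kappa> * (?D \<bullet> ?X) + \<kappa>\<^sup>2 * (norm ?D)\<^sup>2"
        by (rule norm_diff_scaleR_power2)
      also have "?X \<bullet> ?X = ?gq' x \<bullet> ?gq' x - 2 * (?gq x \<bullet> ?gq' x) + ?gq x \<bullet> ?gq x"
        by (simp add: inner_diff_left inner_diff_right inner_commute)
      also have "?D \<bullet> ?X = u' x \<bullet> ?gq' x - u' x \<bullet> ?gq x - u x \<bullet> ?gq' x + u x \<bullet> ?gq x"
        by (simp add: inner_diff_left inner_diff_right)
      finally show "(norm (?X - \<kappa> *\<^sub>R ?D))\<^sup>2 = ?gq' x \<bullet> ?gq' x - 2 * (?gq x \<bullet> ?gq' x) + ?gq x \<bullet> ?gq x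
        - 2 * \<kappa> * (u' x \<bullet> ?gq' x - u' x \<bullet> ?gq x - u x \<bullet> ?gq' x + u x \<bullet> ?gq x)
        + \<kappa>\<^sup>2 * (norm (u' x - u x))\<^sup>2" .
    qed
    also have "\<dots> = Q' - 2 * Y + Q - 2 * \<kappa> * (a - b - c + d) + \<kappa>\<^sup>2 * U"
      using U by (simp add: Q'_def Y_def Q_def a_def b_def c_def d_def U_def)
    also have "2 * \<kappa> * (a - b - c + d) = 2 * (\<kappa> * a - \<kappa> * b - \<kappa> * c + \<kappa> * d)"
      by (simp add: algebra_simps)
    also have "\<dots> = 2 * (Q' - Y - Y + Q)" by (simp only: o[symmetric])
    finally show ?thesis by simp
  qed
  have "0 \<le> Q" by (simp add: Q_def)
  then show ?thesis
    using P P' W Z unfolding U_def[symmetric] by (simp add: algebra_simps)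
qed

text \<open>With \<open>\<kappa> = \<rho>1 / \<delta>t\<close>, the weight
  \<open>\<delta>t\<^sup>2 / \<rho>1\<close> turns \<open>2 \<kappa> W\<close> into
  \<open>2 \<delta>t W\<close>, the pressure work in the tested equation. It turns the remainder
  \<open>\<kappa>\<^sup>2 U\<close> into \<open>\<rho>1 U\<close>, which is exactly what the
  inertial gain \<open>B\<close> can pay for. This fixes the weight of the pressure in the
  energy.\<close>

lemma energy_step:
  assumes pos: "0 < \<delta>t" "0 < r" "0 \<le> \<theta>" "0 < \<rho>1"
    and rho: "\<rho> \<in> borel_measurable (lebesgue_on \<Omega>)" "AE x in lebesgue_on \<Omega>. \<rho>1 \<le> \<rho> x \<and> \<rho> x \<le> \<rho>2"
    and rho': "\<rho>' \<in> borel_measurable (lebesgue_on \<Omega>)" "AE x in lebesgue_on \<Omega>. \<rho>1 \<le> \<rho>' x \<and> \<rho>' x \<le> \<rho>2"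
    and m: "m \<in> Linf \<Omega>" "AE x in lebesgue_on \<Omega>. 0 \<le> m x" and a: "a \<in> Linf \<Omega>"
    and u: "u \<in> L2 \<Omega>" "u' \<in> vecH10 \<Omega>" and S: "S \<in> tensorLam \<Omega>" "S' \<in> tensorLam \<Omega>"
    and H: "p \<in> H1 \<Omega>" "q \<in> H1 \<Omega>" "q' \<in> H1 \<Omega>" and p': "ae_eq \<Omega> p' (\<lambda>x. p x + q' x)"
    and momentum: "momentum_equation \<Omega> \<delta>t \<rho> \<rho>' u w (\<lambda>x. p x + q x) m a u' S'"
    and proj: "ae_eq \<Omega> S' (\<lambda>x. proj_Lam (S' x + (r * a x) *\<^sub>R symgrad \<Omega> u' x + \<theta> *\<^sub>R (S x - S' x)))"
    and orth: "\<And>\<phi>. \<phi> \<in> H1 \<Omega> \<Longrightarrow>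
      (LINT x|lebesgue_on \<Omega>. wgrad \<Omega> q x \<bullet> wgrad \<Omega> \<phi> x) = \<rho>1 / \<delta>t * (LINT x|lebesgue_on \<Omega>. u x \<bullet> wgrad \<Omega> \<phi> x)"
    and orth': "\<And>\<phi>. \<phi> \<in> H1 \<Omega> \<Longrightarrow>
      (LINT x|lebesgue_on \<Omega>. wgrad \<Omega> q' x \<bullet> wgrad \<Omega> \<phi> x) = \<rho>1 / \<delta>t * (LINT x|lebesgue_on \<Omega>. u' x \<bullet> wgrad \<Omega> \<phi> x)"
  shows "(l2norm \<Omega> (\<lambda>x. sqrt (\<rho>' x) *\<^sub>R u' x))\<^sup>2
      + \<delta>t * (tensor_l2norm \<Omega> (\<lambda>x. sqrt (2 * m x) *\<^sub>R symgrad \<Omega> u' x))\<^sup>2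
      + \<delta>t\<^sup>2 / \<rho>1 * (l2norm \<Omega> (wgrad \<Omega> p'))\<^sup>2 + 2 * \<theta> / r * \<delta>t * (tensor_l2norm \<Omega> S')\<^sup>2
    \<le> (l2norm \<Omega> (\<lambda>x. sqrt (\<rho> x) *\<^sub>R u x))\<^sup>2
      + \<delta>t\<^sup>2 / \<rho>1 * (l2norm \<Omega> (wgrad \<Omega> p))\<^sup>2 + 2 * \<theta> / r * \<delta>t * (tensor_l2norm \<Omega> S)\<^sup>2"
proof -
  note u'2 = vecH10D(3)[OF u(2)]
  note rL = bounded_Linf[OF rho] and rL' = bounded_Linf[OF rho']
  note du = L2_diff[OF u'2 u(1)]
  define A where "A = (LINT x|lebesgue_on \<Omega>. \<rho> x * (norm (u x))\<^sup>2)"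
  define A' where "A' = (LINT x|lebesgue_on \<Omega>. \<rho>' x * (norm (u' x))\<^sup>2)"
  define B where "B = (LINT x|lebesgue_on \<Omega>. \<rho> x * (norm (u' x - u x))\<^sup>2)"
  define U where "U = (LINT x|lebesgue_on \<Omega>. (norm (u' x - u x))\<^sup>2)"
  define V where "V = (LINT x|lebesgue_on \<Omega>. (2 * m x) * (norm (symgrad \<Omega> u' x))\<^sup>2)"
  define W where "W = (LINT x|lebesgue_on \<Omega>. wgrad \<Omega> (\<lambda>x. p x + q x) x \<bullet> u' x)"
  define K where "K = (LINT x|lebesgue_on \<Omega>. (a x *\<^sub>R S' x) \<bullet> wjac \<Omega> u' x)"
  define P where "P = (LINT x|lebesgue_on \<Omega>. (norm (wgrad \<Omega> p x))\<^sup>2)"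
  define P' where "P' = (LINT x|lebesgue_on \<Omega>. (norm (wgrad \<Omega> p' x))\<^sup>2)"
  define s where "s = (LINT x|lebesgue_on \<Omega>. (norm (S x))\<^sup>2)"
  define s' where "s' = (LINT x|lebesgue_on \<Omega>. (norm (S' x))\<^sup>2)"
  have inertia: "2 * (LINT x|lebesgue_on \<Omega>. ((1/2 * (\<rho>' x + \<rho> x)) *\<^sub>R u' x - \<rho> x *\<^sub>R u x) \<bullet> u' x) = A' - A + B"
  proof -
    have "2 * (LINT x|lebesgue_on \<Omega>. ((1/2 * (\<rho>' x + \<rho> x)) *\<^sub>R u' x - \<rho> x *\<^sub>R u x) \<bullet> u' x)
      = (LINT x|lebesgue_on \<Omega>. 2 * (((1/2 * (\<rho>' x + \<rho> x)) *\<^sub>R u' x - \<rho> x *\<^sub>R u x) \<bullet> u' x))"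
      by simp
    \<comment> \<open>The average of the two densities in the scheme is chosen so that completing
      the square with weight \<open>\<rho>\<close> leaves \<open>\<rho>'\<close> on the new kinetic
      energy and \<open>\<rho>\<close> on the old one.\<close>
    also have "\<dots> = (LINT x|lebesgue_on \<Omega>. \<rho>' x * (norm (u' x))\<^sup>2 - \<rho> x * (norm (u x))\<^sup>2 + \<rho> x * (norm (u' x - u x))\<^sup>2)"
      by (intro Bochner_Integration.integral_cong refl)
        (simp add: power2_norm_eq_inner inner_simps inner_commute algebra_simps)
    also have "\<dots> = A' - A + B"
      using weighted_square_integrable[OF u(1) rL] weighted_square_integrable[OF u'2 rL'] weighted_square_integrable[OF du rL]
      by (simp add: A_def A'_def B_def)
    finally show ?thesis .
  qed
  have viscous: "(LINT x|lebesgue_on \<Omega>. ((2 * m x) *\<^sub>R symgrad \<Omega> u' x) \<bullet> wjac \<Omega> u' x) = V"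
    by (simp add: V_def symmetric_inner_wjac[OF transpose_symgrad] power2_norm_eq_inner)
  have eq: "1 / \<delta>t * ((A' - A + B) / 2) + V + W = - K"
  proof -
    have b: "Btilde_integrable \<Omega> w u' u'" and e: "1 / \<delta>t * (LINT x|lebesgue_on \<Omega>.
           ((1/2 * (\<rho>' x + \<rho> x)) *\<^sub>R u' x - \<rho> x *\<^sub>R u x) \<bullet> u' x)
        + Btilde \<Omega> w u' u' + V + W = - K"
      using momentum u(2) viscous unfolding momentum_equation_def W_def K_def by auto
    define J where "J = (LINT x|lebesgue_on \<Omega>. ((1/2 * (\<rho>' x + \<rho> x)) *\<^sub>R u' x - \<rho> x *\<^sub>R u x) \<bullet> u' x)"
    have "J = (A' - A + B) / 2" using inertia[folded J_def] by simp
    with e[folded J_def] show ?thesis using Btilde_self[OF u(2) b] by simp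
  qed
  have "2 * (\<rho>1 / \<delta>t) * W \<ge> P' - P - (\<rho>1 / \<delta>t)\<^sup>2 * U"
    using pressure_work[OF u(1) u'2 H p' _ orth orth'] pos unfolding P_def P'_def W_def U_def by simp
  then have "\<delta>t\<^sup>2 / \<rho>1 * (P' - P - (\<rho>1 / \<delta>t)\<^sup>2 * U) \<le> \<delta>t\<^sup>2 / \<rho>1 * (2 * (\<rho>1 / \<delta>t) * W)"
    using pos by (intro mult_left_mono) auto
  moreover have "\<delta>t\<^sup>2 / \<rho>1 * (P' - P - (\<rho>1 / \<delta>t)\<^sup>2 * U) = \<delta>t\<^sup>2 / \<rho>1 * (P' - P) - \<rho>1 * U"
    and "\<delta>t\<^sup>2 / \<rho>1 * (2 * (\<rho>1 / \<delta>t) * W) = 2 * \<delta>t * W"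
    using pos by (simp_all add: field_simps power2_eq_square)
  ultimately have pressure: "\<delta>t\<^sup>2 / \<rho>1 * (P' - P) - \<rho>1 * U \<le> 2 * \<delta>t * W" by simp
  have increment: "\<rho>1 * U \<le> B"
  proof -
    have "(LINT x|lebesgue_on \<Omega>. \<rho>1 * (norm (u' x - u x))\<^sup>2) \<le> B"
      unfolding B_def
    proof (rule integral_mono_AE)
      show "AE x in lebesgue_on \<Omega>. \<rho>1 * (norm (u' x - u x))\<^sup>2 \<le> \<rho> x * (norm (u' x - u x))\<^sup>2"
        using rho(2) by eventually_elim (intro mult_right_mono, auto)
    qed (use L2D(2)[OF du] weighted_square_integrable[OF du rL] in auto)
    then show ?thesis by (simp add: U_def)
  qed
  have plastic: "\<theta> / (2 * r) * (s' - s) \<le> K"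
    unfolding s_def s'_def K_def by (rule plastic_dissipation[OF S u(2) a proj pos(2,3)])
  have "AE x in lebesgue_on \<Omega>. 0 \<le> 2 * m x" using m(2) by eventually_elim simp
  note m2 = Linf_mult[OF LinfI[of "\<lambda>x. 2" \<Omega> 2] m(1)] this
  have V0: "0 \<le> V"
    unfolding V_def by (rule integral_nonneg_AE) (use m2(2) in \<open>eventually_elim, simp\<close>)
  have nonneg: "AE x in lebesgue_on \<Omega>. 0 \<le> \<sigma> x" if "AE x in lebesgue_on \<Omega>. \<rho>1 \<le> \<sigma> x \<and> \<sigma> x \<le> \<rho>2" for \<sigma>
    using that by eventually_elim (use pos(4) in linarith)
  have n1: "(l2norm \<Omega> (\<lambda>x. sqrt (\<rho>' x) *\<^sub>R u' x))\<^sup>2 = A'" "(l2norm \<Omega> (\<lambda>x. sqrt (\<rho> x) *\<^sub>R u x))\<^sup>2 = A"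
    unfolding l2norm_power2 A_def A'_def
    using integral_sqrt_weight[OF u'2 rL' nonneg[OF rho'(2)]] integral_sqrt_weight[OF u(1) rL nonneg[OF rho(2)]]
    by auto
  \<comment> \<open>\<open>V\<close> is written with the Frobenius norm, whose square is twice that
    of \<open>tensor_norm\<close>.\<close>
  have n2: "(tensor_l2norm \<Omega> (\<lambda>x. sqrt (2 * m x) *\<^sub>R symgrad \<Omega> u' x))\<^sup>2 = V / 2"
    unfolding tensor_l2norm_power2 V_def
    using integral_sqrt_weight[OF vecH10D(5)[OF u(2)] m2] by simp
  have "2 * \<delta>t * (1 / \<delta>t * ((A' - A + B) / 2) + V + W) = 2 * \<delta>t * (- K)" by (simp only: eq)
  moreover have "2 * \<delta>t * (1 / \<delta>t * ((A' - A + B) / 2)) = A' - A + B" using pos(1) by simp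
  ultimately have "A' - A + B + 2 * \<delta>t * V + 2 * \<delta>t * W + 2 * \<delta>t * K = 0"
    by (simp only: distrib_left mult_minus_right)
  moreover have "2 * \<delta>t * (\<theta> / (2 * r) * (s' - s)) \<le> 2 * \<delta>t * K"
    using plastic pos(1) by (intro mult_left_mono) auto
  \<comment> \<open>The halves of \<open>s'\<close> and \<open>s\<close> are the squared tensor
    norms; this explains the constant \<open>2 * \<theta> / r\<close> in the energy.\<close>
  moreover have "2 * \<delta>t * (\<theta> / (2 * r) * (s' - s)) = 2 * \<theta> / r * \<delta>t * (s' / 2) - 2 * \<theta> / r * \<delta>t * (s / 2)"
    using pos(2) by (simp add: field_simps)
  \<comment> \<open>The tested equation supplies \<open>2 * \<delta>t * V\<close>, while the
    dissipation in the tensor norm amounts to \<open>\<delta>t * (V / 2)\<close>.\<close>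
  moreover have "\<delta>t * (V / 2) \<le> 2 * \<delta>t * V" using V0 pos(1) by simp
  ultimately have "A' + \<delta>t * (V / 2) + \<delta>t\<^sup>2 / \<rho>1 * P' + 2 * \<theta> / r * \<delta>t * (s' / 2)
      \<le> A + \<delta>t\<^sup>2 / \<rho>1 * P + 2 * \<theta> / r * \<delta>t * (s / 2)"
    using pressure increment by (simp only: right_diff_distrib)
  then show ?thesis
    unfolding n1 n2 unfolding l2norm_power2 tensor_l2norm_power2
    by (simp only: P_def P'_def s_def s'_def)
qed

text \<open>This starts the induction: the first density step is driven by the initial velocity,
  which has undergone no correction.\<close>

lemma solenoidal_orthogonal:
  assumes u: "u \<in> vecH10 \<Omega>" and 0: "AE x in lebesgue_on \<Omega>. wdiv \<Omega> u x = 0" and f: "f \<in> H1 \<Omega>"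
  shows "(LINT x|lebesgue_on \<Omega>. u x \<bullet> wgrad \<Omega> f x) = 0"
proof -
  have "AE x in lebesgue_on \<Omega>. wdiv \<Omega> u x * f x = 0" using 0 by eventually_elim simp
  then have "(LINT x|lebesgue_on \<Omega>. wdiv \<Omega> u x * f x) = 0" by (rule integral_eq_zero_AE)
  then show ?thesis using vecH10_by_parts[OF u f] by simp
qed

text \<open>Both sides equal minus \<open>c\<close> times the integral of \<open>f\<close> against
  the divergence. Removing the divergence states that the gradient of \<open>q\<close> is
  \<open>c\<close> times the gradient part of \<open>u\<close>, the form in which the pressure
  estimate uses it.\<close>

lemma neumann_poisson_orthogonal:
  assumes "neumann_poisson \<Omega> (\<lambda>x. c * wdiv \<Omega> u x) q" and u: "u \<in> vecH10 \<Omega>" and f: "f \<in> H1 \<Omega>"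
  shows "(LINT x|lebesgue_on \<Omega>. wgrad \<Omega> q x \<bullet> wgrad \<Omega> f x) = c * (LINT x|lebesgue_on \<Omega>. u x \<bullet> wgrad \<Omega> f x)"
  using assms(1) f vecH10_by_parts[OF u f] by (simp add: neumann_poisson_def mult.assoc)

text \<open>The correction removes precisely the gradient part of \<open>u\<close>, because its
  factor \<open>\<delta>t / \<rho>1\<close> is the inverse of the factor
  \<open>\<rho>1 / \<delta>t\<close> in the Poisson problem.\<close>

lemma corrected_velocity_orthogonal:
  assumes u: "u \<in> L2 \<Omega>" and q: "q \<in> H1 \<Omega>" and c: "c * \<kappa> = 1"
    and v: "ae_eq \<Omega> v (\<lambda>x. u x - c *\<^sub>R wgrad \<Omega> q x)" and f: "f \<in> H1 \<Omega>"
    and orth: "(LINT x|lebesgue_on \<Omega>. wgrad \<Omega> q x \<bullet> wgrad \<Omega> f x) = \<kappa> * (LINT x|lebesgue_on \<Omega>. u x \<bullet> wgrad \<Omega> f x)"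
  shows "v \<in> L2 \<Omega>" "(LINT x|lebesgue_on \<Omega>. v x \<bullet> wgrad \<Omega> f x) = 0"
proof -
  have w: "(\<lambda>x. u x - c *\<^sub>R wgrad \<Omega> q x) \<in> L2 \<Omega>"
    by (intro L2_diff L2_scaleR u wgrad_L2[OF q])
  show "v \<in> L2 \<Omega>" by (rule L2_cong_AE[OF w ae_eq_sym[OF v]])
  have "(LINT x|lebesgue_on \<Omega>. v x \<bullet> wgrad \<Omega> f x) = (LINT x|lebesgue_on \<Omega>. (u x - c *\<^sub>R wgrad \<Omega> q x) \<bullet> wgrad \<Omega> f x)"
    by (rule integral_inner_cong_AE[OF w wgrad_L2[OF f] ae_eq_sym[OF v]])
  also have "\<dots> = (LINT x|lebesgue_on \<Omega>. u x \<bullet> wgrad \<Omega> f x) - c * (LINT x|lebesgue_on \<Omega>. wgrad \<Omega> q x \<bullet> wgrad \<Omega> f x)"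
    using L2_inner_integrable[OF u wgrad_L2[OF f]] L2_inner_integrable[OF wgrad_L2[OF q] wgrad_L2[OF f]]
    by (simp add: inner_diff_left)
  also have "\<dots> = 0" using c by (simp add: orth mult.assoc[symmetric])
  finally show "(LINT x|lebesgue_on \<Omega>. v x \<bullet> wgrad \<Omega> f x) = 0" .
qed

end

lemma C1_on_continuous: "C1_on I f \<Longrightarrow> continuous_on I f"
  unfolding C1_on_def by (auto intro: DERIV_continuous_on)

section \<open>Induction over the time steps\<close>

theorem theorem3:
  fixes \<Omega> :: "(real^3) set"
    and T \<delta>t r \<theta> \<rho>1 \<rho>2 \<mu>1 \<mu>2 \<alpha>1 \<alpha>2 :: real
    and N :: nat
    and \<mu> \<alpha> :: "real \<Rightarrow> real"
    and \<rho>0 :: "real^3 \<Rightarrow> real" and u0 :: "real^3 \<Rightarrow> real^3"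
    and \<rho> q p :: "nat \<Rightarrow> real^3 \<Rightarrow> real"
    and u uh :: "nat \<Rightarrow> real^3 \<Rightarrow> real^3"
    and S :: "nat \<Rightarrow> real^3 \<Rightarrow> real^3^3"
  assumes "open \<Omega>" "connected \<Omega>" "bounded \<Omega>" "\<Omega> \<noteq> {}"
    and "0 < T" "0 < N" and dt: "\<delta>t = T / real N"
    and "0 < r" "0 < \<theta>"
    and "0 < \<mu>1" "0 < \<mu>2" "0 \<le> \<alpha>1" "0 \<le> \<alpha>2"
    and "C1_on {\<rho>1..\<rho>2} \<mu>" "C1_on {\<rho>1..\<rho>2} \<alpha>"
    and "\<forall>s\<in>{\<rho>1..\<rho>2}. 0 < \<mu> s \<and> \<mu>1 \<le> \<mu> s \<and> \<mu> s \<le> \<mu>2"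
    and "\<forall>s\<in>{\<rho>1..\<rho>2}. 0 \<le> \<alpha> s \<and> \<alpha>1 \<le> \<alpha> s \<and> \<alpha> s \<le> \<alpha>2"
    and "0 < \<rho>1" "\<rho>0 \<in> Linf \<Omega>" "AE x in lebesgue_on \<Omega>. \<rho>1 \<le> \<rho>0 x \<and> \<rho>0 x \<le> \<rho>2"
    and "u0 \<in> vecH10 \<Omega>" "AE x in lebesgue_on \<Omega>. wdiv \<Omega> u0 x = 0"
    and "bi_projection_scheme \<Omega> \<delta>t N \<rho>1 r \<theta> \<mu> \<alpha> \<rho>0 u0 \<rho> u uh q p S"
    and "r * (\<alpha>2\<^sup>2 / \<mu>1) \<le> 3/2" "\<theta> \<le> 1/2"
  shows "\<forall>n\<in>{1..N}.
      (l2norm \<Omega> (\<lambda>x. sqrt (\<rho> n x) *\<^sub>R u n x))\<^sup>2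
      + \<delta>t * (\<Sum>k=0..n-1. (tensor_l2norm \<Omega>
            (\<lambda>x. sqrt (2 * \<mu> (\<rho> (k+1) x)) *\<^sub>R symgrad \<Omega> (u (k+1)) x))\<^sup>2)
      + \<delta>t\<^sup>2 / \<rho>1 * (l2norm \<Omega> (wgrad \<Omega> (p n)))\<^sup>2
      + 2 * \<theta> / r * \<delta>t * (tensor_l2norm \<Omega> (S n))\<^sup>2
    \<le> (l2norm \<Omega> (\<lambda>x. sqrt (\<rho> 0 x) *\<^sub>R u 0 x))\<^sup>2
      + \<delta>t\<^sup>2 / \<rho>1 * (l2norm \<Omega> (wgrad \<Omega> (p 0)))\<^sup>2
      + 2 * \<theta> / r * \<delta>t * (tensor_l2norm \<Omega> (S 0))\<^sup>2"
proof -
  interpret bounded_open \<Omega> by unfold_locales fact+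
  have dt0: "0 < \<delta>t" using \<open>0 < T\<close> \<open>0 < N\<close> dt by simp
  note scheme = \<open>bi_projection_scheme \<Omega> \<delta>t N \<rho>1 r \<theta> \<mu> \<alpha> \<rho>0 u0 \<rho> u uh q p S\<close>
  have init: "ae_eq \<Omega> (\<rho> 0) \<rho>0" "ae_eq \<Omega> (u 0) u0" "ae_eq \<Omega> (uh 0) u0" "ae_eq \<Omega> (q 0) (\<lambda>x. 0)"
    "p 0 \<in> H1 \<Omega>" "S 0 \<in> tensorLam \<Omega>"
    and steps: "\<And>n. n < N \<Longrightarrow> bi_projection_step \<Omega> \<delta>t \<rho>1 r \<theta> \<mu> \<alpha> \<rho> u uh q p S n"
    using scheme by (auto simp: bi_projection_scheme_def)
  have \<mu>: "continuous_on {\<rho>1..\<rho>2} \<mu>" "\<forall>s\<in>{\<rho>1..\<rho>2}. 0 \<le> \<mu> s \<and> \<mu> s \<le> \<mu>2"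
    and \<alpha>: "continuous_on {\<rho>1..\<rho>2} \<alpha>" "\<forall>s\<in>{\<rho>1..\<rho>2}. 0 \<le> \<alpha> s \<and> \<alpha> s \<le> \<alpha>2"
    using assms by (auto intro: C1_on_continuous less_imp_le)
  \<comment> \<open>Besides the density bounds, a step needs two relations from the past: the
    orthogonality of \<open>uh n\<close> for the maximum principle, and the Poisson relation between
    \<open>q n\<close> and \<open>u n\<close> for the pressure work.\<close>
  define inv where "inv n \<longleftrightarrow> \<rho> n \<in> borel_measurable (lebesgue_on \<Omega>) \<and>
      (AE x in lebesgue_on \<Omega>. \<rho>1 \<le> \<rho> n x \<and> \<rho> n x \<le> \<rho>2) \<and> u n \<in> L2 \<Omega> \<and> uh n \<in> L2 \<Omega> \<and>
      (\<forall>\<phi>\<in>H1 \<Omega>. (LINT x|lebesgue_on \<Omega>. uh n x \<bullet> wgrad \<Omega> \<phi> x) = 0) \<and>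
      p n \<in> H1 \<Omega> \<and> q n \<in> H1 \<Omega> \<and> S n \<in> tensorLam \<Omega> \<and>
      (\<forall>\<phi>\<in>H1 \<Omega>. (LINT x|lebesgue_on \<Omega>. wgrad \<Omega> (q n) x \<bullet> wgrad \<Omega> \<phi> x)
        = \<rho>1 / \<delta>t * (LINT x|lebesgue_on \<Omega>. u n x \<bullet> wgrad \<Omega> \<phi> x))" for n
  define V where "V n = (tensor_l2norm \<Omega> (\<lambda>x. sqrt (2 * \<mu> (\<rho> n x)) *\<^sub>R symgrad \<Omega> (u n) x))\<^sup>2" for n
  define E where "E n = (l2norm \<Omega> (\<lambda>x. sqrt (\<rho> n x) *\<^sub>R u n x))\<^sup>2
      + \<delta>t\<^sup>2 / \<rho>1 * (l2norm \<Omega> (wgrad \<Omega> (p n)))\<^sup>2 + 2 * \<theta> / r * \<delta>t * (tensor_l2norm \<Omega> (S n))\<^sup>2" for n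
  have inv0: "inv 0"
  proof -
    have u0: "u0 \<in> L2 \<Omega>" using assms by (auto dest: vecH10D(3))
    have orth0: "(LINT x|lebesgue_on \<Omega>. v x \<bullet> wgrad \<Omega> \<phi> x) = 0"
      if "ae_eq \<Omega> v u0" "\<phi> \<in> H1 \<Omega>" for v \<phi>
      using integral_inner_cong_AE[OF u0 wgrad_L2[OF that(2)] ae_eq_sym[OF that(1)]]
        solenoidal_orthogonal[OF \<open>u0 \<in> vecH10 \<Omega>\<close> \<open>AE x in lebesgue_on \<Omega>. wdiv \<Omega> u0 x = 0\<close> that(2)] by simp
    have q0: "q 0 \<in> H1 \<Omega>" "ae_eq \<Omega> (wgrad \<Omega> (q 0)) (\<lambda>x. 0)"
      using H1_cong_AE[OF H1_const(1)[of 0] ae_eq_sym[OF init(4)]] ae_eq_trans[OF _ H1_const(2)] by auto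
    \<comment> \<open>No Poisson problem has been solved at time 0. Its relation nevertheless holds
      with both sides zero, since \<open>q 0\<close> vanishes and the initial velocity is
      solenoidal.\<close>
    have "(LINT x|lebesgue_on \<Omega>. wgrad \<Omega> (q 0) x \<bullet> wgrad \<Omega> \<phi> x) = 0" if "\<phi> \<in> H1 \<Omega>" for \<phi>
      using integral_inner_cong_AE[OF L2_const wgrad_L2[OF that] ae_eq_sym[OF q0(2)]] by simp
    moreover have "\<rho> 0 \<in> borel_measurable (lebesgue_on \<Omega>)"
      using borel_measurable_lebesgue_on_AE[OF \<Omega>_sets(1) LinfD(1)[OF \<open>\<rho>0 \<in> Linf \<Omega>\<close>]] ae_eq_sym[OF init(1)]
      by (simp add: ae_eq_def)
    moreover have "AE x in lebesgue_on \<Omega>. \<rho>1 \<le> \<rho> 0 x \<and> \<rho> 0 x \<le> \<rho>2"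
      using init(1) \<open>AE x in lebesgue_on \<Omega>. \<rho>1 \<le> \<rho>0 x \<and> \<rho>0 x \<le> \<rho>2\<close> unfolding ae_eq_def
      by eventually_elim simp
    ultimately show ?thesis
      unfolding inv_def using init(5,6) q0(1) orth0[OF init(2)] orth0[OF init(3)]
        L2_cong_AE[OF u0 ae_eq_sym[OF init(2)]] L2_cong_AE[OF u0 ae_eq_sym[OF init(3)]] by simp
  qed
  have step: "inv (Suc n) \<and> E (Suc n) + \<delta>t * V (Suc n) \<le> E n" if n: "n < N" and i: "inv n" for n
  proof -
    note st = steps[OF n, unfolded bi_projection_step_def]
    have dens: "density_step \<Omega> \<delta>t (uh n) (\<rho> n) (\<rho> (Suc n))"
      and uS: "u (Suc n) \<in> vecH10 \<Omega>" and SS: "S (Suc n) \<in> tensorLam \<Omega>"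
      and mom: "momentum_equation \<Omega> \<delta>t (\<rho> n) (\<rho> (Suc n)) (u n) (\<lambda>x. \<rho> (Suc n) x *\<^sub>R uh n x)
         (\<lambda>x. p n x + q n x) (\<lambda>x. \<mu> (\<rho> (Suc n) x)) (\<lambda>x. \<alpha> (\<rho> (Suc n) x)) (u (Suc n)) (S (Suc n))"
      and proj: "ae_eq \<Omega> (S (Suc n)) (\<lambda>x. proj_Lam (S (Suc n) x
         + (r * \<alpha> (\<rho> (Suc n) x)) *\<^sub>R symgrad \<Omega> (u (Suc n)) x + \<theta> *\<^sub>R (S n x - S (Suc n) x)))"
      and poisson: "neumann_poisson \<Omega> (\<lambda>x. \<rho>1 / \<delta>t * wdiv \<Omega> (u (Suc n)) x) (q (Suc n))"
      and pS: "ae_eq \<Omega> (p (Suc n)) (\<lambda>x. p n x + q (Suc n) x)"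
      and uhS: "ae_eq \<Omega> (uh (Suc n)) (\<lambda>x. u (Suc n) x - (\<delta>t / \<rho>1) *\<^sub>R wgrad \<Omega> (q (Suc n)) x)"
      using st by blast+
    have rho: "\<rho> n \<in> borel_measurable (lebesgue_on \<Omega>)" "AE x in lebesgue_on \<Omega>. \<rho>1 \<le> \<rho> n x \<and> \<rho> n x \<le> \<rho>2"
      and L: "u n \<in> L2 \<Omega>" "uh n \<in> L2 \<Omega>"
      and H: "p n \<in> H1 \<Omega>" "q n \<in> H1 \<Omega>" and Sn: "S n \<in> tensorLam \<Omega>"
      and sol: "\<And>\<phi>. \<phi> \<in> H1 \<Omega> \<Longrightarrow> (LINT x|lebesgue_on \<Omega>. uh n x \<bullet> wgrad \<Omega> \<phi> x) = 0"
      and orth: "\<And>\<phi>. \<phi> \<in> H1 \<Omega> \<Longrightarrow> (LINT x|lebesgue_on \<Omega>. wgrad \<Omega> (q n) x \<bullet> wgrad \<Omega> \<phi> x)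
        = \<rho>1 / \<delta>t * (LINT x|lebesgue_on \<Omega>. u n x \<bullet> wgrad \<Omega> \<phi> x)"
      using i unfolding inv_def by blast+
    note rho' = density_step_bounds[OF dens dt0 L(2) sol rho]
    have qS: "q (Suc n) \<in> H1 \<Omega>" using poisson by (simp add: neumann_poisson_def)
    note orth' = neumann_poisson_orthogonal[OF poisson uS]
    have c: "\<delta>t / \<rho>1 * (\<rho>1 / \<delta>t) = 1" using dt0 \<open>0 < \<rho>1\<close> by simp
    note uhS' = corrected_velocity_orthogonal[OF vecH10D(3)[OF uS] qS c uhS]
    have "p (Suc n) \<in> H1 \<Omega>" by (rule H1_cong_AE(1)[OF H1_add(1)[OF H(1) qS] ae_eq_sym[OF pS]])
    moreover have "uh (Suc n) \<in> L2 \<Omega>" by (rule uhS'(1)[OF qS orth'[OF qS]])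
    moreover have "(LINT x|lebesgue_on \<Omega>. uh (Suc n) x \<bullet> wgrad \<Omega> \<phi> x) = 0" if "\<phi> \<in> H1 \<Omega>" for \<phi>
      by (rule uhS'(2)[OF that orth'[OF that]])
    ultimately have "inv (Suc n)"
      unfolding inv_def using rho' vecH10D(3)[OF uS] qS SS orth' by simp
    moreover have "E (Suc n) + \<delta>t * V (Suc n) \<le> E n"
      using energy_step[OF dt0 \<open>0 < r\<close> less_imp_le[OF \<open>0 < \<theta>\<close>] \<open>0 < \<rho>1\<close> rho rho'
          coefficient_Linf[OF \<mu>(1) rho' \<mu>(2)] coefficient_Linf(1)[OF \<alpha>(1) rho' \<alpha>(2)]
          L(1) uS Sn SS H qS pS mom proj orth orth']
      unfolding E_def V_def by simp
    ultimately show ?thesis ..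
  qed
  have total: "inv n \<and> E n + \<delta>t * (\<Sum>k<n. V (Suc k)) \<le> E 0" if "n \<le> N" for n
    using that
  proof (induction n)
    case 0
    then show ?case using inv0 by simp
  next
    case (Suc n)
    then show ?case using step[of n] by (simp add: distrib_left)
  qed
  show ?thesis
  proof
    fix n assume n: "n \<in> {1..N}"
    \<comment> \<open>Truncated subtraction makes this identity depend on \<open>n\<close> being
      positive.\<close>
    then have "{0..n - 1} = {..<n}" by auto
    then show "(l2norm \<Omega> (\<lambda>x. sqrt (\<rho> n x) *\<^sub>R u n x))\<^sup>2
      + \<delta>t * (\<Sum>k=0..n-1. (tensor_l2norm \<Omega>
            (\<lambda>x. sqrt (2 * \<mu> (\<rho> (k+1) x)) *\<^sub>R symgrad \<Omega> (u (k+1)) x))\<^sup>2)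
      + \<delta>t\<^sup>2 / \<rho>1 * (l2norm \<Omega> (wgrad \<Omega> (p n)))\<^sup>2
      + 2 * \<theta> / r * \<delta>t * (tensor_l2norm \<Omega> (S n))\<^sup>2
    \<le> (l2norm \<Omega> (\<lambda>x. sqrt (\<rho> 0 x) *\<^sub>R u 0 x))\<^sup>2
      + \<delta>t\<^sup>2 / \<rho>1 * (l2norm \<Omega> (wgrad \<Omega> (p 0)))\<^sup>2
      + 2 * \<theta> / r * \<delta>t * (tensor_l2norm \<Omega> (S 0))\<^sup>2"
      using total[of n] n unfolding E_def V_def by simp
  qed
qed

end
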